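(* There is an absolute constant $C>0$ such that the following holds. Let $\mathcal M$ be a Markov potential game with $\inf_\theta\min_{s\in\mathcal S}d_\theta(s)>0$, and suppose that the stationary policies of $\mathcal M$ are isolated. Let $M=\sup_\theta\max_s\frac1{d_\theta(s)}$ and, for a trajectory $(\theta^{(t)})_{t\ge0}$, let $c=\inf_{t\ge0}c(\theta^{(t)})$. (i) If $\theta^{(t)}$ is generated by gradient play $\theta_i^{(t+1)}=\theta_i^{(t)}+\eta\nabla_{\theta_i}J_i(\theta^{(t)})$ (all $i\in N$) with $\eta=\frac{(1-\gamma)^3}{6n}$, then for all $T\ge1$, $$\frac1T\sum_{t=0}^{T-1}\mathrm{NEgap}(\theta^{(t)})^2\le C\,\frac{n\max_i|\mathcal A_i|\,(\phi_{\max}-\phi_{\min})M^2}{(1-\gamma)^4c^2T}.$$ (ii) If the policies $\pi^{(t)}=\pi_{\theta^{(t)}}$ are generated by natural gradient play $\pi_i^{(t+1)}(a_i|s)\propto\pi_i^{(t)}(a_i|s)\exp\left(\frac{\eta\,\overline{A_i^{\theta^{(t)}}}(s,a_i)}{1-\gamma}\right)$ (all $i,s,a_i$) with $\eta=\frac{(1-\gamma)^2}{2n(\phi_{\max}-\phi_{\min})}$, then for all $T\ge1$, $$\frac1T\sum_{t=0}^{T-1}\mathrm{NEgap}(\theta^{(t)})^2\le C\,\frac{n(\phi_{\max}-\phi_{\min})^2M}{(1-\gamma)^3c\,T}.$$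
   Context: Stochastic game: $\mathcal M=(N,\mathcal S,\mathcal A,P,r,\gamma,\rho)$ with agents $N=\{1,\dots,n\}$, finite state space $\mathcal S$, finite action sets $\mathcal A_i$, $\mathcal A=\mathcal A_1\times\dots\times\mathcal A_n$, transition probabilities $P(s'|s,a)$, rewards $r_i:\mathcal S\times\mathcal A\to[0,1]$, discount $\gamma\in[0,1)$, and initial state distribution $\rho$ on $\mathcal S$. A decentralized policy is $\pi=\pi_1\times\dots\times\pi_n$ with $\pi_i(\cdot|s)$ a probability distribution on $\mathcal A_i$ for each $s$ and $\pi(a|s)=\prod_i\pi_i(a_i|s)$; $\pi_{-i}(a_{-i}|s)=\prod_{j\ne i}\pi_j(a_j|s)$. Softmax parameterization: $\theta=(\theta_1,\dots,\theta_n)$, $\theta_i=(\theta_{s,a_i})_{s\in\mathcal S,a_i\in\mathcal A_i}$ real, $\pi_{\theta_i}(a_i|s)=e^{\theta_{s,a_i}}/\sum_{a_i'}e^{\theta_{s,a_i'}}$, $\pi_\theta=\pi_{\theta_1}\times\dots\times\pi_{\theta_n}$. For a decentralized policy $\pi$ (superscript $\theta$ when $\pi=\pi_\theta$): $V_i^\pi(s)=\mathbb E[\sum_{t\ge0}\gamma^tr_i(s(t),a(t))\mid\pi,s(0)=s]$, $Q_i^\pi(s,a)=\mathbb E[\sum_{t\ge0}\gamma^tr_i(s(t),a(t))\mid\pi,s(0)=s,a(0)=a]$, $A_i^\pi=Q_i^\pi-V_i^\pi$, $\overline{Q_i^\pi}(s,a_i)=\sum_{a_{-i}}\pi_{-i}(a_{-i}|s)Q_i^\pi(s,a_i,a_{-i})$,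 $\overline{A_i^\pi}(s,a_i)=\sum_{a_{-i}}\pi_{-i}(a_{-i}|s)A_i^\pi(s,a_i,a_{-i})$, $J_i(\theta)=\mathbb E_{s\sim\rho}V_i^\theta(s)$, $d_\theta(s)=(1-\gamma)\,\mathbb E_{s(0)\sim\rho}\sum_{t\ge0}\gamma^t\Pr^{\pi_\theta}(s(t)=s|s(0))$. $\mathrm{NEgap}_i(\theta)=\sup_{\theta_i'}J_i(\theta_i',\theta_{-i})-J_i(\theta_i,\theta_{-i})$, $\mathrm{NEgap}(\theta)=\max_i\mathrm{NEgap}_i(\theta)$. $c(\theta)=\min_{i\in N}\min_{s\in\mathcal S}\sum_{a_i^*\in\arg\max_{a_i}\overline{Q_i^\theta}(s,a_i)}\pi_{\theta_i}(a_i^*|s)$. Bounds with $c$ in the denominator are read as $+\infty$ if $c=0$. $\mathcal M$ is a Markov potential game if there is $\phi:\mathcal S\times\mathcal A\to\mathbb R$ such that for all $i$, all $s$, all $(\theta_i',\theta_{-i}),(\theta_i,\theta_{-i})$, the difference $V_i^{(\theta_i',\theta_{-i})}(s)-V_i^{(\theta_i,\theta_{-i})}(s)$ equals the same difference with $r_i$ replaced by $\phi$. The constants satisfy $\phi_{\min}\le\phi(s,a)\le\phi_{\max}$ for all $(s,a)$, with $\phi_{\min}<\phi_{\max}$. The set of stationary policies is the set of decentralized policies $\pi$ (boundary of the simplices included) with $\pi_i(a_i|s)\overline{A_i^\pi}(s,a_i)=0$ for all $s,i,a_i$. "The stationary policies are isolated" means every point of this set is an isolated point of it. *)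

theory Defs
  imports "HOL-Probability.Probability"
begin

text \<open>
  The number of agents, the number of states and the sizes of the action sets are data of the
  game, not types, because the constant of the main statement is uniform in all of them.  States
  and actions are natural numbers.  A joint action is an element of
  \<open>PiE (agents G) (acts G)\<close>; only values at such arguments and at states in
  \<open>states G\<close> are meaningful.
\<close>

record stochastic_game =
  num_agents :: nat
  states :: "nat set"
  acts :: "nat \<Rightarrow> nat set"
  trans_prob :: "nat \<Rightarrow> (nat \<Rightarrow> nat) \<Rightarrow> nat pmf"
  reward :: "nat \<Rightarrow> nat \<Rightarrow> (nat \<Rightarrow> nat) \<Rightarrow> real"
  discount :: real
  init_dist :: "nat pmf"

definition agents :: "stochastic_game \<Rightarrow> nat set" where
  "agents G = {1..num_agents G}"

definition joint_acts :: "stochastic_game \<Rightarrow> (nat \<Rightarrow> nat) set" where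
  "joint_acts G = PiE (agents G) (acts G)"

text \<open>Nonemptiness of the state space follows from the condition on \<open>init_dist\<close>.\<close>

definition is_game :: "stochastic_game \<Rightarrow> bool" where
  "is_game G \<longleftrightarrow>
     num_agents G \<ge> 1 \<and>
     finite (states G) \<and>
     (\<forall>i\<in>agents G. finite (acts G i) \<and> acts G i \<noteq> {}) \<and>
     (\<forall>s\<in>states G. \<forall>a\<in>joint_acts G. set_pmf (trans_prob G s a) \<subseteq> states G) \<and>
     (\<forall>i\<in>agents G. \<forall>s\<in>states G. \<forall>a\<in>joint_acts G. reward G i s a \<in> {0..1}) \<and>
     0 \<le> discount G \<and> discount G < 1 \<and>
     set_pmf (init_dist G) \<subseteq> states G"

text \<open>
  A decentralized policy is the family of its factors, \<open>\<pi> i s a\<close> being the probability that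
  agent \<open>i\<close> plays \<open>a\<close> in state \<open>s\<close>.  Irrelevant entries are fixed to be zero, so that the product
  topology on the function space induces on \<open>dec_policies G\<close> the Euclidean topology of the
  product of simplices.
\<close>

type_synonym policy = "nat \<Rightarrow> nat \<Rightarrow> nat \<Rightarrow> real"

definition dec_policies :: "stochastic_game \<Rightarrow> policy set" where
  "dec_policies G = {\<pi>.
     (\<forall>i\<in>agents G. \<forall>s\<in>states G. (\<forall>a\<in>acts G i. 0 \<le> \<pi> i s a) \<and> (\<Sum>a\<in>acts G i. \<pi> i s a) = 1) \<and>
     (\<forall>i s a. \<not> (i \<in> agents G \<and> s \<in> states G \<and> a \<in> acts G i) \<longrightarrow> \<pi> i s a = 0)}"

text \<open>Parameters are likewise written \<open>\<theta> i s a\<close>; irrelevant entries are unconstrained.\<close>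

type_synonym param = "nat \<Rightarrow> nat \<Rightarrow> nat \<Rightarrow> real"

definition softmax :: "stochastic_game \<Rightarrow> param \<Rightarrow> policy" where
  "softmax G \<theta> i s a =
     (if i \<in> agents G \<and> s \<in> states G \<and> a \<in> acts G i
      then exp (\<theta> i s a) / (\<Sum>b\<in>acts G i. exp (\<theta> i s b)) else 0)"

definition action_pmf :: "stochastic_game \<Rightarrow> policy \<Rightarrow> nat \<Rightarrow> (nat \<Rightarrow> nat) pmf" where
  "action_pmf G \<pi> s = Pi_pmf (agents G) undefined (\<lambda>i. embed_pmf (\<pi> i s))"

definition step_pmf ::
    "stochastic_game \<Rightarrow> policy \<Rightarrow> nat \<times> (nat \<Rightarrow> nat) \<Rightarrow> (nat \<times> (nat \<Rightarrow> nat)) pmf" where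
  "step_pmf G \<pi> = (\<lambda>(s, a).
     bind_pmf (trans_prob G s a) (\<lambda>s'. map_pmf (Pair s') (action_pmf G \<pi> s')))"

text \<open>
  The law of the trajectory of state-action pairs under \<open>\<pi>\<close>, when \<open>\<mu>\<close> is the law of the pair at
  time 0, given by the theorem of Ionescu-Tulcea.
\<close>

definition traj_kernel ::
    "stochastic_game \<Rightarrow> policy \<Rightarrow> (nat \<times> (nat \<Rightarrow> nat)) pmf \<Rightarrow>
     nat \<Rightarrow> (nat \<Rightarrow> nat \<times> (nat \<Rightarrow> nat)) \<Rightarrow> (nat \<times> (nat \<Rightarrow> nat)) measure" where
  "traj_kernel G \<pi> \<mu> t \<omega> =
     measure_pmf (case t of 0 \<Rightarrow> \<mu> | Suc k \<Rightarrow> step_pmf G \<pi> (\<omega> k))"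

lemma Ionescu_Tulcea_traj_kernel:
  "Ionescu_Tulcea (traj_kernel G \<pi> \<mu>) (\<lambda>_. count_space UNIV)"
proof (unfold Ionescu_Tulcea_def, intro conjI allI impI)
  show "traj_kernel G \<pi> \<mu> t \<in> measurable (PiM {0..<t} (\<lambda>_. count_space UNIV))
          (subprob_algebra (count_space UNIV))" for t
  proof (cases t)
    case 0
    have "measure_pmf \<mu> \<in> space (subprob_algebra (count_space UNIV))"
      by (rule measure_pmf_in_subprob_algebra)
    then show ?thesis
      by (simp add: 0 traj_kernel_def[abs_def])
  next
    case (Suc k)
    have "(\<lambda>\<omega>::nat \<Rightarrow> nat \<times> (nat \<Rightarrow> nat). \<omega> k) \<in>
        measurable (PiM {0..<t} (\<lambda>_. count_space UNIV)) (count_space UNIV)"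
      by (rule measurable_component_singleton) (simp add: Suc)
    moreover have "(\<lambda>p. measure_pmf (step_pmf G \<pi> p)) \<in>
        measurable (count_space UNIV) (subprob_algebra (count_space UNIV))"
      by (simp add: measure_pmf_in_subprob_algebra)
    ultimately show ?thesis
      unfolding traj_kernel_def[abs_def] Suc nat.case by (rule measurable_compose)
  qed
  show "prob_space (traj_kernel G \<pi> \<mu> t \<omega>)" for t \<omega>
    unfolding traj_kernel_def by (rule prob_space_measure_pmf)
qed

definition traj_measure ::
    "stochastic_game \<Rightarrow> policy \<Rightarrow> (nat \<times> (nat \<Rightarrow> nat)) pmf \<Rightarrow>
     (nat \<Rightarrow> nat \<times> (nat \<Rightarrow> nat)) measure" where
  "traj_measure G \<pi> \<mu> =
     projective_family.lim UNIV
       (Ionescu_Tulcea.CI (traj_kernel G \<pi> \<mu>) (\<lambda>_. count_space UNIV)) (\<lambda>_. count_space UNIV)"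

definition start_at :: "stochastic_game \<Rightarrow> policy \<Rightarrow> nat \<Rightarrow> (nat \<times> (nat \<Rightarrow> nat)) pmf" where
  "start_at G \<pi> s = map_pmf (Pair s) (action_pmf G \<pi> s)"

text \<open>
  The function \<open>R\<close> below is \<open>reward G i\<close> for the value functions of agent \<open>i\<close>, and the potential
  for those in which the reward is replaced by the potential.
\<close>

definition discounted_return ::
    "stochastic_game \<Rightarrow> (nat \<Rightarrow> (nat \<Rightarrow> nat) \<Rightarrow> real) \<Rightarrow>
     (nat \<Rightarrow> nat \<times> (nat \<Rightarrow> nat)) \<Rightarrow> real" where
  "discounted_return G R \<omega> = (\<Sum>t. discount G ^ t * R (fst (\<omega> t)) (snd (\<omega> t)))"

definition V_fun ::
    "stochastic_game \<Rightarrow> (nat \<Rightarrow> (nat \<Rightarrow> nat) \<Rightarrow> real) \<Rightarrow> policy \<Rightarrow> nat \<Rightarrow> real" where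
  "V_fun G R \<pi> s = (\<integral>\<omega>. discounted_return G R \<omega> \<partial>traj_measure G \<pi> (start_at G \<pi> s))"

definition Q_fun ::
    "stochastic_game \<Rightarrow> (nat \<Rightarrow> (nat \<Rightarrow> nat) \<Rightarrow> real) \<Rightarrow> policy \<Rightarrow>
     nat \<Rightarrow> (nat \<Rightarrow> nat) \<Rightarrow> real" where
  "Q_fun G R \<pi> s a = (\<integral>\<omega>. discounted_return G R \<omega> \<partial>traj_measure G \<pi> (return_pmf (s, a)))"

definition A_fun ::
    "stochastic_game \<Rightarrow> (nat \<Rightarrow> (nat \<Rightarrow> nat) \<Rightarrow> real) \<Rightarrow> policy \<Rightarrow>
     nat \<Rightarrow> (nat \<Rightarrow> nat) \<Rightarrow> real" where
  "A_fun G R \<pi> s a = Q_fun G R \<pi> s a - V_fun G R \<pi> s"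

definition avg_others ::
    "stochastic_game \<Rightarrow> nat \<Rightarrow> policy \<Rightarrow> (nat \<Rightarrow> (nat \<Rightarrow> nat) \<Rightarrow> real) \<Rightarrow>
     nat \<Rightarrow> nat \<Rightarrow> real" where
  "avg_others G i \<pi> F s a =
     (\<Sum>b\<in>PiE (agents G - {i}) (acts G). (\<Prod>j\<in>agents G - {i}. \<pi> j s (b j)) * F s (b(i := a)))"

definition Q_avg :: "stochastic_game \<Rightarrow> nat \<Rightarrow> policy \<Rightarrow> nat \<Rightarrow> nat \<Rightarrow> real" where
  "Q_avg G i \<pi> = avg_others G i \<pi> (Q_fun G (reward G i) \<pi>)"

definition A_avg :: "stochastic_game \<Rightarrow> nat \<Rightarrow> policy \<Rightarrow> nat \<Rightarrow> nat \<Rightarrow> real" where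
  "A_avg G i \<pi> = avg_others G i \<pi> (A_fun G (reward G i) \<pi>)"

definition J_fun :: "stochastic_game \<Rightarrow> nat \<Rightarrow> param \<Rightarrow> real" where
  "J_fun G i \<theta> =
     measure_pmf.expectation (init_dist G) (V_fun G (reward G i) (softmax G \<theta>))"

definition visit :: "stochastic_game \<Rightarrow> param \<Rightarrow> nat \<Rightarrow> real" where
  "visit G \<theta> s = (1 - discount G) * measure_pmf.expectation (init_dist G) (\<lambda>s0.
     \<Sum>t. discount G ^ t *
       \<P>(\<omega> in traj_measure G (softmax G \<theta>) (start_at G (softmax G \<theta>) s0). fst (\<omega> t) = s))"

definition NEgap_agent :: "stochastic_game \<Rightarrow> nat \<Rightarrow> param \<Rightarrow> real" where
  "NEgap_agent G i \<theta> = (SUP \<theta>i. J_fun G i (\<theta>(i := \<theta>i))) - J_fun G i \<theta>"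

definition NEgap :: "stochastic_game \<Rightarrow> param \<Rightarrow> real" where
  "NEgap G \<theta> = (MAX i\<in>agents G. NEgap_agent G i \<theta>)"

definition c_fun :: "stochastic_game \<Rightarrow> param \<Rightarrow> real" where
  "c_fun G \<theta> = (MIN i\<in>agents G. MIN s\<in>states G.
     \<Sum>a\<in>{a. is_arg_max (Q_avg G i (softmax G \<theta>) s) (\<lambda>a. a \<in> acts G i) a}. softmax G \<theta> i s a)"

definition potential :: "stochastic_game \<Rightarrow> (nat \<Rightarrow> (nat \<Rightarrow> nat) \<Rightarrow> real) \<Rightarrow> bool" where
  "potential G \<phi> \<longleftrightarrow> (\<forall>i\<in>agents G. \<forall>s\<in>states G. \<forall>\<theta> \<theta>i.
     V_fun G (reward G i) (softmax G (\<theta>(i := \<theta>i))) s - V_fun G (reward G i) (softmax G \<theta>) s =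
     V_fun G \<phi> (softmax G (\<theta>(i := \<theta>i))) s - V_fun G \<phi> (softmax G \<theta>) s)"

definition stationary_policies :: "stochastic_game \<Rightarrow> policy set" where
  "stationary_policies G = {\<pi> \<in> dec_policies G.
     \<forall>s\<in>states G. \<forall>i\<in>agents G. \<forall>a\<in>acts G i. \<pi> i s a * A_avg G i \<pi> s a = 0}"

definition grad_J :: "stochastic_game \<Rightarrow> nat \<Rightarrow> param \<Rightarrow> nat \<Rightarrow> nat \<Rightarrow> real" where
  "grad_J G i \<theta> s a = deriv (\<lambda>x. J_fun G i (\<theta>(i := (\<theta> i)(s := (\<theta> i s)(a := x))))) (\<theta> i s a)"

definition gradient_play :: "stochastic_game \<Rightarrow> real \<Rightarrow> (nat \<Rightarrow> param) \<Rightarrow> bool" where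
  "gradient_play G \<eta> \<theta> \<longleftrightarrow> (\<forall>t. \<forall>i\<in>agents G. \<forall>s\<in>states G. \<forall>a\<in>acts G i.
     \<theta> (Suc t) i s a = \<theta> t i s a + \<eta> * grad_J G i (\<theta> t) s a)"

definition npg_weight :: "stochastic_game \<Rightarrow> real \<Rightarrow> nat \<Rightarrow> policy \<Rightarrow> nat \<Rightarrow> nat \<Rightarrow> real" where
  "npg_weight G \<eta> i \<pi> s a = \<pi> i s a * exp (\<eta> * A_avg G i \<pi> s a / (1 - discount G))"

definition natural_gradient_play :: "stochastic_game \<Rightarrow> real \<Rightarrow> (nat \<Rightarrow> param) \<Rightarrow> bool" where
  "natural_gradient_play G \<eta> \<theta> \<longleftrightarrow> (\<forall>t. \<forall>i\<in>agents G. \<forall>s\<in>states G. \<forall>a\<in>acts G i.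
     softmax G (\<theta> (Suc t)) i s a =
       npg_weight G \<eta> i (softmax G (\<theta> t)) s a /
       (\<Sum>b\<in>acts G i. npg_weight G \<eta> i (softmax G (\<theta> t)) s b))"

end

theory Submission
  imports Defs
begin

text \<open>
  Both dynamics climb the function \<open>\<Phi>(\<theta>)\<close>, the value \<open>start_value G \<phi> (softmax G \<theta>)\<close> of the
  potential from the initial distribution.  As \<open>\<Phi>\<close> takes values in an interval of length
  \<open>(\<phi>max - \<phi>min) / (1 - \<gamma>)\<close>, a bound \<open>NEgap\<^sup>2 \<le> K (\<Phi>(\<theta>') - \<Phi>(\<theta>))\<close> for every step from \<open>\<theta>\<close> to \<open>\<theta>'\<close>
  telescopes to the average bound \<open>K (\<phi>max - \<phi>min) / ((1 - \<gamma>) T)\<close>; this is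
  \<open>average_NEgap_sq_le\<close>.  It remains to find \<open>K\<close> for each of the two dynamics.

  The tool is the performance difference lemma: when a policy \<open>\<pi>\<close> is replaced by \<open>\<pi>'\<close>, the value
  changes by the mean advantage of \<open>\<pi>'\<close> over \<open>\<pi>\<close>, weighted with the state visitation of \<open>\<pi>'\<close> and
  divided by \<open>1 - \<gamma>\<close>.  It follows from the Bellman equations, which in turn follow from the
  description of the marginals of the trajectory measure by a recursion of probability mass
  functions.  Applied to a deviation of one agent it shows that the equilibrium gap is at most the
  largest averaged advantage divided by \<open>1 - \<gamma>\<close> (\<open>NEgap_agent_le\<close>), so the largest averaged
  advantage has to be bounded by the gain of \<open>\<Phi>\<close>.

  Gradient play.  The partial derivative of \<open>J_i\<close> at \<open>(s, a)\<close> is \<open>d(s) \<pi>_i(a|s) A_i(s, a) / (1 - \<gamma>)\<close>,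
  where \<open>d\<close> is the state visitation and \<open>A_i\<close> the averaged advantage (\<open>grad_J_eq\<close>).  Summed over
  the maximizing actions, which carry probability at least \<open>c\<close>, it bounds the largest advantage by
  \<open>M / c\<close> times a norm of the gradient (\<open>NEgap_sq_le_grad_sq\<close>).  The gain of \<open>\<Phi>\<close> is at least a
  multiple of the squared gradient, since the step size is so small that the second-order
  errors consume only a part of the first-order gain (\<open>gradient_step_ascent\<close>).  The step size is adapted to rewards in \<open>[0, 1]\<close>
  and not to the range of \<open>\<phi>\<close>.  For this reason the agents are moved one after the other: each such
  move changes \<open>\<Phi>\<close> exactly as it changes the value of the moving agent, and all errors are errors
  of the functions \<open>J_i\<close>.

  Natural gradient play.  The performance difference lemma for the joint move expresses the gain
  of \<open>\<Phi>\<close> by the advantage of \<open>\<phi>\<close>, a multilinear function of the agents' distributions.  Its linear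
  part is the sum of the agents' own gains, because the averaged advantages of \<open>\<phi>\<close> and of the
  rewards coincide (\<open>potential_A_avg\<close>).  The rest is quadratic in the \<open>l\<^sub>1\<close> distances moved, and
  a Pinsker type inequality for exponential tilts (\<open>tilt_l1_sq_le\<close>) bounds the squares of these
  distances by the gains; the step size is such that at most half of the linear part is lost.
  The gain of an agent is in turn at least a multiple of the second moment of its advantage
  (\<open>tilt_gain_ge\<close>), hence of \<open>c\<close> times the square of the largest advantage.
\<close>

section \<open>Exponential tilting of a probability vector\<close>

text \<open>
  With logits \<open>v\<close> added, a softmax distribution \<open>p\<close> becomes \<open>tilt A p v\<close>; a natural gradient step
  has the same form with \<open>v\<close> proportional to the advantage.
\<close>

definition tilt :: "'a set \<Rightarrow> ('a \<Rightarrow> real) \<Rightarrow> ('a \<Rightarrow> real) \<Rightarrow> 'a \<Rightarrow> real" where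
  "tilt A p v a = p a * exp (v a) / (\<Sum>b\<in>A. p b * exp (v b))"

text \<open>
  Both sides vanish at 1, and the derivative of their difference is \<open>(r - 1)\<^sup>2 / (r (r + 1)\<^sup>2)\<close>.
\<close>

lemma ln_ge_two_diff_over_sum:
  fixes r :: real
  assumes "1 \<le> r"
  shows "2 * (r - 1) / (r + 1) \<le> ln r"
proof -
  let ?f = "\<lambda>r::real. ln r - 2 * (r - 1) / (r + 1)"
  have "?f 1 \<le> ?f r"
  proof (rule DERIV_nonneg_imp_nondecreasing[OF assms])
    fix x :: real assume x: "1 \<le> x" "x \<le> r"
    have "(?f has_real_derivative (1 / x - (2 * (x + 1) - 2 * (x - 1)) / (x + 1)\<^sup>2)) (at x)"
      using x by (auto intro!: derivative_eq_intros simp: power2_eq_square)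
    moreover have "1 / x - (2 * (x + 1) - 2 * (x - 1)) / (x + 1)\<^sup>2 = (x - 1)\<^sup>2 / (x * (x + 1)\<^sup>2)"
    proof -
      have "1 / x - (2 * (x + 1) - 2 * (x - 1)) / (x + 1)\<^sup>2 =
          (1 * (x + 1)\<^sup>2 - (2 * (x + 1) - 2 * (x - 1)) * x) / (x * (x + 1)\<^sup>2)"
        using x by (intro diff_frac_eq) auto
      also have "1 * (x + 1)\<^sup>2 - (2 * (x + 1) - 2 * (x - 1)) * x = (x - 1)\<^sup>2" by algebra
      finally show ?thesis .
    qed
    ultimately show "\<exists>y. (?f has_real_derivative y) (at x) \<and> 0 \<le> y"
      using x by (intro exI[of _ "(x - 1)\<^sup>2 / (x * (x + 1)\<^sup>2)"]) auto
  qed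
  then show ?thesis by simp
qed

lemma diff_mult_ln_ratio_ge:
  fixes p q :: real
  assumes "0 < p" "0 < q"
  shows "2 * (q - p)\<^sup>2 / (p + q) \<le> (q - p) * (ln q - ln p)"
proof -
  have *: "2 * (y - x)\<^sup>2 / (x + y) \<le> (y - x) * (ln y - ln x)" if "0 < x" "x \<le> y" for x y :: real
  proof -
    have "2 * (y / x - 1) / (y / x + 1) \<le> ln (y / x)"
      using that by (intro ln_ge_two_diff_over_sum) simp
    moreover have "2 * (y / x - 1) / (y / x + 1) = 2 * (y - x) / (x + y)"
    proof -
      have "y / x - 1 = (y - x) / x" "y / x + 1 = (x + y) / x"
        using that by (simp_all add: field_simps)
      then show ?thesis using that by simp
    qed
    ultimately have "2 * (y - x) / (x + y) \<le> ln y - ln x"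
      using that by (simp add: ln_div)
    then have "(y - x) * (2 * (y - x) / (x + y)) \<le> (y - x) * (ln y - ln x)"
      using that by (intro mult_left_mono) auto
    then show ?thesis by (simp add: power2_eq_square mult_ac)
  qed
  show ?thesis
  proof (cases "p \<le> q")
    case True then show ?thesis using * assms by simp
  next
    case False
    then have "2 * (p - q)\<^sup>2 / (q + p) \<le> (p - q) * (ln p - ln q)" using * assms by simp
    moreover have "(p - q)\<^sup>2 = (q - p)\<^sup>2" by (rule power2_commute)
    ultimately show ?thesis by (simp add: algebra_simps)
  qed
qed

lemma exp_le_quadratic:
  fixes x :: real
  assumes "x \<le> 1"
  shows "exp x \<le> 1 + x + x\<^sup>2"
proof (cases "0 \<le> x")
  case True then show ?thesis using exp_bound[of x] assms by simp
next
  case False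
  have "exp x * (1 - x) \<le> exp x * exp (- x)"
    using exp_ge_add_one_self[of "- x"] by (intro mult_left_mono) auto
  also have "\<dots> \<le> 1 - x ^ 3"
    using False by (simp add: exp_minus power3_eq_cube mult_nonneg_nonpos)
  also have "\<dots> = (1 + x + x\<^sup>2) * (1 - x)" by algebra
  finally show ?thesis using False by simp
qed

context
  fixes A :: "'a set" and p v :: "'a \<Rightarrow> real"
  assumes A: "finite A" "A \<noteq> {}" and p_pos: "\<And>a. a \<in> A \<Longrightarrow> 0 < p a" and p_sum: "(\<Sum>a\<in>A. p a) = 1"
begin

lemma tilt_partition_pos: "0 < (\<Sum>b\<in>A. p b * exp (v b))"
  using A p_pos by (intro sum_pos) auto

lemma tilt_pos: "a \<in> A \<Longrightarrow> 0 < tilt A p v a"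
  unfolding tilt_def using tilt_partition_pos p_pos by simp

lemma tilt_sum: "(\<Sum>a\<in>A. tilt A p v a) = 1"
  unfolding tilt_def sum_divide_distrib[symmetric] using tilt_partition_pos by simp

text \<open>
  A Pinsker inequality for the symmetrized divergence.  As \<open>v\<close> is the logarithm of the ratio of
  the two densities up to a constant, the right-hand side is the sum of the two relative entropies;
  \<open>diff_mult_ln_ratio_ge\<close> bounds it from below termwise and the Cauchy-Schwarz inequality finishes.
\<close>

lemma tilt_l1_sq_le: "(\<Sum>a\<in>A. \<bar>tilt A p v a - p a\<bar>)\<^sup>2 \<le> (\<Sum>a\<in>A. (tilt A p v a - p a) * v a)"
proof -
  let ?q = "tilt A p v" and ?Z = "\<Sum>b\<in>A. p b * exp (v b)"
  have ln: "v a = (ln (?q a) - ln (p a)) + ln ?Z" if "a \<in> A" for a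
    using p_pos[OF that] tilt_partition_pos by (simp add: tilt_def ln_div ln_mult)
  have zero: "(\<Sum>a\<in>A. (?q a - p a) * ln ?Z) = 0"
    by (simp add: sum_distrib_right[symmetric] sum_subtractf tilt_sum p_sum)
  have "(\<Sum>a\<in>A. (?q a - p a) * v a) = (\<Sum>a\<in>A. (?q a - p a) * (ln (?q a) - ln (p a)) + (?q a - p a) * ln ?Z)"
    by (intro sum.cong refl) (subst ln, auto simp: algebra_simps)
  also have "\<dots> = (\<Sum>a\<in>A. (?q a - p a) * (ln (?q a) - ln (p a)))"
    unfolding sum.distrib zero by simp
  also have "\<dots> \<ge> (\<Sum>a\<in>A. 2 * (?q a - p a)\<^sup>2 / (p a + ?q a))"
    by (intro sum_mono diff_mult_ln_ratio_ge p_pos tilt_pos)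
  finally have 1: "2 * (\<Sum>a\<in>A. (?q a - p a)\<^sup>2 / (p a + ?q a)) \<le> (\<Sum>a\<in>A. (?q a - p a) * v a)"
    by (simp add: sum_distrib_left)
  have "(\<Sum>a\<in>A. \<bar>?q a - p a\<bar>)\<^sup>2 = (\<Sum>a\<in>A. (\<bar>?q a - p a\<bar> / sqrt (p a + ?q a)) * sqrt (p a + ?q a))\<^sup>2"
    using add_pos_pos[OF p_pos tilt_pos] by (intro arg_cong[where f="\<lambda>x. x\<^sup>2"] sum.cong refl) fastforce
  also have "\<dots> \<le> (\<Sum>a\<in>A. (\<bar>?q a - p a\<bar> / sqrt (p a + ?q a))\<^sup>2) * (\<Sum>a\<in>A. (sqrt (p a + ?q a))\<^sup>2)"
    by (rule Cauchy_Schwarz_ineq_sum)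
  also have "(\<Sum>a\<in>A. (\<bar>?q a - p a\<bar> / sqrt (p a + ?q a))\<^sup>2) = (\<Sum>a\<in>A. (?q a - p a)\<^sup>2 / (p a + ?q a))"
    using add_pos_pos[OF p_pos tilt_pos] by (intro sum.cong refl) (auto simp: power_divide less_imp_le)
  also have "(\<Sum>a\<in>A. (sqrt (p a + ?q a))\<^sup>2) = (\<Sum>a\<in>A. p a + ?q a)"
    using add_pos_pos[OF p_pos tilt_pos] by (intro sum.cong refl) (auto simp: less_imp_le)
  also have "\<dots> = 2" by (simp add: sum.distrib p_sum tilt_sum)
  finally show ?thesis using 1 by simp
qed

text \<open>
  In the previous inequality the right-hand side is at most \<open>m\<close> times the \<open>l\<^sub>1\<close> distance.  Softmax
  policies are therefore Lipschitz, with constant 1, in the maximum norm of their logits, without any restriction on the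
  size of \<open>v\<close>.
\<close>

lemma tilt_l1_le:
  assumes "\<And>a. a \<in> A \<Longrightarrow> \<bar>v a\<bar> \<le> m"
  shows "(\<Sum>a\<in>A. \<bar>tilt A p v a - p a\<bar>) \<le> m"
proof -
  let ?d = "\<Sum>a\<in>A. \<bar>tilt A p v a - p a\<bar>"
  have "?d\<^sup>2 \<le> (\<Sum>a\<in>A. (tilt A p v a - p a) * v a)" by (rule tilt_l1_sq_le)
  also have "\<dots> \<le> (\<Sum>a\<in>A. \<bar>tilt A p v a - p a\<bar> * m)"
  proof (rule sum_mono)
    fix a assume "a \<in> A"
    have "(tilt A p v a - p a) * v a \<le> \<bar>tilt A p v a - p a\<bar> * \<bar>v a\<bar>"
      by (metis abs_ge_self abs_mult)
    also have "\<dots> \<le> \<bar>tilt A p v a - p a\<bar> * m"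
      using assms \<open>a \<in> A\<close> by (intro mult_left_mono) auto
    finally show "(tilt A p v a - p a) * v a \<le> \<bar>tilt A p v a - p a\<bar> * m" .
  qed
  finally have "?d * ?d \<le> ?d * m" by (simp add: sum_distrib_right power2_eq_square)
  moreover have "0 \<le> ?d" by (intro sum_nonneg) auto
  moreover have "0 \<le> m" using A assms abs_ge_zero order_trans by blast
  ultimately show ?thesis by (cases "?d = 0") auto
qed

text \<open>
  Subtracting the mean from \<open>v\<close> does not change the tilt and makes the normalizing constant
  \<open>Z\<close> at least 1.  The remainder \<open>exp y - 1 - y\<close> lies between 0 and \<open>y\<^sup>2\<close>, so that \<open>Z - 1\<close> is at
  most the variance; numerator and denominator contribute one variance each.
\<close>

lemma tilt_first_order:
  assumes v: "\<And>a. a \<in> A \<Longrightarrow> \<bar>v a\<bar> \<le> 1 / 2"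
  defines "m \<equiv> \<Sum>b\<in>A. p b * v b"
  shows "(\<Sum>a\<in>A. \<bar>tilt A p v a - p a - p a * (v a - m)\<bar>) \<le> 2 * (\<Sum>a\<in>A. p a * (v a)\<^sup>2)"
proof -
  let ?y = "\<lambda>a. v a - m"
  define Z where "Z = (\<Sum>b\<in>A. p b * exp (?y b))"
  define W where "W = (\<Sum>a\<in>A. p a * (?y a)\<^sup>2)"
  have m: "\<bar>m\<bar> \<le> 1 / 2"
  proof -
    have "\<bar>m\<bar> \<le> (\<Sum>b\<in>A. p b * (1 / 2))"
      unfolding m_def using v p_pos
      by (intro order_trans[OF sum_abs] sum_mono) (auto simp: abs_mult less_imp_le intro!: mult_mono)
    then show ?thesis by (simp add: sum_distrib_right[symmetric] p_sum sum_divide_distrib[symmetric])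
  qed
  have y: "\<bar>?y a\<bar> \<le> 1" if "a \<in> A" for a using v[OF that] m by linarith
  have py: "(\<Sum>a\<in>A. p a * ?y a) = 0"
    by (simp add: right_diff_distrib sum_subtractf sum_distrib_right[symmetric] p_sum m_def)
  have e1: "0 \<le> exp (?y a) - 1 - ?y a" for a using exp_ge_add_one_self[of "?y a"] by linarith
  have e2: "exp (?y a) - 1 - ?y a \<le> (?y a)\<^sup>2" if "a \<in> A" for a
    using exp_le_quadratic[of "?y a"] y[OF that] by linarith
  have Z1: "Z - 1 = (\<Sum>a\<in>A. p a * (exp (?y a) - 1 - ?y a))"
    unfolding Z_def using py by (simp add: right_diff_distrib sum_subtractf p_sum)
  have Zge: "1 \<le> Z" using Z1 sum_nonneg[of A "\<lambda>a. p a * (exp (?y a) - 1 - ?y a)"] e1 p_pos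
    by (fastforce simp: less_imp_le)
  have ZW: "Z - 1 \<le> W"
    unfolding Z1 W_def using e2 p_pos by (intro sum_mono mult_left_mono) (auto simp: less_imp_le)
  have q: "tilt A p v a = p a * exp (?y a) / Z" for a
  proof -
    have "Z = (\<Sum>b\<in>A. p b * exp (v b)) / exp m"
      by (simp add: Z_def exp_diff sum_divide_distrib)
    then show ?thesis by (simp add: tilt_def exp_diff)
  qed
  have "\<bar>tilt A p v a - p a - p a * ?y a\<bar> \<le>
      p a * (exp (?y a) - 1 - ?y a) + (Z - 1) * (p a * (1 + ?y a))" if "a \<in> A" for a
  proof -
    have "tilt A p v a - p a - p a * ?y a =
        (p a * (exp (?y a) - 1 - ?y a) - (Z - 1) * (p a * (1 + ?y a))) / Z"
      using Zge by (simp add: q field_simps)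
    moreover have "0 \<le> p a * (exp (?y a) - 1 - ?y a)"
      using e1[of a] p_pos[OF that] by (intro mult_nonneg_nonneg) auto
    moreover have "0 \<le> (Z - 1) * (p a * (1 + ?y a))"
      using Zge y[OF that] p_pos[OF that] by (intro mult_nonneg_nonneg) auto
    ultimately have "\<bar>tilt A p v a - p a - p a * ?y a\<bar> \<le>
        (p a * (exp (?y a) - 1 - ?y a) + (Z - 1) * (p a * (1 + ?y a))) / Z"
      using Zge by (simp add: abs_divide divide_right_mono)
    also have "\<dots> \<le> p a * (exp (?y a) - 1 - ?y a) + (Z - 1) * (p a * (1 + ?y a))"
      using Zge \<open>0 \<le> p a * (exp (?y a) - 1 - ?y a)\<close> \<open>0 \<le> (Z - 1) * (p a * (1 + ?y a))\<close>
      by (simp add: divide_le_eq mult_le_cancel_left1)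
    finally show ?thesis .
  qed
  then have "(\<Sum>a\<in>A. \<bar>tilt A p v a - p a - p a * ?y a\<bar>) \<le>
      (\<Sum>a\<in>A. p a * (exp (?y a) - 1 - ?y a)) + (Z - 1) * (\<Sum>a\<in>A. p a * (1 + ?y a))"
    unfolding sum_distrib_left sum.distrib[symmetric] by (intro sum_mono) 
  also have "(\<Sum>a\<in>A. p a * (1 + ?y a)) = 1"
    using py p_sum by (simp add: distrib_left sum.distrib)
  also have "(\<Sum>a\<in>A. p a * (exp (?y a) - 1 - ?y a)) + (Z - 1) * 1 \<le> 2 * W"
    unfolding Z1[symmetric] using ZW by simp
  also have "W \<le> (\<Sum>a\<in>A. p a * (v a)\<^sup>2)"
  proof -
    have "W = (\<Sum>a\<in>A. p a * (v a)\<^sup>2 - 2 * m * (p a * v a) + p a * m\<^sup>2)"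
      unfolding W_def by (intro sum.cong refl) (simp add: power2_eq_square algebra_simps)
    also have "\<dots> = (\<Sum>a\<in>A. p a * (v a)\<^sup>2) - m\<^sup>2"
      by (simp add: sum.distrib sum_subtractf sum_distrib_left[symmetric] sum_distrib_right[symmetric]
          p_sum m_def[symmetric] power2_eq_square)
    finally show ?thesis by simp
  qed
  finally show ?thesis by simp
qed

text \<open>
  For \<open>\<bar>v\<bar> \<le> 1 / 2\<close> one has \<open>v exp v \<ge> v + v\<^sup>2 / 2\<close>, and the linear term has mean zero.  This leaves
  half the second moment of \<open>v\<close>, divided by a normalizing constant that is at most 2.
\<close>

lemma tilt_gain_ge:
  assumes v: "\<And>a. a \<in> A \<Longrightarrow> \<bar>v a\<bar> \<le> 1 / 2" and centred: "(\<Sum>a\<in>A. p a * v a) = 0"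
  shows "(\<Sum>a\<in>A. p a * (v a)\<^sup>2) / 4 \<le> (\<Sum>a\<in>A. tilt A p v a * v a)"
proof -
  define Z where "Z = (\<Sum>b\<in>A. p b * exp (v b))"
  have Z0: "0 < Z" unfolding Z_def by (rule tilt_partition_pos)
  have upper: "exp (v a) \<le> 1 + v a + (v a)\<^sup>2" if "a \<in> A" for a
    using exp_le_quadratic[of "v a"] v[OF that] by simp
  have low: "v a + (v a)\<^sup>2 / 2 \<le> exp (v a) * v a" if "a \<in> A" for a
  proof (cases "0 \<le> v a")
    case True
    have "(1 + v a) * v a \<le> exp (v a) * v a"
      using True by (intro mult_right_mono exp_ge_add_one_self)
    moreover have "v a + (v a)\<^sup>2 / 2 \<le> (1 + v a) * v a" by (simp add: power2_eq_square algebra_simps)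
    ultimately show ?thesis by linarith
  next
    case False
    have "(1 + v a + (v a)\<^sup>2) * v a \<le> exp (v a) * v a"
      using False upper[OF that] by (intro mult_right_mono_neg) auto
    moreover have "(v a)\<^sup>2 * (1 / 2 + v a) \<ge> 0" using v[OF that] by (intro mult_nonneg_nonneg) auto
    ultimately show ?thesis by (simp add: algebra_simps power2_eq_square)
  qed
  have sq: "(\<Sum>a\<in>A. p a * (v a)\<^sup>2) \<le> 1"
  proof -
    have "(v a)\<^sup>2 \<le> 1" if "a \<in> A" for a using v[OF that] by (auto simp: abs_square_le_1)
    then have "(\<Sum>a\<in>A. p a * (v a)\<^sup>2) \<le> (\<Sum>a\<in>A. p a * 1)"
      using p_pos by (intro sum_mono mult_left_mono) (auto simp: less_imp_le)
    then show ?thesis by (simp add: p_sum)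
  qed
  have "Z \<le> (\<Sum>a\<in>A. p a * (1 + v a + (v a)\<^sup>2))"
    unfolding Z_def using upper p_pos by (intro sum_mono mult_left_mono) (auto simp: less_imp_le)
  also have "\<dots> = 1 + (\<Sum>a\<in>A. p a * (v a)\<^sup>2)"
    using centred p_sum by (simp add: distrib_left sum.distrib)
  finally have Z2: "Z \<le> 2" using sq by simp
  let ?W = "\<Sum>a\<in>A. p a * (v a)\<^sup>2"
  have W0: "0 \<le> ?W" using p_pos by (intro sum_nonneg) (auto simp: less_imp_le)
  have "(\<Sum>a\<in>A. p a * (v a + (v a)\<^sup>2 / 2)) \<le> (\<Sum>a\<in>A. p a * (exp (v a) * v a))"
    using low p_pos by (intro sum_mono mult_left_mono) (auto simp: less_imp_le)
  also have "(\<Sum>a\<in>A. p a * (v a + (v a)\<^sup>2 / 2)) = ?W / 2"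
    using centred by (simp add: distrib_left sum.distrib sum_divide_distrib)
  also have "(\<Sum>a\<in>A. p a * (exp (v a) * v a)) = Z * (\<Sum>a\<in>A. tilt A p v a * v a)"
    using Z0 by (simp add: tilt_def Z_def[symmetric] sum_distrib_left mult.assoc)
  finally have "?W / 2 / Z \<le> (\<Sum>a\<in>A. tilt A p v a * v a)"
    using Z0 by (simp add: pos_divide_le_eq mult.commute)
  moreover have "?W / 4 \<le> ?W / 2 / Z"
    using mult_right_mono[OF Z2 W0] Z0 by (simp add: field_simps)
  ultimately show ?thesis by linarith
qed

end

section \<open>Product distributions\<close>

lemma sum_PiE_split:
  fixes f :: "('a \<Rightarrow> 'b) \<Rightarrow> 'c::comm_monoid_add"
  assumes "i \<in> I" 
  shows "(\<Sum>a\<in>PiE I A. f a) = (\<Sum>x\<in>A i. \<Sum>b\<in>PiE (I - {i}) A. f (b(i := x)))"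
proof -
  have I: "I = insert i (I - {i})" using assms by auto
  have "(\<Sum>a\<in>PiE I A. f a) = (\<Sum>a\<in>(\<lambda>(x, b). b(i := x)) ` (A i \<times> PiE (I - {i}) A). f a)"
    by (subst I, subst PiE_insert_eq) simp
  also have "\<dots> = (\<Sum>y\<in>A i \<times> PiE (I - {i}) A. f ((\<lambda>(x, b). b(i := x)) y))"
    by (rule sum.reindex[unfolded comp_def]) (rule inj_combinator, simp)
  finally show ?thesis by (simp add: sum.cartesian_product')
qed

lemma sum_PiE_product_split:
  fixes p :: "'a \<Rightarrow> 'b \<Rightarrow> real"
  assumes "finite I" "i \<in> I"
  shows "(\<Sum>a\<in>PiE I A. (\<Prod>j\<in>I. p j (a j)) * f a) =
    (\<Sum>x\<in>A i. p i x * (\<Sum>b\<in>PiE (I - {i}) A. (\<Prod>j\<in>I - {i}. p j (b j)) * f (b(i := x))))"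
proof -
  have "(\<Prod>j\<in>I. p j ((b(i := x)) j)) = p i x * (\<Prod>j\<in>I - {i}. p j (b j))" for b x
    by (subst prod.remove[OF assms]) simp
  then show ?thesis by (simp add: sum_PiE_split[OF assms(2)] sum_distrib_left mult.assoc)
qed

lemma sum_PiE_product:
  fixes p :: "'a \<Rightarrow> 'b \<Rightarrow> real"
  assumes "finite I" "\<And>i. i \<in> I \<Longrightarrow> finite (A i)" "\<And>i. i \<in> I \<Longrightarrow> (\<Sum>x\<in>A i. p i x) = 1"
  shows "(\<Sum>a\<in>PiE I A. \<Prod>j\<in>I. p j (a j)) = 1"
  using prod_sum_PiE[of I A p] assms by simp

text \<open>
  Changing one factor at a time costs the \<open>l\<^sub>1\<close> distance of that factor.
\<close>

lemma product_l1_le: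
  fixes p q :: "'a \<Rightarrow> 'b \<Rightarrow> real"
  assumes "finite I" "\<And>i. i \<in> I \<Longrightarrow> finite (A i)"
    and p: "\<And>i x. 0 \<le> p i x" "\<And>i. i \<in> I \<Longrightarrow> (\<Sum>x\<in>A i. p i x) = 1"
    and q: "\<And>i x. 0 \<le> q i x" "\<And>i. i \<in> I \<Longrightarrow> (\<Sum>x\<in>A i. q i x) = 1"
  shows "(\<Sum>a\<in>PiE I A. \<bar>(\<Prod>j\<in>I. p j (a j)) - (\<Prod>j\<in>I. q j (a j))\<bar>) \<le>
    (\<Sum>i\<in>I. \<Sum>x\<in>A i. \<bar>p i x - q i x\<bar>)"
  using assms(1,2) p(2) q(2)
proof (induction I rule: finite_induct)
  case (insert i I)
  let ?P = "\<lambda>b. \<Prod>j\<in>I. p j (b j)" and ?Q = "\<lambda>b. \<Prod>j\<in>I. q j (b j)"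
  have I: "insert i I - {i} = I" using insert by auto
  have upd: "(\<Prod>j\<in>insert i I. r j ((b(i := x)) j)) = r i x * (\<Prod>j\<in>I. r j (b j))"
    for r :: "'a \<Rightarrow> 'b \<Rightarrow> real" and b x
  proof -
    have "(\<Prod>j\<in>I. r j ((b(i := x)) j)) = (\<Prod>j\<in>I. r j (b j))"
      using insert by (intro prod.cong) auto
    then show ?thesis using insert by simp
  qed
  have "(\<Sum>a\<in>PiE (insert i I) A. \<bar>(\<Prod>j\<in>insert i I. p j (a j)) - (\<Prod>j\<in>insert i I. q j (a j))\<bar>) =
      (\<Sum>x\<in>A i. \<Sum>b\<in>PiE I A. \<bar>p i x * ?P b - q i x * ?Q b\<bar>)"
    by (subst sum_PiE_split[of i]) (simp_all only: I upd insertI1)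
  also have "\<dots> \<le> (\<Sum>x\<in>A i. \<Sum>b\<in>PiE I A. \<bar>p i x - q i x\<bar> * ?P b + q i x * \<bar>?P b - ?Q b\<bar>)"
  proof (intro sum_mono)
    fix x b
    have "p i x * ?P b - q i x * ?Q b = (p i x - q i x) * ?P b + q i x * (?P b - ?Q b)"
      by (simp add: algebra_simps)
    also have "\<bar>\<dots>\<bar> \<le> \<bar>(p i x - q i x) * ?P b\<bar> + \<bar>q i x * (?P b - ?Q b)\<bar>" by (rule abs_triangle_ineq)
    also have "\<dots> = \<bar>p i x - q i x\<bar> * ?P b + q i x * \<bar>?P b - ?Q b\<bar>"
      using p(1) q(1) by (simp add: abs_mult prod_nonneg)
    finally show "\<bar>p i x * ?P b - q i x * ?Q b\<bar> \<le> \<bar>p i x - q i x\<bar> * ?P b + q i x * \<bar>?P b - ?Q b\<bar>" .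
  qed
  also have "\<dots> = (\<Sum>x\<in>A i. \<bar>p i x - q i x\<bar>) * (\<Sum>b\<in>PiE I A. ?P b)
      + (\<Sum>x\<in>A i. q i x) * (\<Sum>b\<in>PiE I A. \<bar>?P b - ?Q b\<bar>)"
    by (simp only: sum.distrib sum_product)
  also have "(\<Sum>b\<in>PiE I A. ?P b) = 1"
    using insert by (intro sum_PiE_product) auto
  also have "(\<Sum>x\<in>A i. q i x) = 1" using insert by auto
  also have "(\<Sum>b\<in>PiE I A. \<bar>?P b - ?Q b\<bar>) \<le> (\<Sum>i\<in>I. \<Sum>x\<in>A i. \<bar>p i x - q i x\<bar>)"
    using insert by auto
  finally show ?case using insert by simp
qed simp

section \<open>One-time marginals of the trajectory measure\<close>

text \<open>
  The law of the state-action pair at time \<open>t\<close>.  Expected returns depend on the measure on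
  trajectories only through these laws.
\<close>

primrec pair_law ::
    "stochastic_game \<Rightarrow> policy \<Rightarrow> (nat \<times> (nat \<Rightarrow> nat)) pmf \<Rightarrow> nat \<Rightarrow> (nat \<times> (nat \<Rightarrow> nat)) pmf" where
  "pair_law G \<pi> \<mu> 0 = \<mu>"
| "pair_law G \<pi> \<mu> (Suc t) = bind_pmf (pair_law G \<pi> \<mu> t) (step_pmf G \<pi>)"

lemma sets_traj_measure [measurable_cong]:
  "sets (traj_measure G \<pi> \<mu>) = sets (PiM UNIV (\<lambda>_. count_space UNIV))"
proof -
  interpret IT: Ionescu_Tulcea "traj_kernel G \<pi> \<mu>" "\<lambda>_. count_space UNIV"
    by (rule Ionescu_Tulcea_traj_kernel)
  show ?thesis unfolding traj_measure_def by (rule IT.PF.sets_lim)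
qed

lemma measurable_traj_component [measurable]:
  "(\<lambda>\<omega>. \<omega> t) \<in> measurable (traj_measure G \<pi> \<mu>) (count_space UNIV)"
  by (subst measurable_cong_sets[OF sets_traj_measure refl])
     (rule measurable_component_singleton, simp)

text \<open>
  The projection of the Ionescu-Tulcea limit to the coordinates up to \<open>t\<close> is a finite composition of
  kernels.  Its last coordinate is distributed as the last kernel applied to the composition of the
  earlier ones, and this kernel looks only at the coordinate before.
\<close>

lemma distr_traj_measure:
  "distr (traj_measure G \<pi> \<mu>) (count_space UNIV) (\<lambda>\<omega>. \<omega> t) = measure_pmf (pair_law G \<pi> \<mu> t)"
proof -
  let ?M = "\<lambda>_::nat. count_space (UNIV :: (nat \<times> (nat \<Rightarrow> nat)) set)"
  let ?K = "traj_kernel G \<pi> \<mu>"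
  let ?u = "\<lambda>_::nat. undefined :: nat \<times> (nat \<Rightarrow> nat)"
  interpret IT: Ionescu_Tulcea "traj_kernel G \<pi> \<mu>" "\<lambda>_. count_space UNIV"
    by (rule Ionescu_Tulcea_traj_kernel)
  have u: "?u \<in> space (PiM {0..<0} ?M)" by (simp add: space_PiM)
  have up: "IT.up_to {t} = Suc t" for t
    unfolding IT.up_to_def by (rule Least_equality) (auto simp: not_less_eq_eq[symmetric])
  have comp: "(\<lambda>\<omega>. \<omega> t) \<in> measurable (PiM J ?M) (count_space UNIV)" if "t \<in> J" for t J
    using that by (rule measurable_component_singleton)
  have step: "distr (IT.C 0 (Suc t) ?u) (count_space UNIV) (\<lambda>\<omega>. \<omega> t) = IT.C 0 t ?u \<bind> ?K t" for t
  proof -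
    have "distr (IT.C 0 (Suc t) ?u) (count_space UNIV) (\<lambda>\<omega>. \<omega> t)
        = distr (IT.C 0 t ?u \<bind> IT.eP t) (count_space UNIV) (\<lambda>\<omega>. \<omega> t)" by simp
    also have "\<dots> = IT.C 0 t ?u \<bind> (\<lambda>\<omega>. distr (IT.eP t \<omega>) (count_space UNIV) (\<lambda>\<omega>. \<omega> t))"
    proof (rule distr_bind)
      show "IT.eP t \<in> measurable (IT.C 0 t ?u) (subprob_algebra (PiM {0..<Suc t} ?M))"
        using IT.measurable_eP[of t] by (simp add: measurable_cong_sets[OF IT.sets_C[OF u] refl])
      show "space (IT.C 0 t ?u) \<noteq> {}" 
        using IT.prob_space_C[OF u, of t] by (rule prob_space.not_empty)
    qed (rule comp, simp)
    also have "\<dots> = IT.C 0 t ?u \<bind> ?K t"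
    proof (rule bind_cong[OF refl])
      fix \<omega> assume "\<omega> \<in> space (IT.C 0 t ?u)"
      then have w: "\<omega> \<in> space (PiM {0..<t} ?M)" using IT.space_C[OF u] by simp
      have "distr (IT.eP t \<omega>) (count_space UNIV) (\<lambda>\<omega>. \<omega> t)
          = distr (?K t \<omega>) (count_space UNIV) ((\<lambda>\<omega>. \<omega> t) \<circ> fun_upd \<omega> t)"
        unfolding IT.eP_def
      proof (rule distr_distr)
        show "fun_upd \<omega> t \<in> measurable (?K t \<omega>) (PiM {0..<Suc t} ?M)"
          using w by (intro measurable_fun_upd[where J="{0..<t}"]) (auto simp: traj_kernel_def)
      qed (rule comp, simp)
      also have "\<dots> = ?K t \<omega>"
        by (simp add: comp_def traj_kernel_def distr_id2)
      finally show "distr (IT.eP t \<omega>) (count_space UNIV) (\<lambda>\<omega>. \<omega> t) = ?K t \<omega>" .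
    qed
    finally show ?thesis .
  qed
  have C: "distr (IT.C 0 (Suc t) ?u) (count_space UNIV) (\<lambda>\<omega>. \<omega> t) = measure_pmf (pair_law G \<pi> \<mu> t)" for t
  proof (induction t)
    case 0
    have "?K 0 \<in> measurable (PiM {0..<0} ?M) (subprob_algebra (count_space UNIV))"
      by (rule IT.P)
    then have "return (PiM {0..<0} ?M) ?u \<bind> ?K 0 = ?K 0 ?u"
      by (rule bind_return) (rule u)
    then show ?case by (subst step) (simp add: traj_kernel_def)
  next
    case (Suc t)
    have "distr (IT.C 0 (Suc (Suc t)) ?u) (count_space UNIV) (\<lambda>\<omega>. \<omega> (Suc t))
        = IT.C 0 (Suc t) ?u \<bind> ?K (Suc t)" by (rule step)
    also have "\<dots> = IT.C 0 (Suc t) ?u \<bind> (\<lambda>\<omega>. measure_pmf (step_pmf G \<pi> (\<omega> t)))"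
      by (simp add: traj_kernel_def[abs_def])
    also have "\<dots> = distr (IT.C 0 (Suc t) ?u) (count_space UNIV) (\<lambda>\<omega>. \<omega> t) \<bind>
        (\<lambda>x. measure_pmf (step_pmf G \<pi> x))"
    proof (rule bind_distr[symmetric])
      show "(\<lambda>\<omega>. \<omega> t) \<in> measurable (IT.C 0 (Suc t) ?u) (count_space UNIV)"
        using comp[of t "{0..<Suc t}"] by (simp add: measurable_cong_sets[OF IT.sets_C[OF u] refl] del: IT.C.simps)
      show "space (IT.C 0 (Suc t) ?u) \<noteq> {}" 
        using IT.prob_space_C[OF u, of "Suc t"] by (rule prob_space.not_empty)
      show "(\<lambda>p. measure_pmf (step_pmf G \<pi> p)) \<in>
        measurable (count_space UNIV) (subprob_algebra (count_space UNIV))"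
        by (simp add: measure_pmf_in_subprob_algebra)
    qed
    also have "\<dots> = measure_pmf (pair_law G \<pi> \<mu> (Suc t))"
      unfolding Suc by (simp add: measure_pmf_bind)
    finally show ?case .
  qed
  have "distr (traj_measure G \<pi> \<mu>) (count_space UNIV) (\<lambda>\<omega>. \<omega> t)
      = distr (distr (traj_measure G \<pi> \<mu>) (PiM {t} ?M) (\<lambda>x. restrict x {t})) (count_space UNIV) (\<lambda>\<omega>. \<omega> t)"
    by (subst distr_distr)
       (auto intro!: comp measurable_restrict simp: comp_def measurable_cong_sets[OF sets_traj_measure refl])
  also have "distr (traj_measure G \<pi> \<mu>) (PiM {t} ?M) (\<lambda>x. restrict x {t}) = IT.CI {t}"
    unfolding traj_measure_def by (rule IT.distr_lim) simp
  also have "distr (IT.CI {t}) (count_space UNIV) (\<lambda>\<omega>. \<omega> t)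
      = distr (IT.C 0 (Suc t) ?u) (count_space UNIV) (\<lambda>\<omega>. \<omega> t)"
    unfolding IT.CI_def up
    by (subst distr_distr)
       (auto intro!: comp measurable_restrict simp: comp_def measurable_cong_sets[OF IT.sets_C[OF u] refl] simp del: IT.C.simps)
  finally show ?thesis unfolding C .
qed

lemma pair_law_bind: "pair_law G \<pi> \<mu> t = bind_pmf \<mu> (\<lambda>x. pair_law G \<pi> (return_pmf x) t)"
  by (induction t) (simp_all add: bind_return_pmf' bind_assoc_pmf)

lemma pair_law_Suc_shift: "pair_law G \<pi> \<mu> (Suc t) = pair_law G \<pi> (bind_pmf \<mu> (step_pmf G \<pi>)) t"
  by (induction t) simp_all

section \<open>The Bellman equations\<close>

definition joint_prob :: "stochastic_game \<Rightarrow> policy \<Rightarrow> nat \<Rightarrow> (nat \<Rightarrow> nat) \<Rightarrow> real" where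
  "joint_prob G \<pi> s a = (\<Prod>j\<in>agents G. \<pi> j s (a j))"

definition state_kernel :: "stochastic_game \<Rightarrow> policy \<Rightarrow> nat \<Rightarrow> nat \<Rightarrow> real" where
  "state_kernel G \<pi> s s' = (\<Sum>a\<in>joint_acts G. joint_prob G \<pi> s a * pmf (trans_prob G s a) s')"

locale game =
  fixes G :: stochastic_game
  assumes is_game: "is_game G"
begin

abbreviation "S \<equiv> states G"
abbreviation "Ag \<equiv> agents G"
abbreviation "JA \<equiv> joint_acts G"
abbreviation "\<gamma> \<equiv> discount G"

lemma finite_S [simp]: "finite S" and finite_Ag [simp]: "finite Ag"
  and finite_acts [simp]: "i \<in> Ag \<Longrightarrow> finite (acts G i)"
  and acts_ne: "i \<in> Ag \<Longrightarrow> acts G i \<noteq> {}"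
  and trans_closed: "s \<in> S \<Longrightarrow> a \<in> JA \<Longrightarrow> set_pmf (trans_prob G s a) \<subseteq> S"
  and reward_range: "i \<in> Ag \<Longrightarrow> s \<in> S \<Longrightarrow> a \<in> JA \<Longrightarrow> reward G i s a \<in> {0..1}"
  and \<gamma>0: "0 \<le> \<gamma>" and \<gamma>1: "\<gamma> < 1"
  and init_closed: "set_pmf (init_dist G) \<subseteq> S"
  using is_game by (auto simp: is_game_def agents_def)

lemma S_ne: "S \<noteq> {}"
  using init_closed set_pmf_not_empty[of "init_dist G"] by blast

lemma Ag_ne: "Ag \<noteq> {}"
  using is_game by (auto simp: is_game_def agents_def)

lemma card_Ag: "card Ag = num_agents G"
  by (simp add: agents_def)

lemma num_agents_pos: "num_agents G \<ge> 1"
  using is_game by (simp add: is_game_def)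

lemma finite_JA [simp]: "finite JA"
  unfolding joint_acts_def by (rule finite_PiE) auto

lemma dec_policy_nonneg: "\<pi> \<in> dec_policies G \<Longrightarrow> 0 \<le> \<pi> i s a"
  unfolding dec_policies_def by (cases "i \<in> Ag \<and> s \<in> S \<and> a \<in> acts G i") auto

lemma dec_policy_sum: "\<pi> \<in> dec_policies G \<Longrightarrow> i \<in> Ag \<Longrightarrow> s \<in> S \<Longrightarrow> (\<Sum>a\<in>acts G i. \<pi> i s a) = 1"
  unfolding dec_policies_def by auto

lemma pmf_embed_policy:
  assumes "\<pi> \<in> dec_policies G" "i \<in> Ag" "s \<in> S"
  shows "pmf (embed_pmf (\<pi> i s)) a = \<pi> i s a"
proof (rule pmf_embed_pmf)
  show "0 \<le> \<pi> i s a" for a using assms(1) by (rule dec_policy_nonneg)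
  have "(\<integral>\<^sup>+a. ennreal (\<pi> i s a) \<partial>count_space UNIV) = (\<Sum>a\<in>acts G i. ennreal (\<pi> i s a))"
  proof (rule nn_integral_count_space'[OF finite_acts[OF assms(2)]])
    show "ennreal (\<pi> i s a) = 0" if "a \<notin> acts G i" for a
      using assms(1) that by (simp add: dec_policies_def)
  qed auto
  also have "\<dots> = 1"
    using dec_policy_sum[OF assms] dec_policy_nonneg[OF assms(1)] by (simp add: sum_ennreal)
  finally show "(\<integral>\<^sup>+a. ennreal (\<pi> i s a) \<partial>count_space UNIV) = 1" .
qed

lemma pmf_action:
  assumes "\<pi> \<in> dec_policies G" "s \<in> S" "a \<in> JA"
  shows "pmf (action_pmf G \<pi> s) a = joint_prob G \<pi> s a"
proof -
  have "pmf (action_pmf G \<pi> s) a = (\<Prod>j\<in>Ag. pmf (embed_pmf (\<pi> j s)) (a j))"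
    unfolding action_pmf_def using assms(3) by (intro pmf_Pi') (auto simp: joint_acts_def)
  then show ?thesis
    using assms by (simp add: joint_prob_def pmf_embed_policy)
qed

lemma set_action_pmf:
  assumes "\<pi> \<in> dec_policies G" "s \<in> S"
  shows "set_pmf (action_pmf G \<pi> s) \<subseteq> JA"
proof
  fix a assume a: "a \<in> set_pmf (action_pmf G \<pi> s)"
  then have "a \<in> PiE_dflt Ag undefined (\<lambda>i. set_pmf (embed_pmf (\<pi> i s)))"
    unfolding action_pmf_def by (simp add: set_Pi_pmf comp_def)
  moreover have "set_pmf (embed_pmf (\<pi> i s)) \<subseteq> acts G i" if "i \<in> Ag" for i
  proof
    fix x assume "x \<in> set_pmf (embed_pmf (\<pi> i s))"
    then have "\<pi> i s x \<noteq> 0" using pmf_embed_policy[OF assms(1) that assms(2)] by (simp add: set_pmf_iff)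
    then show "x \<in> acts G i" using assms(1) unfolding dec_policies_def by blast
  qed
  ultimately show "a \<in> JA"
    by (force simp: PiE_dflt_def joint_acts_def PiE_def extensional_def)
qed

lemma joint_prob_nonneg: "\<pi> \<in> dec_policies G \<Longrightarrow> 0 \<le> joint_prob G \<pi> s a"
  unfolding joint_prob_def by (intro prod_nonneg) (simp add: dec_policy_nonneg)

lemma joint_prob_sum:
  assumes "\<pi> \<in> dec_policies G" "s \<in> S"
  shows "(\<Sum>a\<in>JA. joint_prob G \<pi> s a) = 1"
  using sum_pmf_eq_1[OF finite_JA set_action_pmf[OF assms]] by (simp add: pmf_action assms)

lemma trans_sum: "s \<in> S \<Longrightarrow> a \<in> JA \<Longrightarrow> (\<Sum>s'\<in>S. pmf (trans_prob G s a) s') = 1"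
  by (rule sum_pmf_eq_1[OF finite_S trans_closed])

lemma state_kernel_nonneg: "\<pi> \<in> dec_policies G \<Longrightarrow> 0 \<le> state_kernel G \<pi> s s'"
  unfolding state_kernel_def by (intro sum_nonneg) (simp add: joint_prob_nonneg)

lemma state_kernel_sum:
  assumes "\<pi> \<in> dec_policies G" "s \<in> S"
  shows "(\<Sum>s'\<in>S. state_kernel G \<pi> s s') = 1"
  unfolding state_kernel_def
  by (subst sum.swap) (simp add: sum_distrib_left[symmetric] trans_sum joint_prob_sum assms)

lemma set_step_pmf:
  assumes "\<pi> \<in> dec_policies G" "x \<in> S \<times> JA"
  shows "set_pmf (step_pmf G \<pi> x) \<subseteq> S \<times> JA"
  using assms set_action_pmf[OF assms(1)] trans_closed
  by (fastforce simp: step_pmf_def set_bind_pmf)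

lemma set_pair_law:
  assumes "\<pi> \<in> dec_policies G" "set_pmf \<mu> \<subseteq> S \<times> JA"
  shows "set_pmf (pair_law G \<pi> \<mu> t) \<subseteq> S \<times> JA"
proof (induction t)
  case (Suc t)
  then show ?case using set_step_pmf[OF assms(1)] by (fastforce simp: set_bind_pmf)
qed (use assms in simp)

lemma expectation_pair:
  fixes f :: "nat \<times> (nat \<Rightarrow> nat) \<Rightarrow> real"
  assumes "set_pmf \<mu> \<subseteq> S \<times> JA"
  shows "measure_pmf.expectation \<mu> f = (\<Sum>x\<in>S \<times> JA. pmf \<mu> x * f x)"
  using assms by (subst integral_measure_pmf_real[of "S \<times> JA"]) (auto simp: mult.commute)

text \<open>
  The reward is unconstrained outside the states and joint actions of the game, so it is bounded
  only almost surely along a trajectory; this is enough to exchange sum and integral.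
\<close>

lemma discounted_return_sums:
  assumes "\<pi> \<in> dec_policies G" "set_pmf \<mu> \<subseteq> S \<times> JA"
  shows "(\<lambda>t. \<gamma> ^ t * measure_pmf.expectation (pair_law G \<pi> \<mu> t) (\<lambda>x. R (fst x) (snd x)))
    sums (\<integral>\<omega>. discounted_return G R \<omega> \<partial>traj_measure G \<pi> \<mu>)"
proof -
  let ?T = "traj_measure G \<pi> \<mu>" and ?Z = "S \<times> JA"
  let ?r = "\<lambda>x. R (fst x) (snd x)"
  define B where "B = (\<Sum>x\<in>?Z. \<bar>?r x\<bar>)"
  have B: "\<bar>?r x\<bar> \<le> B" if "x \<in> ?Z" for x
    unfolding B_def using that by (intro member_le_sum) auto
  note Z = set_pair_law[OF assms]
  have fin: "finite (set_pmf (pair_law G \<pi> \<mu> t))" for t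
    by (rule finite_subset[OF Z]) simp
  have int: "(\<integral>\<omega>. f (\<omega> t) \<partial>?T) = measure_pmf.expectation (pair_law G \<pi> \<mu> t) f" for t and f :: "_ \<Rightarrow> real"
    unfolding distr_traj_measure[symmetric] by (subst integral_distr) auto
  have integ: "integrable ?T (\<lambda>\<omega>. f (\<omega> t))" for t and f :: "_ \<Rightarrow> real"
  proof -
    have "integrable (distr ?T (count_space UNIV) (\<lambda>\<omega>. \<omega> t)) f"
      unfolding distr_traj_measure by (rule integrable_measure_pmf_finite[OF fin])
    then show ?thesis by (subst (asm) integrable_distr_eq) auto
  qed
  have "AE \<omega> in ?T. \<omega> t \<in> ?Z" for t
  proof -
    have "AE x in distr ?T (count_space UNIV) (\<lambda>\<omega>. \<omega> t). x \<in> ?Z"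
      unfolding distr_traj_measure using Z by (auto simp: AE_measure_pmf_iff)
    then show ?thesis by (subst (asm) AE_distr_iff) auto
  qed
  then have AE: "AE \<omega> in ?T. \<forall>t. \<omega> t \<in> ?Z"
    by (subst AE_all_countable) blast
  have geo: "summable (\<lambda>t. \<gamma> ^ t * B)"
    using \<gamma>0 \<gamma>1 by (intro summable_mult2 summable_geometric) simp
  have "(\<lambda>t. \<integral>\<omega>. \<gamma> ^ t * ?r (\<omega> t) \<partial>?T) sums (\<integral>\<omega>. (\<Sum>t. \<gamma> ^ t * ?r (\<omega> t)) \<partial>?T)"
  proof (rule sums_integral)
    show "integrable ?T (\<lambda>\<omega>. \<gamma> ^ t * ?r (\<omega> t))" for t
      by (rule integ[of "\<lambda>x. \<gamma> ^ t * ?r x"])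
    show "AE \<omega> in ?T. summable (\<lambda>t. norm (\<gamma> ^ t * ?r (\<omega> t)))"
      using AE
    proof eventually_elim
      case (elim \<omega>)
      show ?case
        by (rule summable_comparison_test[OF _ geo])
           (use elim B \<gamma>0 in \<open>auto simp: abs_mult mem_Times_iff intro!: exI[of _ 0] mult_left_mono\<close>)
    qed
    show "summable (\<lambda>t. \<integral>\<omega>. norm (\<gamma> ^ t * ?r (\<omega> t)) \<partial>?T)"
    proof (rule summable_comparison_test[OF _ geo], intro exI allI impI)
      fix t
      have "(\<integral>\<omega>. norm (\<gamma> ^ t * ?r (\<omega> t)) \<partial>?T)
          = measure_pmf.expectation (pair_law G \<pi> \<mu> t) (\<lambda>x. norm (\<gamma> ^ t * ?r x))"
        by (rule int)
      also have "\<dots> = (\<Sum>x\<in>?Z. pmf (pair_law G \<pi> \<mu> t) x * (\<gamma> ^ t * \<bar>?r x\<bar>))"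
        using \<gamma>0 by (simp add: expectation_pair[OF Z] abs_mult sum_distrib_left mult_ac)
      also have "\<dots> \<le> (\<Sum>x\<in>?Z. pmf (pair_law G \<pi> \<mu> t) x * (\<gamma> ^ t * B))"
        using B \<gamma>0 by (intro sum_mono mult_left_mono) auto
      also have "\<dots> = \<gamma> ^ t * B"
        using sum_pmf_eq_1[OF _ Z[of t]] by (simp add: sum_distrib_right[symmetric])
      finally show "norm (\<integral>\<omega>. norm (\<gamma> ^ t * ?r (\<omega> t)) \<partial>?T) \<le> \<gamma> ^ t * B"
        by simp
    qed
  qed
  moreover have "(\<integral>\<omega>. \<gamma> ^ t * ?r (\<omega> t) \<partial>?T) = \<gamma> ^ t * measure_pmf.expectation (pair_law G \<pi> \<mu> t) ?r" for t
    unfolding int[of ?r, symmetric] by (rule integral_mult_right_zero)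
  ultimately show ?thesis by (simp only: discounted_return_def)
qed

text \<open>
  Conditioning on the first state-action pair.
\<close>

lemma expected_return_decomp:
  assumes "\<pi> \<in> dec_policies G" "set_pmf \<mu> \<subseteq> S \<times> JA"
  shows "(\<integral>\<omega>. discounted_return G R \<omega> \<partial>traj_measure G \<pi> \<mu>) =
    (\<Sum>x\<in>S \<times> JA. pmf \<mu> x * Q_fun G R \<pi> (fst x) (snd x))"
proof (rule sums_unique2[OF discounted_return_sums[OF assms]])
  let ?Z = "S \<times> JA" and ?r = "\<lambda>x. R (fst x) (snd x)"
  let ?E = "\<lambda>\<mu> t. measure_pmf.expectation (pair_law G \<pi> \<mu> t) ?r"
  have E: "?E \<mu> t = (\<Sum>x\<in>?Z. pmf \<mu> x * ?E (return_pmf x) t)" for t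
  proof -
    have "finite (set_pmf (pair_law G \<pi> (return_pmf x) t))" if "x \<in> ?Z" for x
      using that by (intro finite_subset[OF set_pair_law[OF assms(1)]]) auto
    then show ?thesis
      by (subst pair_law_bind, subst pmf_expectation_bind[of ?Z]) (use assms(2) in auto)
  qed
  have "(\<lambda>t. \<Sum>x\<in>?Z. pmf \<mu> x * (\<gamma> ^ t * ?E (return_pmf x) t)) sums
      (\<Sum>x\<in>?Z. pmf \<mu> x * Q_fun G R \<pi> (fst x) (snd x))"
    unfolding Q_fun_def
    by (intro sums_sum sums_mult) (use discounted_return_sums[OF assms(1)] in auto)
  then show "(\<lambda>t. \<gamma> ^ t * ?E \<mu> t) sums (\<Sum>x\<in>?Z. pmf \<mu> x * Q_fun G R \<pi> (fst x) (snd x))"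
    by (subst E) (simp add: sum_distrib_left mult_ac)
qed

lemma V_fun_Q_fun:
  assumes "\<pi> \<in> dec_policies G" "s \<in> S"
  shows "V_fun G R \<pi> s = (\<Sum>a\<in>JA. joint_prob G \<pi> s a * Q_fun G R \<pi> s a)"
proof -
  have "set_pmf (start_at G \<pi> s) \<subseteq> S \<times> JA"
    using set_action_pmf[OF assms] assms(2) by (auto simp: start_at_def)
  then have "V_fun G R \<pi> s = (\<Sum>x\<in>S \<times> JA. pmf (start_at G \<pi> s) x * Q_fun G R \<pi> (fst x) (snd x))"
    unfolding V_fun_def by (rule expected_return_decomp[OF assms(1)])
  also have "\<dots> = (\<Sum>x\<in>{s} \<times> JA. pmf (start_at G \<pi> s) x * Q_fun G R \<pi> (fst x) (snd x))"
    using assms(2) by (intro sum.mono_neutral_right) (auto simp: start_at_def pmf_eq_0_set_pmf)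
  also have "\<dots> = (\<Sum>a\<in>JA. pmf (start_at G \<pi> s) (s, a) * Q_fun G R \<pi> s a)"
    by (simp add: sum.cartesian_product')
  also have "\<dots> = (\<Sum>a\<in>JA. joint_prob G \<pi> s a * Q_fun G R \<pi> s a)"
    unfolding start_at_def
    by (intro sum.cong refl) (simp add: pmf_map_inj' inj_on_def pmf_action assms)
  finally show ?thesis .
qed

lemma Q_fun_V_fun:
  assumes "\<pi> \<in> dec_policies G" "s \<in> S" "a \<in> JA"
  shows "Q_fun G R \<pi> s a = R s a + \<gamma> * (\<Sum>s'\<in>S. pmf (trans_prob G s a) s' * V_fun G R \<pi> s')"
proof -
  let ?Z = "S \<times> JA" and ?r = "\<lambda>x. R (fst x) (snd x)"
  let ?E = "\<lambda>\<mu> t. measure_pmf.expectation (pair_law G \<pi> \<mu> t) ?r"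
  have Z: "set_pmf (return_pmf (s, a)) \<subseteq> ?Z" using assms by simp
  have Z': "set_pmf (step_pmf G \<pi> (s, a)) \<subseteq> ?Z" using assms by (intro set_step_pmf) auto
  let ?I = "\<integral>\<omega>. discounted_return G R \<omega> \<partial>traj_measure G \<pi> (step_pmf G \<pi> (s, a))"
  have "(\<lambda>t. \<gamma> * (\<gamma> ^ t * ?E (step_pmf G \<pi> (s, a)) t)) sums (\<gamma> * ?I)"
    by (rule sums_mult[OF discounted_return_sums[OF assms(1) Z']])
  moreover have "?E (return_pmf (s, a)) (Suc t) = ?E (step_pmf G \<pi> (s, a)) t" for t
    by (simp only: pair_law_Suc_shift bind_return_pmf)
  ultimately have "(\<lambda>t. \<gamma> ^ Suc t * ?E (return_pmf (s, a)) (Suc t)) sums (\<gamma> * ?I)"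
    by (simp only: power_Suc mult.assoc)
  then have "(\<lambda>t. \<gamma> ^ t * ?E (return_pmf (s, a)) t) sums (\<gamma> * ?I + R s a)"
    by (subst (asm) sums_Suc_iff) simp
  then have "Q_fun G R \<pi> s a = \<gamma> * ?I + R s a"
    unfolding Q_fun_def by (rule sums_unique2[OF discounted_return_sums[OF assms(1) Z]])
  also have "?I = (\<Sum>x\<in>?Z. pmf (step_pmf G \<pi> (s, a)) x * Q_fun G R \<pi> (fst x) (snd x))"
    by (rule expected_return_decomp[OF assms(1) Z'])
  also have "\<dots> = (\<Sum>s'\<in>S. \<Sum>a'\<in>JA. pmf (trans_prob G s a) s' * (joint_prob G \<pi> s' a' * Q_fun G R \<pi> s' a'))"
  unfolding sum.cartesian_product'
  proof (intro sum.cong refl)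
    fix s' a' assume "s' \<in> S" "a' \<in> JA"
    have "pmf (step_pmf G \<pi> (s, a)) (s', a') =
        measure_pmf.expectation (trans_prob G s a) (\<lambda>s''. pmf (map_pmf (Pair s'') (action_pmf G \<pi> s'')) (s', a'))"
      by (simp add: step_pmf_def pmf_bind)
    also have "\<dots> = (\<Sum>s''\<in>{s'}. pmf (map_pmf (Pair s'') (action_pmf G \<pi> s'')) (s', a') * pmf (trans_prob G s a) s'')"
      by (rule integral_measure_pmf_real) (auto simp: pmf_eq_0_set_pmf)
    also have "\<dots> = pmf (trans_prob G s a) s' * joint_prob G \<pi> s' a'"
      using \<open>s' \<in> S\<close> \<open>a' \<in> JA\<close> by (simp add: pmf_map_inj' inj_on_def pmf_action assms)
    finally show "pmf (step_pmf G \<pi> (s, a)) (s', a') * Q_fun G R \<pi> (fst (s', a')) (snd (s', a')) =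
        pmf (trans_prob G s a) s' * (joint_prob G \<pi> s' a' * Q_fun G R \<pi> s' a')"
      by simp
  qed
  also have "\<dots> = (\<Sum>s'\<in>S. pmf (trans_prob G s a) s' * V_fun G R \<pi> s')"
    by (simp add: V_fun_Q_fun[OF assms(1)] sum_distrib_left)
  finally show ?thesis by simp
qed

end

section \<open>Discounted visitation and the performance difference\<close>

text \<open>
  The expected discounted number of visits to \<open>s\<close> is itself a value function, for the reward that is
  1 in state \<open>s\<close> and 0 elsewhere, so that no separate theory of visitation measures is needed.
\<close>

definition occupancy :: "stochastic_game \<Rightarrow> policy \<Rightarrow> nat \<Rightarrow> nat \<Rightarrow> real" where
  "occupancy G \<pi> s0 s = V_fun G (\<lambda>s' _. of_bool (s' = s)) \<pi> s0"

text \<open>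
  The visitation distribution \<open>visit\<close> for an arbitrary policy in place of a softmax policy.
\<close>

definition visit_prob :: "stochastic_game \<Rightarrow> policy \<Rightarrow> nat \<Rightarrow> real" where
  "visit_prob G \<pi> s = (1 - discount G) * (\<Sum>s0\<in>states G. pmf (init_dist G) s0 * occupancy G \<pi> s0 s)"

definition start_value ::
    "stochastic_game \<Rightarrow> (nat \<Rightarrow> (nat \<Rightarrow> nat) \<Rightarrow> real) \<Rightarrow> policy \<Rightarrow> real" where
  "start_value G R \<pi> = (\<Sum>s0\<in>states G. pmf (init_dist G) s0 * V_fun G R \<pi> s0)"

definition policy_dist :: "stochastic_game \<Rightarrow> policy \<Rightarrow> policy \<Rightarrow> nat \<Rightarrow> real" where
  "policy_dist G \<pi>' \<pi> s = (\<Sum>a\<in>joint_acts G. \<bar>joint_prob G \<pi>' s a - joint_prob G \<pi> s a\<bar>)"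

context game
begin

text \<open>
  Evaluate the hypothesis where \<open>f\<close> is maximal.  All uniqueness statements and all bounds on value
  functions are instances.
\<close>

lemma kernel_max_principle:
  assumes "\<pi> \<in> dec_policies G"
    and f: "\<And>s. s \<in> S \<Longrightarrow> f s \<le> b + \<gamma> * (\<Sum>s'\<in>S. state_kernel G \<pi> s s' * f s')"
    and "s \<in> S"
  shows "f s \<le> b / (1 - \<gamma>)"
proof -
  have "Max (f ` S) \<in> f ` S" using S_ne by (intro Max_in) auto
  then obtain m where m: "m \<in> S" "f m = Max (f ` S)" by auto
  have le: "f s' \<le> f m" if "s' \<in> S" for s' using m that by simp
  have "f m \<le> b + \<gamma> * (\<Sum>s'\<in>S. state_kernel G \<pi> m s' * f s')" using f m by blast
  also have "(\<Sum>s'\<in>S. state_kernel G \<pi> m s' * f s') \<le> (\<Sum>s'\<in>S. state_kernel G \<pi> m s' * f m)"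
    by (intro sum_mono mult_left_mono le state_kernel_nonneg[OF assms(1)])
  also have "\<dots> = f m"
    using state_kernel_sum[OF assms(1) m(1)] by (simp add: sum_distrib_right[symmetric])
  finally have "f m \<le> b + \<gamma> * f m" using \<gamma>0 by (simp add: mult_left_mono)
  then have "f m \<le> b / (1 - \<gamma>)" using \<gamma>1 by (simp add: field_simps)
  then show ?thesis using le[OF assms(3)] by simp
qed

lemma bellman_unique:
  assumes "\<pi> \<in> dec_policies G"
    and f: "\<And>s. s \<in> S \<Longrightarrow> f s = g s + \<gamma> * (\<Sum>s'\<in>S. state_kernel G \<pi> s s' * f s')"
    and h: "\<And>s. s \<in> S \<Longrightarrow> h s = g s + \<gamma> * (\<Sum>s'\<in>S. state_kernel G \<pi> s s' * h s')"
    and "s \<in> S"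
  shows "f s = h s"
proof -
  have "f s - h s \<le> 0 / (1 - \<gamma>)"
  proof (rule kernel_max_principle[OF assms(1)])
    show "f s - h s \<le> 0 + \<gamma> * (\<Sum>s'\<in>S. state_kernel G \<pi> s s' * (f s' - h s'))" if "s \<in> S" for s
      by (subst f[OF that], subst h[OF that]) (simp add: algebra_simps sum_subtractf)
  qed fact
  moreover have "h s - f s \<le> 0 / (1 - \<gamma>)"
  proof (rule kernel_max_principle[OF assms(1)])
    show "h s - f s \<le> 0 + \<gamma> * (\<Sum>s'\<in>S. state_kernel G \<pi> s s' * (h s' - f s'))" if "s \<in> S" for s
      by (subst f[OF that], subst h[OF that]) (simp add: algebra_simps sum_subtractf)
  qed fact
  ultimately show ?thesis by simp
qed

lemma kernel_sum_swap:
  "(\<Sum>a\<in>JA. joint_prob G \<pi> s a * (\<Sum>s'\<in>S. pmf (trans_prob G s a) s' * f s')) =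
   (\<Sum>s'\<in>S. state_kernel G \<pi> s s' * f s')"
  unfolding state_kernel_def sum_distrib_left sum_distrib_right mult.assoc by (rule sum.swap)

lemma V_fun_bellman:
  assumes "\<pi> \<in> dec_policies G" "s \<in> S"
  shows "V_fun G R \<pi> s = (\<Sum>a\<in>JA. joint_prob G \<pi> s a * R s a)
    + \<gamma> * (\<Sum>s'\<in>S. state_kernel G \<pi> s s' * V_fun G R \<pi> s')"
proof -
  have "V_fun G R \<pi> s = (\<Sum>a\<in>JA. joint_prob G \<pi> s a *
      (R s a + \<gamma> * (\<Sum>s'\<in>S. pmf (trans_prob G s a) s' * V_fun G R \<pi> s')))"
    unfolding V_fun_Q_fun[OF assms] by (intro sum.cong refl arg_cong2[where f="(*)"] Q_fun_V_fun assms)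
  then show ?thesis
    unfolding kernel_sum_swap[symmetric] by (simp add: algebra_simps sum.distrib sum_distrib_left)
qed

lemma V_fun_le:
  assumes "\<pi> \<in> dec_policies G" "\<And>s a. s \<in> S \<Longrightarrow> a \<in> JA \<Longrightarrow> R s a \<le> hi" "s \<in> S"
  shows "V_fun G R \<pi> s \<le> hi / (1 - \<gamma>)"
proof (rule kernel_max_principle[OF assms(1)])
  fix s assume s: "s \<in> S"
  have "(\<Sum>a\<in>JA. joint_prob G \<pi> s a * R s a) \<le> (\<Sum>a\<in>JA. joint_prob G \<pi> s a * hi)"
    by (intro sum_mono mult_left_mono assms joint_prob_nonneg s)
  also have "\<dots> = hi" using joint_prob_sum[OF assms(1) s] by (simp add: sum_distrib_right[symmetric])
  finally show "V_fun G R \<pi> s \<le> hi + \<gamma> * (\<Sum>s'\<in>S. state_kernel G \<pi> s s' * V_fun G R \<pi> s')"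
    using V_fun_bellman[OF assms(1) s, of R] by simp
qed fact

lemma V_fun_ge:
  assumes "\<pi> \<in> dec_policies G" "\<And>s a. s \<in> S \<Longrightarrow> a \<in> JA \<Longrightarrow> lo \<le> R s a" "s \<in> S"
  shows "lo / (1 - \<gamma>) \<le> V_fun G R \<pi> s"
proof -
  have "- V_fun G R \<pi> s \<le> (- lo) / (1 - \<gamma>)"
  proof (rule kernel_max_principle[OF assms(1)])
    fix s assume s: "s \<in> S"
    have "lo = (\<Sum>a\<in>JA. joint_prob G \<pi> s a * lo)"
      using joint_prob_sum[OF assms(1) s] by (simp add: sum_distrib_right[symmetric])
    also have "\<dots> \<le> (\<Sum>a\<in>JA. joint_prob G \<pi> s a * R s a)"
      by (intro sum_mono mult_left_mono assms joint_prob_nonneg s)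
    finally show "- V_fun G R \<pi> s \<le> - lo + \<gamma> * (\<Sum>s'\<in>S. state_kernel G \<pi> s s' * - V_fun G R \<pi> s')"
      using V_fun_bellman[OF assms(1) s, of R] by (simp add: sum_negf)
  qed fact
  then show ?thesis by simp
qed

lemma Q_fun_le:
  assumes "\<pi> \<in> dec_policies G" "\<And>s a. s \<in> S \<Longrightarrow> a \<in> JA \<Longrightarrow> R s a \<le> hi" "s \<in> S" "a \<in> JA"
  shows "Q_fun G R \<pi> s a \<le> hi / (1 - \<gamma>)"
proof -
  have "(\<Sum>s'\<in>S. pmf (trans_prob G s a) s' * V_fun G R \<pi> s')
      \<le> (\<Sum>s'\<in>S. pmf (trans_prob G s a) s' * (hi / (1 - \<gamma>)))"
    by (intro sum_mono mult_left_mono V_fun_le assms) auto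
  also have "\<dots> = hi / (1 - \<gamma>)"
    using trans_sum[OF assms(3,4)] by (simp only: sum_distrib_right[symmetric])
  finally have "Q_fun G R \<pi> s a \<le> hi + \<gamma> * (hi / (1 - \<gamma>))"
    unfolding Q_fun_V_fun[OF assms(1,3,4)]
    using \<gamma>0 by (intro add_mono mult_left_mono assms)
  also have "\<dots> = hi / (1 - \<gamma>)" using \<gamma>1 by (simp add: field_simps)
  finally show ?thesis .
qed

lemma Q_fun_ge:
  assumes "\<pi> \<in> dec_policies G" "\<And>s a. s \<in> S \<Longrightarrow> a \<in> JA \<Longrightarrow> lo \<le> R s a" "s \<in> S" "a \<in> JA"
  shows "lo / (1 - \<gamma>) \<le> Q_fun G R \<pi> s a"
proof -
  have "lo / (1 - \<gamma>) = (\<Sum>s'\<in>S. pmf (trans_prob G s a) s' * (lo / (1 - \<gamma>)))"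
    using trans_sum[OF assms(3,4)] by (simp only: sum_distrib_right[symmetric])
  also have "\<dots> \<le> (\<Sum>s'\<in>S. pmf (trans_prob G s a) s' * V_fun G R \<pi> s')"
    by (intro sum_mono mult_left_mono V_fun_ge assms) auto
  finally have "lo + \<gamma> * (lo / (1 - \<gamma>)) \<le> Q_fun G R \<pi> s a"
    unfolding Q_fun_V_fun[OF assms(1,3,4)]
    using \<gamma>0 by (intro add_mono mult_left_mono assms)
  moreover have "lo + \<gamma> * (lo / (1 - \<gamma>)) = lo / (1 - \<gamma>)" using \<gamma>1 by (simp add: field_simps)
  ultimately show ?thesis by simp
qed

lemma occupancy_nonneg: "\<pi> \<in> dec_policies G \<Longrightarrow> s0 \<in> S \<Longrightarrow> 0 \<le> occupancy G \<pi> s0 s"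
  using V_fun_ge[of \<pi> 0 "\<lambda>s' _. of_bool (s' = s)" s0] by (simp add: occupancy_def)

text \<open>
  The right-hand side, as a superposition of the Bellman equations of the occupancies, satisfies the
  same equation as \<open>f\<close>.
\<close>

lemma bellman_occupancy:
  assumes "\<pi> \<in> dec_policies G"
    and f: "\<And>s. s \<in> S \<Longrightarrow> f s = g s + \<gamma> * (\<Sum>s'\<in>S. state_kernel G \<pi> s s' * f s')"
    and "s0 \<in> S"
  shows "f s0 = (\<Sum>s\<in>S. occupancy G \<pi> s0 s * g s)"
proof (rule bellman_unique[OF assms(1) f _ assms(3)])
  fix s0 assume s0: "s0 \<in> S"
  have occ: "occupancy G \<pi> s0 s = of_bool (s0 = s) + \<gamma> * (\<Sum>s'\<in>S. state_kernel G \<pi> s0 s' * occupancy G \<pi> s' s)" for s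
    unfolding occupancy_def
    by (subst V_fun_bellman[OF assms(1) s0]) (simp add: sum_distrib_right[symmetric] joint_prob_sum assms(1) s0)
  have "(\<Sum>s\<in>S. occupancy G \<pi> s0 s * g s) =
      (\<Sum>s\<in>S. of_bool (s0 = s) * g s) +
      (\<Sum>s\<in>S. \<gamma> * (\<Sum>s'\<in>S. state_kernel G \<pi> s0 s' * occupancy G \<pi> s' s) * g s)"
    by (subst occ) (simp add: algebra_simps sum.distrib)
  also have "(\<Sum>s\<in>S. of_bool (s0 = s) * g s) = g s0"
    using s0 by (simp add: of_bool_def if_distrib[where f="\<lambda>x. x * _"] sum.delta' cong: if_cong)
  also have "(\<Sum>s\<in>S. \<gamma> * (\<Sum>s'\<in>S. state_kernel G \<pi> s0 s' * occupancy G \<pi> s' s) * g s)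
      = \<gamma> * (\<Sum>s'\<in>S. state_kernel G \<pi> s0 s' * (\<Sum>s\<in>S. occupancy G \<pi> s' s * g s))"
    by (simp add: sum_distrib_left sum_distrib_right mult.assoc, subst sum.swap) (simp add: mult_ac)
  finally show "(\<Sum>s\<in>S. occupancy G \<pi> s0 s * g s) = g s0 +
      \<gamma> * (\<Sum>s'\<in>S. state_kernel G \<pi> s0 s' * (\<Sum>s\<in>S. occupancy G \<pi> s' s * g s))" .
qed

lemma occupancy_sum:
  assumes "\<pi> \<in> dec_policies G" "s0 \<in> S"
  shows "(\<Sum>s\<in>S. occupancy G \<pi> s0 s) = 1 / (1 - \<gamma>)"
  using bellman_occupancy[OF assms(1) _ assms(2), of "\<lambda>_. 1 / (1 - \<gamma>)" "\<lambda>_. 1"]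
    state_kernel_sum[OF assms(1)] \<gamma>1
  by (simp add: sum_divide_distrib[symmetric] field_simps)

lemma visit_prob_nonneg: "\<pi> \<in> dec_policies G \<Longrightarrow> 0 \<le> visit_prob G \<pi> s"
  unfolding visit_prob_def using \<gamma>1
  by (intro mult_nonneg_nonneg sum_nonneg) (auto simp: occupancy_nonneg)

lemma init_sum: "(\<Sum>s0\<in>S. pmf (init_dist G) s0) = 1"
  by (rule sum_pmf_eq_1[OF finite_S init_closed])

lemma start_occupancy_sum:
  "(\<Sum>s0\<in>S. pmf (init_dist G) s0 * (\<Sum>s\<in>S. occupancy G \<pi> s0 s * g s)) =
    1 / (1 - \<gamma>) * (\<Sum>s\<in>S. visit_prob G \<pi> s * g s)"
proof -
  have "(\<Sum>s\<in>S. visit_prob G \<pi> s * g s) =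
      (1 - \<gamma>) * (\<Sum>s\<in>S. \<Sum>s0\<in>S. pmf (init_dist G) s0 * (occupancy G \<pi> s0 s * g s))"
    unfolding visit_prob_def by (simp add: sum_distrib_left sum_distrib_right mult_ac)
  also have "(\<Sum>s\<in>S. \<Sum>s0\<in>S. pmf (init_dist G) s0 * (occupancy G \<pi> s0 s * g s)) =
      (\<Sum>s0\<in>S. pmf (init_dist G) s0 * (\<Sum>s\<in>S. occupancy G \<pi> s0 s * g s))"
    by (subst sum.swap) (simp add: sum_distrib_left)
  finally show ?thesis using \<gamma>1 by simp
qed

lemma visit_prob_sum:
  assumes "\<pi> \<in> dec_policies G"
  shows "(\<Sum>s\<in>S. visit_prob G \<pi> s) = 1"
  using start_occupancy_sum[of \<pi> "\<lambda>_. 1"] \<gamma>1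
  by (simp add: occupancy_sum[OF assms] init_sum sum_divide_distrib[symmetric])

lemma visit_prob_le_1: "\<pi> \<in> dec_policies G \<Longrightarrow> s \<in> S \<Longrightarrow> visit_prob G \<pi> s \<le> 1"
  using member_le_sum[of s S "visit_prob G \<pi>"] by (simp add: visit_prob_sum visit_prob_nonneg)

lemma expected_A_fun:
  assumes "\<pi> \<in> dec_policies G" "\<pi>' \<in> dec_policies G" "s \<in> S"
  shows "(\<Sum>a\<in>JA. joint_prob G \<pi>' s a * A_fun G R \<pi> s a) =
    (\<Sum>a\<in>JA. (joint_prob G \<pi>' s a - joint_prob G \<pi> s a) * Q_fun G R \<pi> s a)"
  using joint_prob_sum[OF assms(2,3)]
  by (simp add: A_fun_def right_diff_distrib left_diff_distrib sum_subtractf sum_distrib_right[symmetric]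
      V_fun_Q_fun[OF assms(1,3)])

lemma V_difference_bellman:
  assumes "\<pi> \<in> dec_policies G" "\<pi>' \<in> dec_policies G" "s \<in> S"
  shows "V_fun G R \<pi>' s - V_fun G R \<pi> s = (\<Sum>a\<in>JA. joint_prob G \<pi>' s a * A_fun G R \<pi> s a)
    + \<gamma> * (\<Sum>s'\<in>S. state_kernel G \<pi>' s s' * (V_fun G R \<pi>' s' - V_fun G R \<pi> s'))"
proof -
  have "(\<Sum>a\<in>JA. joint_prob G \<pi>' s a * Q_fun G R \<pi> s a) = (\<Sum>a\<in>JA. joint_prob G \<pi>' s a *
      (R s a + \<gamma> * (\<Sum>s'\<in>S. pmf (trans_prob G s a) s' * V_fun G R \<pi> s')))"
    by (intro sum.cong refl arg_cong2[where f="(*)"] Q_fun_V_fun assms)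
  then have "(\<Sum>a\<in>JA. joint_prob G \<pi>' s a * A_fun G R \<pi> s a) = (\<Sum>a\<in>JA. joint_prob G \<pi>' s a * R s a)
      + \<gamma> * (\<Sum>s'\<in>S. state_kernel G \<pi>' s s' * V_fun G R \<pi> s') - V_fun G R \<pi> s"
    using joint_prob_sum[OF assms(2,3)] unfolding kernel_sum_swap[symmetric]
    by (simp add: A_fun_def algebra_simps sum_subtractf sum.distrib sum_distrib_left[symmetric])
  then show ?thesis
    using V_fun_bellman[OF assms(2,3), of R] by (simp add: algebra_simps sum_subtractf)
qed

text \<open>
  The difference of two value functions satisfies the Bellman equation of the new policy with the
  mean advantage in the role of the reward.
\<close>

lemma performance_difference_state:
  assumes "\<pi> \<in> dec_policies G" "\<pi>' \<in> dec_policies G" "s0 \<in> S"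
  shows "V_fun G R \<pi>' s0 - V_fun G R \<pi> s0 =
    (\<Sum>s\<in>S. occupancy G \<pi>' s0 s * (\<Sum>a\<in>JA. joint_prob G \<pi>' s a * A_fun G R \<pi> s a))"
  by (rule bellman_occupancy[OF assms(2) V_difference_bellman[OF assms(1,2)] assms(3)])

lemma performance_difference:
  assumes "\<pi> \<in> dec_policies G" "\<pi>' \<in> dec_policies G"
  shows "start_value G R \<pi>' - start_value G R \<pi> =
    1 / (1 - \<gamma>) * (\<Sum>s\<in>S. visit_prob G \<pi>' s * (\<Sum>a\<in>JA. joint_prob G \<pi>' s a * A_fun G R \<pi> s a))"
proof -
  have "start_value G R \<pi>' - start_value G R \<pi> =
      (\<Sum>s0\<in>S. pmf (init_dist G) s0 * (V_fun G R \<pi>' s0 - V_fun G R \<pi> s0))"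
    by (simp add: start_value_def algebra_simps sum_subtractf)
  then show ?thesis
    by (simp add: performance_difference_state[OF assms] start_occupancy_sum)
qed

lemma abs_expected_A_fun_le:
  assumes "\<pi> \<in> dec_policies G" "\<pi>' \<in> dec_policies G" "s \<in> S"
    and R: "\<And>s a. s \<in> S \<Longrightarrow> a \<in> JA \<Longrightarrow> \<bar>R s a\<bar> \<le> B" 
  shows "\<bar>\<Sum>a\<in>JA. joint_prob G \<pi>' s a * A_fun G R \<pi> s a\<bar> \<le> policy_dist G \<pi>' \<pi> s * (B / (1 - \<gamma>))"
proof -
  have "\<bar>Q_fun G R \<pi> s a\<bar> \<le> B / (1 - \<gamma>)" if "a \<in> JA" for a
    using Q_fun_le[of \<pi> R B s a] Q_fun_ge[of \<pi> "-B" R s a] assms that R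
    by (force simp: abs_le_iff minus_le_iff)
  then have "\<bar>\<Sum>a\<in>JA. joint_prob G \<pi>' s a * A_fun G R \<pi> s a\<bar> \<le>
      (\<Sum>a\<in>JA. \<bar>joint_prob G \<pi>' s a - joint_prob G \<pi> s a\<bar> * (B / (1 - \<gamma>)))"
    unfolding expected_A_fun[OF assms(1-3)]
    by (intro order_trans[OF sum_abs] sum_mono) (simp only: abs_mult, intro mult_left_mono, auto)
  then show ?thesis by (simp only: policy_dist_def sum_distrib_right)
qed

text \<open>
  An action value is at most \<open>B / (1 - \<gamma>)\<close> in absolute value, so the mean advantage is at most \<open>\<delta> B / (1 - \<gamma>)\<close>;
  the performance difference lemma contributes the second factor \<open>1 / (1 - \<gamma>)\<close>.
\<close>

lemma V_fun_lipschitz: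
  assumes "\<pi> \<in> dec_policies G" "\<pi>' \<in> dec_policies G" "s0 \<in> S"
    and R: "\<And>s a. s \<in> S \<Longrightarrow> a \<in> JA \<Longrightarrow> \<bar>R s a\<bar> \<le> B" 
    and \<delta>: "\<And>s. s \<in> S \<Longrightarrow> policy_dist G \<pi>' \<pi> s \<le> \<delta>" and "0 \<le> B"
  shows "\<bar>V_fun G R \<pi>' s0 - V_fun G R \<pi> s0\<bar> \<le> \<delta> * B / (1 - \<gamma>)\<^sup>2"
proof -
  have B: "0 \<le> B / (1 - \<gamma>)" using \<open>0 \<le> B\<close> \<gamma>1 by simp
  have "\<bar>\<Sum>a\<in>JA. joint_prob G \<pi>' s a * A_fun G R \<pi> s a\<bar> \<le> \<delta> * (B / (1 - \<gamma>))" if "s \<in> S" for s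
    using abs_expected_A_fun_le[OF assms(1,2) that R] mult_right_mono[OF \<delta>[OF that] B] by fastforce
  then have "\<bar>V_fun G R \<pi>' s0 - V_fun G R \<pi> s0\<bar> \<le> (\<Sum>s\<in>S. occupancy G \<pi>' s0 s * (\<delta> * (B / (1 - \<gamma>))))"
    unfolding performance_difference_state[OF assms(1-3)]
    by (intro order_trans[OF sum_abs] sum_mono)
       (simp only: abs_mult abs_of_nonneg[OF occupancy_nonneg[OF assms(2,3)]],
        intro mult_left_mono occupancy_nonneg assms, auto)
  also have "\<dots> = \<delta> * B / (1 - \<gamma>)\<^sup>2"
    unfolding sum_distrib_right[symmetric] occupancy_sum[OF assms(2,3)] by (simp add: power2_eq_square)
  finally show ?thesis .
qed

text \<open>
  The mean of \<open>X\<close> under the visitation distribution is \<open>1 - \<gamma>\<close> times the value of the reward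
  \<open>X\<close>, to which the Lipschitz bound for value functions applies.  Testing with all \<open>X\<close> bounded by
  \<open>B\<close> amounts to a bound in \<open>l\<^sub>1\<close> norm.
\<close>

lemma visit_prob_lipschitz:
  assumes "\<pi> \<in> dec_policies G" "\<pi>' \<in> dec_policies G"
    and X: "\<And>s. s \<in> S \<Longrightarrow> \<bar>X s\<bar> \<le> B"
    and \<delta>: "\<And>s. s \<in> S \<Longrightarrow> policy_dist G \<pi>' \<pi> s \<le> \<delta>" and "0 \<le> B"
  shows "\<bar>(\<Sum>s\<in>S. visit_prob G \<pi>' s * X s) - (\<Sum>s\<in>S. visit_prob G \<pi> s * X s)\<bar> \<le> \<delta> * B / (1 - \<gamma>)"
proof -
  let ?V = "V_fun G (\<lambda>s _. X s)"
  have V: "?V \<pi> s0 = (\<Sum>s\<in>S. occupancy G \<pi> s0 s * X s)" if "\<pi> \<in> dec_policies G" "s0 \<in> S" for \<pi> s0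
    by (rule bellman_occupancy[OF that(1) _ that(2)])
       (subst V_fun_bellman[OF that(1)], simp_all add: sum_distrib_right[symmetric] joint_prob_sum that(1))
  have vis: "(\<Sum>s\<in>S. visit_prob G \<pi> s * X s) = (1 - \<gamma>) * (\<Sum>s0\<in>S. pmf (init_dist G) s0 * ?V \<pi> s0)"
    if "\<pi> \<in> dec_policies G" for \<pi>
    using start_occupancy_sum[of \<pi> X] \<gamma>1 by (simp add: V[OF that])
  have "\<bar>\<Sum>s0\<in>S. pmf (init_dist G) s0 * (?V \<pi>' s0 - ?V \<pi> s0)\<bar> \<le>
      (\<Sum>s0\<in>S. pmf (init_dist G) s0 * (\<delta> * B / (1 - \<gamma>)\<^sup>2))"
    by (intro order_trans[OF sum_abs] sum_mono)
       (simp only: abs_mult abs_of_nonneg[OF pmf_nonneg],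
        intro mult_left_mono V_fun_lipschitz assms, auto)
  also have "\<dots> = \<delta> * B / (1 - \<gamma>)\<^sup>2"
    by (simp only: sum_distrib_right[symmetric] init_sum mult_1)
  finally have *: "\<bar>\<Sum>s0\<in>S. pmf (init_dist G) s0 * (?V \<pi>' s0 - ?V \<pi> s0)\<bar> \<le> \<delta> * B / (1 - \<gamma>)\<^sup>2" .
  have "(\<Sum>s\<in>S. visit_prob G \<pi>' s * X s) - (\<Sum>s\<in>S. visit_prob G \<pi> s * X s) =
      (1 - \<gamma>) * (\<Sum>s0\<in>S. pmf (init_dist G) s0 * (?V \<pi>' s0 - ?V \<pi> s0))"
    unfolding vis[OF assms(1)] vis[OF assms(2)]
    by (simp add: right_diff_distrib sum_subtractf)
  then have "\<bar>(\<Sum>s\<in>S. visit_prob G \<pi>' s * X s) - (\<Sum>s\<in>S. visit_prob G \<pi> s * X s)\<bar> =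
      (1 - \<gamma>) * \<bar>\<Sum>s0\<in>S. pmf (init_dist G) s0 * (?V \<pi>' s0 - ?V \<pi> s0)\<bar>"
    using \<gamma>1 by (simp add: abs_mult)
  also have "\<dots> \<le> (1 - \<gamma>) * (\<delta> * B / (1 - \<gamma>)\<^sup>2)"
    using * \<gamma>1 by (intro mult_left_mono) auto
  also have "\<dots> = \<delta> * B / (1 - \<gamma>)" using \<gamma>1 by (simp add: power2_eq_square)
  finally show ?thesis .
qed

lemma softmax_dec: "softmax G \<theta> \<in> dec_policies G"
proof -
  have "(\<Sum>b\<in>acts G i. exp (\<theta> i s b)) > 0" if "i \<in> Ag" for i s
    using that acts_ne by (intro sum_pos) auto
  then have "(\<Sum>a\<in>acts G i. exp (\<theta> i s a) / (\<Sum>b\<in>acts G i. exp (\<theta> i s b))) = 1" if "i \<in> Ag" for i s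
    using that by (simp add: sum_divide_distrib[symmetric] less_imp_neq[symmetric])
  then show ?thesis
    by (auto simp: dec_policies_def softmax_def sum_nonneg)
qed

lemma J_fun_start_value: "J_fun G i \<theta> = start_value G (reward G i) (softmax G \<theta>)"
  unfolding J_fun_def start_value_def
  using init_closed by (subst integral_measure_pmf_real[of S]) (auto simp: mult.commute)

lemma visit_visit_prob: "visit G \<theta> s = visit_prob G (softmax G \<theta>) s"
proof -
  let ?p = "softmax G \<theta>"
  have "(\<Sum>t. \<gamma> ^ t * \<P>(\<omega> in traj_measure G ?p (start_at G ?p s0). fst (\<omega> t) = s)) = occupancy G ?p s0 s"
    if "s0 \<in> S" for s0
  proof -
    let ?T = "traj_measure G ?p (start_at G ?p s0)"
    have "set_pmf (start_at G ?p s0) \<subseteq> S \<times> JA"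
      using set_action_pmf[OF softmax_dec that] that by (auto simp: start_at_def)
    from discounted_return_sums[OF softmax_dec this, where R = "\<lambda>s' _. of_bool (s' = s)"]
    have "(\<lambda>t. \<gamma> ^ t * measure_pmf.expectation (pair_law G ?p (start_at G ?p s0) t) (\<lambda>x. of_bool (fst x = s)))
        sums occupancy G ?p s0 s"
      by (simp add: occupancy_def V_fun_def)
    moreover have "measure_pmf.expectation (pair_law G ?p (start_at G ?p s0) t) (\<lambda>x. of_bool (fst x = s))
        = \<P>(\<omega> in ?T. fst (\<omega> t) = s)" for t
    proof -
      have ind: "(\<lambda>x::nat \<times> (nat \<Rightarrow> nat). of_bool (fst x = s)) = (indicator {x. fst x = s} :: _ \<Rightarrow> real)"
        by (auto simp: fun_eq_iff indicator_def)
      have "measure_pmf.expectation (pair_law G ?p (start_at G ?p s0) t) (\<lambda>x. of_bool (fst x = s))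
          = measure (distr ?T (count_space UNIV) (\<lambda>\<omega>. \<omega> t)) {x. fst x = s}"
        unfolding distr_traj_measure ind by simp
      also have "\<dots> = measure ?T ((\<lambda>\<omega>. \<omega> t) -` {x. fst x = s} \<inter> space ?T)"
        by (rule measure_distr) auto
      also have "(\<lambda>\<omega>. \<omega> t) -` {x. fst x = s} \<inter> space ?T = {\<omega> \<in> space ?T. fst (\<omega> t) = s}" by auto
      finally show ?thesis .
    qed
    ultimately show ?thesis by (simp add: sums_iff)
  qed
  then show ?thesis
    unfolding visit_def visit_prob_def using init_closed
    by (subst integral_measure_pmf_real[of S]) (auto simp: mult.commute intro!: sum.cong)
qed

end

section \<open>Deviations of a single agent\<close>

definition agent_dist :: "stochastic_game \<Rightarrow> policy \<Rightarrow> policy \<Rightarrow> nat \<Rightarrow> nat \<Rightarrow> real" where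
  "agent_dist G \<pi>' \<pi> j s = (\<Sum>x\<in>acts G j. \<bar>\<pi>' j s x - \<pi> j s x\<bar>)"

context game
begin

lemma softmax_pos: "i \<in> Ag \<Longrightarrow> s \<in> S \<Longrightarrow> a \<in> acts G i \<Longrightarrow> 0 < softmax G \<theta> i s a"
  using acts_ne by (auto simp: softmax_def intro!: divide_pos_pos sum_pos)

lemma softmax_tilt:
  assumes "i \<in> Ag" "s \<in> S" "a \<in> acts G i"
  shows "softmax G \<theta>' i s a = tilt (acts G i) (softmax G \<theta> i s) (\<lambda>b. \<theta>' i s b - \<theta> i s b) a"
proof -
  let ?Z = "\<Sum>b\<in>acts G i. exp (\<theta> i s b)"
  have Z: "0 < ?Z" using assms acts_ne by (intro sum_pos) auto
  have *: "softmax G \<theta> i s b * exp (\<theta>' i s b - \<theta> i s b) = exp (\<theta>' i s b) / ?Z" if "b \<in> acts G i" for b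
    using assms that by (simp add: softmax_def exp_diff)
  then have "(\<Sum>b\<in>acts G i. softmax G \<theta> i s b * exp (\<theta>' i s b - \<theta> i s b)) = (\<Sum>b\<in>acts G i. exp (\<theta>' i s b)) / ?Z"
    by (simp add: sum_divide_distrib)
  then show ?thesis
    using Z assms by (simp add: tilt_def *) (simp add: softmax_def)
qed

lemma joint_acts_upd: "i \<in> Ag \<Longrightarrow> x \<in> acts G i \<Longrightarrow> b \<in> PiE (Ag - {i}) (acts G) \<Longrightarrow> b(i := x) \<in> JA"
  using PiE_fun_upd[of x "acts G" i b "Ag - {i}"] by (simp add: joint_acts_def insert_absorb)

lemma joint_expectation_split:
  assumes "i \<in> Ag"
  shows "(\<Sum>a\<in>JA. joint_prob G \<pi> s a * F s a) = (\<Sum>x\<in>acts G i. \<pi> i s x * avg_others G i \<pi> F s x)"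
  unfolding joint_acts_def joint_prob_def avg_others_def
  by (rule sum_PiE_product_split[OF finite_Ag assms])

lemma avg_others_cong:
  assumes "\<And>j. j \<in> Ag - {i} \<Longrightarrow> \<pi>' j s = \<pi> j s"
  shows "avg_others G i \<pi>' F s x = avg_others G i \<pi> F s x"
  unfolding avg_others_def
  by (intro sum.cong refl arg_cong2[where f="(*)"] prod.cong) (simp_all add: assms)

lemma joint_expectation_unilateral:
  assumes "i \<in> Ag" "\<And>j. j \<in> Ag - {i} \<Longrightarrow> \<pi>' j s = \<pi> j s"
  shows "(\<Sum>a\<in>JA. joint_prob G \<pi>' s a * F s a) = (\<Sum>x\<in>acts G i. \<pi>' i s x * avg_others G i \<pi> F s x)"
  using joint_expectation_split[OF assms(1)] avg_others_cong[of i \<pi>' s \<pi>, OF assms(2)] by simp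

lemma others_sum:
  assumes "\<pi> \<in> dec_policies G" "s \<in> S"
  shows "(\<Sum>b\<in>PiE (Ag - {i}) (acts G). \<Prod>j\<in>Ag - {i}. \<pi> j s (b j)) = 1"
  by (rule sum_PiE_product[of "Ag - {i}" "acts G" "\<lambda>j. \<pi> j s"]) (auto simp: dec_policy_sum assms)

lemma avg_others_diff:
  "avg_others G i \<pi> F s x - avg_others G i \<pi> F' s x = avg_others G i \<pi> (\<lambda>s a. F s a - F' s a) s x"
  by (simp add: avg_others_def sum_subtractf right_diff_distrib)

lemma avg_others_A_fun:
  assumes "\<pi> \<in> dec_policies G" "s \<in> S"
  shows "avg_others G i \<pi> (A_fun G R \<pi>) s x = avg_others G i \<pi> (Q_fun G R \<pi>) s x - V_fun G R \<pi> s"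
  by (simp add: avg_others_def A_fun_def[abs_def] right_diff_distrib sum_subtractf
      sum_distrib_right[symmetric] others_sum[OF assms])

lemma A_avg_Q_avg:
  assumes "\<pi> \<in> dec_policies G" "s \<in> S"
  shows "A_avg G i \<pi> s x = Q_avg G i \<pi> s x - V_fun G (reward G i) \<pi> s"
  unfolding A_avg_def Q_avg_def by (rule avg_others_A_fun[OF assms])

lemma A_avg_mean_zero:
  assumes "\<pi> \<in> dec_policies G" "s \<in> S" "i \<in> Ag"
  shows "(\<Sum>x\<in>acts G i. \<pi> i s x * A_avg G i \<pi> s x) = 0"
  unfolding A_avg_def joint_expectation_split[OF assms(3), symmetric] expected_A_fun[OF assms(1) assms(1,2)]
  by simp

lemma abs_avg_others_le:
  assumes "\<pi> \<in> dec_policies G" "s \<in> S" "i \<in> Ag" "x \<in> acts G i"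
    and F: "\<And>a. a \<in> JA \<Longrightarrow> \<bar>F s a\<bar> \<le> B"
  shows "\<bar>avg_others G i \<pi> F s x\<bar> \<le> B"
proof -
  have "\<bar>avg_others G i \<pi> F s x\<bar> \<le>
      (\<Sum>b\<in>PiE (Ag - {i}) (acts G). (\<Prod>j\<in>Ag - {i}. \<pi> j s (b j)) * B)"
    unfolding avg_others_def
  proof (intro order_trans[OF sum_abs] sum_mono)
    fix b assume b: "b \<in> PiE (Ag - {i}) (acts G)"
    have "0 \<le> (\<Prod>j\<in>Ag - {i}. \<pi> j s (b j))" by (intro prod_nonneg) (simp add: dec_policy_nonneg assms)
    then show "\<bar>(\<Prod>j\<in>Ag - {i}. \<pi> j s (b j)) * F s (b(i := x))\<bar> \<le> (\<Prod>j\<in>Ag - {i}. \<pi> j s (b j)) * B"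
      using F[OF joint_acts_upd[OF assms(3,4) b]] by (simp add: abs_mult mult_left_mono)
  qed
  then show ?thesis by (simp add: sum_distrib_right[symmetric] others_sum[OF assms(1,2)])
qed

lemma agent_dist_nonneg: "0 \<le> agent_dist G \<pi>' \<pi> j s"
  unfolding agent_dist_def by (intro sum_nonneg) auto

lemma avg_others_lipschitz:
  assumes "\<pi> \<in> dec_policies G" "\<pi>' \<in> dec_policies G" "s \<in> S" "i \<in> Ag" "x \<in> acts G i"
    and F: "\<And>a. a \<in> JA \<Longrightarrow> \<bar>F s a\<bar> \<le> B" and "0 \<le> B"
  shows "\<bar>avg_others G i \<pi>' F s x - avg_others G i \<pi> F s x\<bar> \<le> (\<Sum>j\<in>Ag. agent_dist G \<pi>' \<pi> j s) * B"
proof -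
  let ?P = "\<lambda>\<pi> b. \<Prod>j\<in>Ag - {i}. \<pi> j s (b j)"
  have "avg_others G i \<pi>' F s x - avg_others G i \<pi> F s x =
      (\<Sum>b\<in>PiE (Ag - {i}) (acts G). (?P \<pi>' b - ?P \<pi> b) * F s (b(i := x)))"
    unfolding avg_others_def by (simp only: left_diff_distrib sum_subtractf)
  then have "\<bar>avg_others G i \<pi>' F s x - avg_others G i \<pi> F s x\<bar> \<le>
      (\<Sum>b\<in>PiE (Ag - {i}) (acts G). \<bar>(?P \<pi>' b - ?P \<pi> b) * F s (b(i := x))\<bar>)"
    by (simp only: sum_abs)
  also have "\<dots> \<le> (\<Sum>b\<in>PiE (Ag - {i}) (acts G). \<bar>?P \<pi>' b - ?P \<pi> b\<bar> * B)"
  proof (rule sum_mono)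
    fix b assume b: "b \<in> PiE (Ag - {i}) (acts G)"
    show "\<bar>(?P \<pi>' b - ?P \<pi> b) * F s (b(i := x))\<bar> \<le> \<bar>?P \<pi>' b - ?P \<pi> b\<bar> * B"
      unfolding abs_mult by (rule mult_left_mono[OF F[OF joint_acts_upd[OF assms(4,5) b]] abs_ge_zero])
  qed
  also have "\<dots> = (\<Sum>b\<in>PiE (Ag - {i}) (acts G). \<bar>?P \<pi>' b - ?P \<pi> b\<bar>) * B"
    by (rule sum_distrib_right[symmetric])
  also have "\<dots> \<le> (\<Sum>j\<in>Ag. agent_dist G \<pi>' \<pi> j s) * B"
  proof (rule mult_right_mono[OF _ \<open>0 \<le> B\<close>])
    have "(\<Sum>b\<in>PiE (Ag - {i}) (acts G). \<bar>?P \<pi>' b - ?P \<pi> b\<bar>) \<le> (\<Sum>j\<in>Ag - {i}. agent_dist G \<pi>' \<pi> j s)"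
      unfolding agent_dist_def
      by (rule product_l1_le[of "Ag - {i}" "acts G" "\<lambda>j. \<pi>' j s" "\<lambda>j. \<pi> j s"])
        (simp_all add: dec_policy_nonneg dec_policy_sum assms(1-3))
    also have "\<dots> \<le> (\<Sum>j\<in>Ag. agent_dist G \<pi>' \<pi> j s)"
      by (rule sum_mono2) (simp_all add: agent_dist_nonneg)
    finally show "(\<Sum>b\<in>PiE (Ag - {i}) (acts G). \<bar>?P \<pi>' b - ?P \<pi> b\<bar>) \<le> (\<Sum>j\<in>Ag. agent_dist G \<pi>' \<pi> j s)" .
  qed
  finally show ?thesis .
qed

lemma policy_dist_le:
  assumes "\<pi> \<in> dec_policies G" "\<pi>' \<in> dec_policies G" "s \<in> S"
  shows "policy_dist G \<pi>' \<pi> s \<le> (\<Sum>j\<in>Ag. agent_dist G \<pi>' \<pi> j s)"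
  unfolding policy_dist_def agent_dist_def joint_prob_def joint_acts_def
  by (rule product_l1_le[of "Ag" "acts G" "\<lambda>j. \<pi>' j s" "\<lambda>j. \<pi> j s"])
     (simp_all add: dec_policy_nonneg dec_policy_sum assms)

lemma softmax_agent_dist_le:
  assumes "j \<in> Ag" "s \<in> S" "\<And>b. b \<in> acts G j \<Longrightarrow> \<bar>\<theta>' j s b - \<theta> j s b\<bar> \<le> m"
  shows "agent_dist G (softmax G \<theta>') (softmax G \<theta>) j s \<le> m"
proof -
  have "(\<Sum>a\<in>acts G j. \<bar>tilt (acts G j) (softmax G \<theta> j s) (\<lambda>b. \<theta>' j s b - \<theta> j s b) a - softmax G \<theta> j s a\<bar>) \<le> m"
    using assms acts_ne by (intro tilt_l1_le) (auto simp: softmax_pos dec_policy_sum softmax_dec)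
  then show ?thesis
    unfolding agent_dist_def using assms by (simp add: softmax_tilt[of j s _ \<theta>' \<theta>])
qed

lemma softmax_cong: "\<theta>' j s = \<theta> j s \<Longrightarrow> softmax G \<theta>' j s = softmax G \<theta> j s"
  by (simp add: softmax_def fun_eq_iff)

lemma J_fun_difference:
  assumes "i \<in> Ag" "\<And>j. j \<in> Ag - {i} \<Longrightarrow> \<theta>' j = \<theta> j"
  shows "J_fun G i \<theta>' - J_fun G i \<theta> = 1 / (1 - \<gamma>) * (\<Sum>s\<in>S. visit_prob G (softmax G \<theta>') s *
    (\<Sum>x\<in>acts G i. softmax G \<theta>' i s x * A_avg G i (softmax G \<theta>) s x))"
proof -
  have "(\<Sum>a\<in>JA. joint_prob G (softmax G \<theta>') s a * A_fun G (reward G i) (softmax G \<theta>) s a) =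
      (\<Sum>x\<in>acts G i. softmax G \<theta>' i s x * A_avg G i (softmax G \<theta>) s x)" for s
    unfolding A_avg_def
    by (rule joint_expectation_unilateral[OF assms(1)]) (rule softmax_cong, simp add: assms)
  then show ?thesis
    unfolding J_fun_start_value performance_difference[OF softmax_dec softmax_dec] by simp
qed

lemma reward_abs_le: "i \<in> Ag \<Longrightarrow> s \<in> S \<Longrightarrow> a \<in> JA \<Longrightarrow> \<bar>reward G i s a\<bar> \<le> 1"
  using reward_range[of i s a] by auto

lemma Q_fun_abs_le:
  assumes "\<pi> \<in> dec_policies G" "i \<in> Ag" "s \<in> S" "a \<in> JA"
  shows "\<bar>Q_fun G (reward G i) \<pi> s a\<bar> \<le> 1 / (1 - \<gamma>)"
  using Q_fun_le[of \<pi> "reward G i" 1 s a] Q_fun_ge[of \<pi> 0 "reward G i" s a] assms reward_range by simp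

lemma A_fun_abs_le:
  assumes "\<pi> \<in> dec_policies G" "\<And>s a. s \<in> S \<Longrightarrow> a \<in> JA \<Longrightarrow> lo \<le> R s a \<and> R s a \<le> hi" "s \<in> S" "a \<in> JA"
  shows "\<bar>A_fun G R \<pi> s a\<bar> \<le> (hi - lo) / (1 - \<gamma>)"
  using Q_fun_le[of \<pi> R hi s a] Q_fun_ge[of \<pi> lo R s a] V_fun_le[of \<pi> R hi s] V_fun_ge[of \<pi> lo R s] assms
  by (simp add: A_fun_def diff_divide_distrib)

lemma A_avg_abs_le:
  assumes "\<pi> \<in> dec_policies G" "i \<in> Ag" "s \<in> S" "x \<in> acts G i"
  shows "\<bar>A_avg G i \<pi> s x\<bar> \<le> 1 / (1 - \<gamma>)"
  unfolding A_avg_def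
proof (rule abs_avg_others_le[OF assms(1,3,2,4)])
  show "\<bar>A_fun G (reward G i) \<pi> s a\<bar> \<le> 1 / (1 - \<gamma>)" if "a \<in> JA" for a
    using A_fun_abs_le[OF assms(1) _ assms(3) that, of 0 "reward G i" 1] reward_range[OF assms(2)] by simp
qed

section \<open>Equilibrium gap and averaged advantages\<close>

lemma J_fun_le:
  assumes "i \<in> Ag"
  shows "J_fun G i \<theta> \<le> 1 / (1 - \<gamma>)"
proof -
  have "J_fun G i \<theta> \<le> (\<Sum>s\<in>S. pmf (init_dist G) s * (1 / (1 - \<gamma>)))"
    unfolding J_fun_start_value start_value_def
    using reward_range[OF assms] by (intro sum_mono mult_left_mono V_fun_le softmax_dec) auto
  then show ?thesis by (simp only: sum_distrib_right[symmetric] init_sum mult_1)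
qed

lemma NEgap_agent_nonneg:
  assumes "i \<in> Ag"
  shows "0 \<le> NEgap_agent G i \<theta>"
proof -
  have "J_fun G i (\<theta>(i := \<theta> i)) \<le> (SUP \<theta>i. J_fun G i (\<theta>(i := \<theta>i)))"
    by (rule cSUP_upper) (auto intro!: bdd_aboveI[where M="1 / (1 - \<gamma>)"] J_fun_le assms)
  then show ?thesis by (simp add: NEgap_agent_def)
qed

text \<open>
  By the performance difference lemma the profit of a deviation is a weighted mean of averaged
  advantages divided by \<open>1 - \<gamma>\<close>, and the weights sum to 1.
\<close>

lemma NEgap_agent_le:
  assumes "i \<in> Ag" and B: "\<And>s x. s \<in> S \<Longrightarrow> x \<in> acts G i \<Longrightarrow> A_avg G i (softmax G \<theta>) s x / (1 - \<gamma>) \<le> B"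
  shows "NEgap_agent G i \<theta> \<le> B"
proof -
  have "J_fun G i (\<theta>(i := \<theta>i)) \<le> J_fun G i \<theta> + B" for \<theta>i
  proof -
    let ?p = "softmax G (\<theta>(i := \<theta>i))"
    have "J_fun G i (\<theta>(i := \<theta>i)) - J_fun G i \<theta> = 
       (\<Sum>s\<in>S. visit_prob G ?p s * (\<Sum>x\<in>acts G i. ?p i s x * (A_avg G i (softmax G \<theta>) s x / (1 - \<gamma>))))"
      by (subst J_fun_difference[OF assms(1)]) (auto simp: sum_divide_distrib[symmetric])
    also have "\<dots> \<le> (\<Sum>s\<in>S. visit_prob G ?p s * (\<Sum>x\<in>acts G i. ?p i s x * B))"
      by (intro sum_mono mult_left_mono B visit_prob_nonneg softmax_dec dec_policy_nonneg)
    also have "\<dots> = (\<Sum>s\<in>S. visit_prob G ?p s * B)"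
      by (intro sum.cong refl) (simp add: sum_distrib_right[symmetric] dec_policy_sum softmax_dec assms(1))
    also have "\<dots> = B" by (simp add: sum_distrib_right[symmetric] visit_prob_sum softmax_dec)
    finally show ?thesis by simp
  qed
  then have "(SUP \<theta>i. J_fun G i (\<theta>(i := \<theta>i))) \<le> J_fun G i \<theta> + B"
    by (intro cSUP_least) auto
  then show ?thesis by (simp add: NEgap_agent_def)
qed

lemma NEgap_sq_le:
  assumes "0 \<le> B"
    and "\<And>i s x. i \<in> Ag \<Longrightarrow> s \<in> S \<Longrightarrow> x \<in> acts G i \<Longrightarrow> A_avg G i (softmax G \<theta>) s x / (1 - \<gamma>) \<le> sqrt B"
  shows "(NEgap G \<theta>)\<^sup>2 \<le> B"
proof -
  have "NEgap G \<theta> \<in> (\<lambda>i. NEgap_agent G i \<theta>) ` Ag"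
    unfolding NEgap_def using Ag_ne by (intro Max_in) auto
  then obtain i where i: "i \<in> Ag" "NEgap G \<theta> = NEgap_agent G i \<theta>" by auto
  have "(NEgap G \<theta>)\<^sup>2 \<le> (sqrt B)\<^sup>2"
    unfolding i(2) using i(1) assms
    by (intro power_mono NEgap_agent_le NEgap_agent_nonneg) auto
  then show ?thesis using assms(1) by simp
qed

lemma c_fun_nonneg: "0 \<le> c_fun G \<theta>"
  unfolding c_fun_def using Ag_ne S_ne
  by (auto intro!: sum_nonneg dec_policy_nonneg[OF softmax_dec])

text \<open>
  The maximizers of the averaged action value are those of the averaged advantage, because the two
  differ by the value of the state.
\<close>

lemma c_fun_le:
  assumes "i \<in> Ag" "s \<in> S"
  obtains A where "A \<subseteq> acts G i" "A \<noteq> {}" "c_fun G \<theta> \<le> (\<Sum>a\<in>A. softmax G \<theta> i s a)"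
    "\<And>a x. a \<in> A \<Longrightarrow> x \<in> acts G i \<Longrightarrow> A_avg G i (softmax G \<theta>) s x \<le> A_avg G i (softmax G \<theta>) s a"
proof
  let ?Q = "Q_avg G i (softmax G \<theta>) s"
  let ?A = "{a. is_arg_max ?Q (\<lambda>a. a \<in> acts G i) a}"
  show "?A \<subseteq> acts G i" by (auto simp: is_arg_max_def)
  have "Max (?Q ` acts G i) \<in> ?Q ` acts G i" using assms acts_ne by (intro Max_in) auto
  then obtain a where "a \<in> acts G i" "?Q a = Max (?Q ` acts G i)" by auto
  then have "a \<in> ?A" using assms by (auto simp: is_arg_max_def not_less)
  then show "?A \<noteq> {}" by blast
  show "A_avg G i (softmax G \<theta>) s x \<le> A_avg G i (softmax G \<theta>) s a" if "a \<in> ?A" "x \<in> acts G i" for a x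
    using that assms by (auto simp: is_arg_max_def not_less A_avg_Q_avg softmax_dec)
  let ?m = "\<lambda>i s. \<Sum>a\<in>{a. is_arg_max (Q_avg G i (softmax G \<theta>) s) (\<lambda>a. a \<in> acts G i) a}. softmax G \<theta> i s a"
  have "c_fun G \<theta> \<le> (MIN s\<in>S. ?m i s)"
    unfolding c_fun_def using assms by (intro Min_le) auto
  also have "\<dots> \<le> ?m i s" using assms by (intro Min_le) auto
  finally show "c_fun G \<theta> \<le> (\<Sum>a\<in>?A. softmax G \<theta> i s a)" .
qed

section \<open>Averaged advantages of a potential game\<close>

text \<open>
  By the Bellman equation for differences of values, the mean averaged advantage in \<open>s\<close> against
  every softmax deviation is determined by the value differences, which agree for the reward and
  for the potential.  Two deviations are enough to separate the actions: the uniform one and the one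
  that doubles the weight of \<open>a\<close>.
\<close>

lemma potential_A_avg:
  assumes "potential G \<phi>" "i \<in> Ag" "s \<in> S" "a \<in> acts G i"
  shows "avg_others G i (softmax G \<theta>) (A_fun G \<phi> (softmax G \<theta>)) s a = A_avg G i (softmax G \<theta>) s a"
proof -
  let ?p = "softmax G \<theta>"
  let ?f = "\<lambda>x. avg_others G i ?p (A_fun G \<phi> ?p) s x - A_avg G i ?p s x"
  have zero: "(\<Sum>x\<in>acts G i. exp (\<theta>i s x) * ?f x) = 0" for \<theta>i
  proof -
    let ?q = "softmax G (\<theta>(i := \<theta>i))"
    have V: "V_fun G (reward G i) ?q s' - V_fun G (reward G i) ?p s' = V_fun G \<phi> ?q s' - V_fun G \<phi> ?p s'"
      if "s' \<in> S" for s'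
      using assms(1,2) that by (simp add: potential_def)
    have "(\<Sum>a\<in>JA. joint_prob G ?q s a * A_fun G (reward G i) ?p s a) =
        (\<Sum>a\<in>JA. joint_prob G ?q s a * A_fun G \<phi> ?p s a)"
      using V_difference_bellman[OF softmax_dec softmax_dec assms(3), of "reward G i" "\<theta>(i := \<theta>i)" \<theta>]
        V_difference_bellman[OF softmax_dec softmax_dec assms(3), of \<phi> "\<theta>(i := \<theta>i)" \<theta>]
      by (simp add: V assms(3))
    moreover have "(\<Sum>a\<in>JA. joint_prob G ?q s a * F s a) = (\<Sum>x\<in>acts G i. ?q i s x * avg_others G i ?p F s x)" for F
      by (rule joint_expectation_unilateral[OF assms(2)]) (rule softmax_cong, simp)
    ultimately have "(\<Sum>x\<in>acts G i. ?q i s x * ?f x) = 0"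
      by (simp add: A_avg_def right_diff_distrib sum_subtractf)
    moreover have "?q i s x = exp (\<theta>i s x) / (\<Sum>b\<in>acts G i. exp (\<theta>i s b))" if "x \<in> acts G i" for x
      using that assms by (simp add: softmax_def)
    moreover have "(\<Sum>b\<in>acts G i. exp (\<theta>i s b)) > 0"
      using assms acts_ne by (intro sum_pos) auto
    ultimately show ?thesis by (simp add: sum_divide_distrib[symmetric])
  qed
  have "(\<Sum>x\<in>acts G i. ?f x) = 0" using zero[of "\<lambda>_ _. 0"] by simp
  moreover have "(\<Sum>x\<in>acts G i. ?f x + (if x = a then ?f x else 0)) = 0"
    \<comment> \<open>The logit \<open>ln 2\<close> gives \<open>a\<close> weight 2 and all other actions weight 1.\<close>
    using zero[of "\<lambda>_ x. if x = a then ln 2 else 0"]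
    by (rule trans[OF sum.cong[OF refl], rotated]) auto
  ultimately show ?thesis
    using assms by (simp add: sum.distrib sum.delta)
qed

lemma potential_start_value:
  assumes "potential G \<phi>" "i \<in> Ag" "\<And>j. j \<noteq> i \<Longrightarrow> \<theta>' j = \<theta> j"
  shows "start_value G \<phi> (softmax G \<theta>') - start_value G \<phi> (softmax G \<theta>) = J_fun G i \<theta>' - J_fun G i \<theta>"
proof -
  have \<theta>': "\<theta>' = \<theta>(i := \<theta>' i)" using assms(3) by auto
  have "V_fun G \<phi> (softmax G \<theta>') s - V_fun G \<phi> (softmax G \<theta>) s =
      V_fun G (reward G i) (softmax G \<theta>') s - V_fun G (reward G i) (softmax G \<theta>) s" if "s \<in> S" for s
    by (subst (1 2) \<theta>') (use assms(1,2) that in \<open>simp add: potential_def\<close>)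
  then show ?thesis
    unfolding J_fun_start_value start_value_def sum_subtractf[symmetric] right_diff_distrib[symmetric]
    by simp
qed

section \<open>The gradient of an agent's value\<close>

text \<open>
  Write the difference quotient with the performance difference lemma.  Only state \<open>s\<close> contributes,
  where the mean advantage \<open>g\<close> is an explicit quotient of sums of exponentials that vanishes at the
  base point; of the visitation distribution only continuity is needed.
\<close>

lemma grad_J_eq:
  assumes i: "i \<in> Ag" and s: "s \<in> S" and a: "a \<in> acts G i"
  shows "grad_J G i \<theta> s a =
    1 / (1 - \<gamma>) * visit_prob G (softmax G \<theta>) s * (softmax G \<theta> i s a * A_avg G i (softmax G \<theta>) s a)"
proof -
  define \<theta>x where "\<theta>x x = \<theta>(i := (\<theta> i)(s := (\<theta> i s)(a := x)))" for x
  let ?x = "\<theta> i s a" and ?p = "softmax G \<theta>"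
  let ?A = "A_avg G i ?p s"
  define g where "g x = (\<Sum>b\<in>acts G i. softmax G (\<theta>x x) i s b * ?A b)" for x
  define d where "d x = visit_prob G (softmax G (\<theta>x x)) s" for x
  have \<theta>x0: "\<theta>x ?x = \<theta>" by (simp add: \<theta>x_def)
  have g0: "g ?x = 0" using A_avg_mean_zero[OF softmax_dec s i] by (simp add: g_def \<theta>x0)
  have J: "J_fun G i (\<theta>x x) - J_fun G i \<theta> = 1 / (1 - \<gamma>) * d x * g x" for x
  proof -
    let ?q = "softmax G (\<theta>x x)"
    have other: "(\<Sum>b\<in>acts G i. ?q i s' b * A_avg G i ?p s' b) = 0" if "s' \<in> S" "s' \<noteq> s" for s'
    proof -
      have "?q i s' = ?p i s'" by (rule softmax_cong) (simp add: \<theta>x_def that)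
      then show ?thesis using A_avg_mean_zero[OF softmax_dec that(1) i] by simp
    qed
    have "J_fun G i (\<theta>x x) - J_fun G i \<theta> = 1 / (1 - \<gamma>) * (\<Sum>s'\<in>S. visit_prob G ?q s' *
        (\<Sum>b\<in>acts G i. ?q i s' b * A_avg G i ?p s' b))"
      by (rule J_fun_difference[OF i]) (simp add: \<theta>x_def)
    also have "(\<Sum>s'\<in>S. visit_prob G ?q s' * (\<Sum>b\<in>acts G i. ?q i s' b * A_avg G i ?p s' b)) = d x * g x"
      unfolding d_def g_def by (subst sum.remove[OF finite_S s]) (simp add: other)
    finally show ?thesis by simp
  qed
  have g': "(g has_field_derivative ?p i s a * ?A a) (at ?x)"
  proof -
    let ?Z = "\<lambda>x. \<Sum>b\<in>acts G i. exp (((\<theta> i s)(a := x)) b)"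
    let ?N = "\<lambda>x. \<Sum>b\<in>acts G i. exp (((\<theta> i s)(a := x)) b) * ?A b"
    have g: "g = (\<lambda>x. ?N x / ?Z x)"
      using i s by (auto simp: g_def softmax_def \<theta>x_def sum_divide_distrib fun_eq_iff intro!: sum.cong)
    have Z: "?Z x > 0" for x
      using i acts_ne by (intro sum_pos) auto
    have dZ: "(?Z has_field_derivative exp ?x) (at ?x)"
    proof -
      have "(?Z has_field_derivative (\<Sum>b\<in>acts G i. if b = a then exp ?x else 0)) (at ?x)"
      proof (rule DERIV_sum)
        fix b assume "b \<in> acts G i"
        show "((\<lambda>x. exp (((\<theta> i s)(a := x)) b)) has_real_derivative (if b = a then exp ?x else 0)) (at ?x)"
          by (cases "b = a") (auto intro!: derivative_eq_intros)
      qed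
      then show ?thesis using a i by (simp add: sum.delta)
    qed
    have dN: "(?N has_field_derivative exp ?x * ?A a) (at ?x)"
    proof -
      have "(?N has_field_derivative (\<Sum>b\<in>acts G i. if b = a then exp ?x * ?A a else 0)) (at ?x)"
      proof (rule DERIV_sum)
        fix b assume "b \<in> acts G i"
        show "((\<lambda>x. exp (((\<theta> i s)(a := x)) b) * ?A b) has_real_derivative (if b = a then exp ?x * ?A a else 0)) (at ?x)"
          by (cases "b = a") (auto intro!: derivative_eq_intros)
      qed
      then show ?thesis using a i by (simp add: sum.delta)
    qed
    have "((\<lambda>x. ?N x / ?Z x) has_field_derivative (exp ?x * ?A a * ?Z ?x - ?N ?x * exp ?x) / (?Z ?x * ?Z ?x)) (at ?x)"
      by (rule DERIV_divide[OF dN dZ]) (use Z[of ?x] in simp)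
    then have D: "(g has_field_derivative (exp ?x * ?A a * ?Z ?x - ?N ?x * exp ?x) / (?Z ?x * ?Z ?x)) (at ?x)"
      unfolding g .
    have "n = 0" if "n / z = 0" "0 < z" for n z :: real using that by simp
    from this[OF g0[unfolded g] Z[of ?x]] have N0: "?N ?x = 0" .
    have p: "?p i s a = exp ?x / ?Z ?x" using i s a by (simp add: softmax_def)
    have "(e * A * z - 0 * e) / (z * z) = e / z * A" if "0 < z" for e A z :: real
      using that by simp
    note this[OF Z[of ?x]]
    then show ?thesis using D unfolding N0 p by (rule subst)
  qed
  have d0: "d ?x = visit_prob G ?p s" by (simp add: d_def \<theta>x0)
  have dist: "\<bar>d x - d ?x\<bar> \<le> \<bar>x - ?x\<bar> / (1 - \<gamma>)" for x
  proof -
    let ?q = "softmax G (\<theta>x x)"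
    have "policy_dist G ?q ?p s' \<le> \<bar>x - ?x\<bar>" if "s' \<in> S" for s'
    proof -
      have "policy_dist G ?q ?p s' \<le> (\<Sum>j\<in>Ag. agent_dist G ?q ?p j s')"
        by (rule policy_dist_le[OF softmax_dec softmax_dec that])
      also have "\<dots> \<le> (\<Sum>j\<in>Ag. if j = i then \<bar>x - ?x\<bar> else 0)"
        using that by (intro sum_mono softmax_agent_dist_le) (auto simp: \<theta>x_def)
      also have "\<dots> = \<bar>x - ?x\<bar>" using i by simp
      finally show ?thesis .
    qed
    \<comment> \<open>Only agent \<open>i\<close> moves, and by at most \<open>\<bar>x - \<theta> i s a\<bar>\<close> in the logits.\<close>
    from visit_prob_lipschitz[OF softmax_dec softmax_dec _ this, of "\<lambda>s'. of_bool (s' = s)" 1]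
    have "\<bar>(\<Sum>s'\<in>S. visit_prob G ?q s' * of_bool (s' = s)) - (\<Sum>s'\<in>S. visit_prob G ?p s' * of_bool (s' = s))\<bar>
        \<le> \<bar>x - ?x\<bar> * 1 / (1 - \<gamma>)" by simp
    moreover have "(\<Sum>s'\<in>S. f s' * of_bool (s' = s)) = f s" for f :: "nat \<Rightarrow> real"
    proof -
      have "S \<inter> {s'. s' = s} = {s}" using s by auto
      then show ?thesis by (simp add: sum_mult_of_bool_eq)
    qed
    ultimately show ?thesis by (simp add: d_def \<theta>x0)
  qed
  have dlim: "(d \<longlongrightarrow> d ?x) (at ?x)"
  proof (rule LIM_zero_cancel, rule tendsto_0_le[where K="1 / (1 - \<gamma>)"])
    show "((\<lambda>x. x - ?x) \<longlongrightarrow> 0) (at ?x)" by (rule LIM_zero) (rule tendsto_ident_at)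
    show "\<forall>\<^sub>F x in at ?x. norm (d x - d ?x) \<le> norm (x - ?x) * (1 / (1 - \<gamma>))"
      using dist by simp
  qed
  have glim: "((\<lambda>x. g x / (x - ?x)) \<longlongrightarrow> ?p i s a * ?A a) (at ?x)"
    using g' g0 by (simp add: has_field_derivative_iff)
  have "((\<lambda>x. J_fun G i (\<theta>x x)) has_field_derivative 1 / (1 - \<gamma>) * d ?x * (?p i s a * ?A a)) (at ?x)"
    unfolding has_field_derivative_iff \<theta>x0 J
    using tendsto_mult[OF tendsto_mult[OF tendsto_const dlim] glim, of "1 / (1 - \<gamma>)"] by simp
  then show ?thesis
    unfolding grad_J_def \<theta>x_def[symmetric] d0 by (rule DERIV_imp_deriv)
qed

end

section \<open>Ascent along gradient play\<close>

text \<open>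
  The parameter after agents \<open>1, \<dots>, k\<close> have moved from \<open>\<theta>\<close> to \<open>\<theta>'\<close>.
\<close>

definition hybrid :: "param \<Rightarrow> param \<Rightarrow> nat \<Rightarrow> param" where
  "hybrid \<theta>' \<theta> k = (\<lambda>j. if j \<le> k then \<theta>' j else \<theta> j)"

definition grad_sq :: "stochastic_game \<Rightarrow> param \<Rightarrow> real" where
  "grad_sq G \<theta> = (\<Sum>i\<in>agents G. \<Sum>s\<in>states G. \<Sum>a\<in>acts G i. (grad_J G i \<theta> s a)\<^sup>2)"

context game
begin

lemma softmax_agents_cong: "(\<And>j. j \<in> Ag \<Longrightarrow> \<theta>' j = \<theta> j) \<Longrightarrow> softmax G \<theta>' = softmax G \<theta>"
  by (auto simp: softmax_def fun_eq_iff)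

lemma softmax_hybrid_0: "softmax G (hybrid \<theta>' \<theta> 0) = softmax G \<theta>"
  and softmax_hybrid_all: "softmax G (hybrid \<theta>' \<theta> (num_agents G)) = softmax G \<theta>'"
  by (auto intro!: softmax_agents_cong simp: hybrid_def agents_def)

lemma hybrid_telescope:
  fixes F :: "policy \<Rightarrow> real"
  shows "F (softmax G \<theta>') - F (softmax G \<theta>) =
    (\<Sum>i\<in>Ag. F (softmax G (hybrid \<theta>' \<theta> i)) - F (softmax G (hybrid \<theta>' \<theta> (i - 1))))"
  using sum_telescope''[of 0 "num_agents G" "\<lambda>k. F (softmax G (hybrid \<theta>' \<theta> k))"]
  by (simp add: agents_def softmax_hybrid_0 softmax_hybrid_all)

lemma hybrid_step: "j \<noteq> i \<Longrightarrow> hybrid \<theta>' \<theta> i j = hybrid \<theta>' \<theta> (i - 1) j"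
  by (auto simp: hybrid_def)

lemma hybrid_prev: "i \<in> Ag \<Longrightarrow> hybrid \<theta>' \<theta> (i - 1) i = \<theta> i"
  and hybrid_self: "hybrid \<theta>' \<theta> i i = \<theta>' i"
  by (auto simp: hybrid_def agents_def)

lemma hybrid_cases: "hybrid \<theta>' \<theta> k j = \<theta>' j \<or> hybrid \<theta>' \<theta> k j = \<theta> j"
  by (simp add: hybrid_def)

lemma Q_avg_abs_le:
  assumes "\<pi> \<in> dec_policies G" "i \<in> Ag" "s \<in> S" "x \<in> acts G i"
  shows "\<bar>Q_avg G i \<pi> s x\<bar> \<le> 1 / (1 - \<gamma>)"
  unfolding Q_avg_def by (rule abs_avg_others_le[OF assms(1,3,2,4)]) (rule Q_fun_abs_le[OF assms(1,2,3)])

text \<open>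
  The policies of the other agents enter through the average, at cost \<open>D / (1 - \<gamma>)\<close>, and through the
  future values, at cost \<open>\<gamma> D / (1 - \<gamma>)\<^sup>2\<close>; the two add up to the bound.
\<close>

lemma Q_avg_lipschitz:
  assumes "\<pi> \<in> dec_policies G" "\<pi>' \<in> dec_policies G" "s \<in> S" "i \<in> Ag" "x \<in> acts G i"
    and D: "\<And>s. s \<in> S \<Longrightarrow> (\<Sum>j\<in>Ag. agent_dist G \<pi>' \<pi> j s) \<le> D"
  shows "\<bar>Q_avg G i \<pi>' s x - Q_avg G i \<pi> s x\<bar> \<le> D / (1 - \<gamma>)\<^sup>2"
proof -
  let ?Q = "Q_fun G (reward G i)" and ?V = "V_fun G (reward G i)"
  have inv: "0 \<le> 1 / (1 - \<gamma>)" using \<gamma>1 by simp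
  have "\<bar>avg_others G i \<pi>' (?Q \<pi>') s x - avg_others G i \<pi> (?Q \<pi>') s x\<bar> \<le>
      (\<Sum>j\<in>Ag. agent_dist G \<pi>' \<pi> j s) * (1 / (1 - \<gamma>))"
    by (rule avg_others_lipschitz[OF assms(1-5) _ inv]) (rule Q_fun_abs_le[OF assms(2,4,3)])
  also have "\<dots> \<le> D * (1 / (1 - \<gamma>))"
    by (rule mult_right_mono[OF D[OF assms(3)] inv])
  finally have 1: "\<bar>avg_others G i \<pi>' (?Q \<pi>') s x - avg_others G i \<pi> (?Q \<pi>') s x\<bar> \<le> D / (1 - \<gamma>)"
    by simp
  have V: "\<bar>?V \<pi>' s' - ?V \<pi> s'\<bar> \<le> D / (1 - \<gamma>)\<^sup>2" if "s' \<in> S" for s'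
    using V_fun_lipschitz[OF assms(1,2) that reward_abs_le[OF assms(4)], where \<delta> = D]
      order_trans[OF policy_dist_le[OF assms(1,2)] D] by simp
  have "\<bar>?Q \<pi>' s a - ?Q \<pi> s a\<bar> \<le> \<gamma> * (D / (1 - \<gamma>)\<^sup>2)" if a: "a \<in> JA" for a
  proof -
    let ?W = "\<Sum>s'\<in>S. pmf (trans_prob G s a) s' * (?V \<pi>' s' - ?V \<pi> s')"
    have "\<bar>?W\<bar> \<le> (\<Sum>s'\<in>S. pmf (trans_prob G s a) s' * (D / (1 - \<gamma>)\<^sup>2))"
      by (intro order_trans[OF sum_abs] sum_mono)
         (simp only: abs_mult abs_of_nonneg[OF pmf_nonneg], intro mult_left_mono V pmf_nonneg)
    also have "\<dots> = D / (1 - \<gamma>)\<^sup>2"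
      by (simp only: sum_distrib_right[symmetric] trans_sum[OF assms(3) a] mult_1)
    finally have "\<gamma> * \<bar>?W\<bar> \<le> \<gamma> * (D / (1 - \<gamma>)\<^sup>2)"
      by (rule mult_left_mono[OF _ \<gamma>0])
    moreover have "?Q \<pi>' s a - ?Q \<pi> s a = \<gamma> * ?W"
      by (simp add: Q_fun_V_fun[OF assms(1,3) a] Q_fun_V_fun[OF assms(2,3) a] right_diff_distrib sum_subtractf)
    ultimately show ?thesis by (simp only: abs_mult abs_of_nonneg[OF \<gamma>0])
  qed
  then have 2: "\<bar>avg_others G i \<pi> (?Q \<pi>') s x - avg_others G i \<pi> (?Q \<pi>) s x\<bar> \<le> \<gamma> * (D / (1 - \<gamma>)\<^sup>2)"
    unfolding avg_others_diff by (intro abs_avg_others_le assms)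
  have "D / (1 - \<gamma>) + \<gamma> * (D / (1 - \<gamma>)\<^sup>2) = D / (1 - \<gamma>)\<^sup>2"
    using \<gamma>1 by (simp add: divide_simps power2_eq_square) (simp add: algebra_simps)
  then show ?thesis using 1 2 unfolding Q_avg_def by linarith
qed

definition first_order :: "nat \<Rightarrow> param \<Rightarrow> param \<Rightarrow> real" where
  "first_order i \<theta> v = (\<Sum>s\<in>S. \<Sum>a\<in>acts G i. grad_J G i \<theta> s a * v i s a)"

text \<open>
  The linearization is taken at \<open>\<theta>\<close> although agent \<open>i\<close> moves from \<open>h\<close>, where some other agents
  have moved already.  Writing both the change and its linearization as sums over states, there are
  three sources of error: the visitation distribution (\<open>N\<^sub>i D\<close>), the second-order part of the
  softmax map (\<open>2 N\<^sub>i\<^sup>2\<close>), and the averaged action values (\<open>2 N\<^sub>i D\<close>), all over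
  \<open>(1 - \<gamma>)\<^sup>3\<close>.
\<close>

lemma J_fun_first_order:
  fixes \<theta> \<theta>' h h' :: param
  assumes i: "i \<in> Ag"
    and h: "\<And>j. h j = \<theta>' j \<or> h j = \<theta> j" "h i = \<theta> i" and h': "h' i = \<theta>' i" "\<And>j. j \<noteq> i \<Longrightarrow> h' j = h j"
    and small: "\<And>s a. s \<in> S \<Longrightarrow> a \<in> acts G i \<Longrightarrow> \<bar>\<theta>' i s a - \<theta> i s a\<bar> \<le> 1 / 2"
    and N: "\<And>j s a. j \<in> Ag \<Longrightarrow> s \<in> S \<Longrightarrow> a \<in> acts G j \<Longrightarrow> \<bar>\<theta>' j s a - \<theta> j s a\<bar> \<le> N j"
      "\<And>j. j \<in> Ag \<Longrightarrow> 0 \<le> N j"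
  defines "D \<equiv> \<Sum>j\<in>Ag. N j"
  shows "\<bar>J_fun G i h' - J_fun G i h - first_order i \<theta> (\<lambda>j s a. \<theta>' j s a - \<theta> j s a)\<bar> \<le>
    (3 * N i * D + 2 * (N i)\<^sup>2) / (1 - \<gamma>) ^ 3"
proof -
  let ?\<pi> = "softmax G \<theta>" and ?p = "softmax G h" and ?q = "softmax G h'"
  let ?v = "\<lambda>s a. \<theta>' i s a - \<theta> i s a"
  define m where "m s = (\<Sum>b\<in>acts G i. ?\<pi> i s b * ?v s b)" for s
  define w where "w s a = ?\<pi> i s a * (?v s a - m s)" for s a
  define X where "X s = (\<Sum>a\<in>acts G i. ?q i s a * A_avg G i ?p s a)" for s
  define Y where "Y s = (\<Sum>a\<in>acts G i. ?\<pi> i s a * A_avg G i ?\<pi> s a * ?v s a)" for s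
  have g: "0 < 1 - \<gamma>" "1 - \<gamma> \<le> 1" using \<gamma>0 \<gamma>1 by auto
  have D0: "0 \<le> D" unfolding D_def using N by (intro sum_nonneg) auto
  have pi: "?p i s = ?\<pi> i s" for s by (rule softmax_cong) (simp add: h)
  have dist_p: "(\<Sum>j\<in>Ag. agent_dist G ?p ?\<pi> j s) \<le> D" if "s \<in> S" for s
    unfolding D_def
  proof (intro sum_mono softmax_agent_dist_le)
    show "\<bar>h j s b - \<theta> j s b\<bar> \<le> N j" if "j \<in> Ag" "b \<in> acts G j" for j b
      using h(1)[of j] N that \<open>s \<in> S\<close> by auto
  qed (use that in auto)
  have dist_q: "(\<Sum>j\<in>Ag. agent_dist G ?q ?\<pi> j s) \<le> D" if "s \<in> S" for s
    unfolding D_def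
  proof (intro sum_mono softmax_agent_dist_le)
    show "\<bar>h' j s b - \<theta> j s b\<bar> \<le> N j" if "j \<in> Ag" "b \<in> acts G j" for j b
      using h(1)[of j] h' N that \<open>s \<in> S\<close> by (cases "j = i") auto
  qed (use that in auto)
  have Jdiff: "J_fun G i h' - J_fun G i h = 1 / (1 - \<gamma>) * (\<Sum>s\<in>S. visit_prob G ?q s * X s)"
    unfolding X_def by (rule J_fun_difference[OF i]) (simp add: h')
  have first: "first_order i \<theta> (\<lambda>j s a. \<theta>' j s a - \<theta> j s a) = 1 / (1 - \<gamma>) * (\<Sum>s\<in>S. visit_prob G ?\<pi> s * Y s)"
    unfolding first_order_def Y_def sum_distrib_left
    by (intro sum.cong refl) (simp add: grad_J_eq[OF i])
  have tilt: "?q i s a = tilt (acts G i) (?\<pi> i s) (?v s) a" if "s \<in> S" "a \<in> acts G i" for s a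
    using softmax_tilt[OF i that, of h' \<theta>] by (simp add: h')
  have state: "\<bar>X s\<bar> \<le> N i / (1 - \<gamma>) \<and> \<bar>X s - Y s\<bar> \<le> (2 * (N i)\<^sup>2 + 2 * N i * D) / (1 - \<gamma>)\<^sup>2" if s: "s \<in> S" for s
  proof -
    let ?A = "acts G i"
    have A: "finite ?A" "?A \<noteq> {}" using i acts_ne by auto
    have pos: "\<And>a. a \<in> ?A \<Longrightarrow> 0 < ?\<pi> i s a" by (rule softmax_pos[OF i s])
    have sum1: "(\<Sum>a\<in>?A. ?\<pi> i s a) = 1" by (rule dec_policy_sum[OF softmax_dec i s])
    \<comment> \<open>Both \<open>q - \<pi>\<close> and \<open>w\<close> have total mass 0, so advantages may be replaced by action values.\<close>
    have split: "(\<Sum>a\<in>?A. f a * (k a - l)) = (\<Sum>a\<in>?A. f a * k a) - (\<Sum>a\<in>?A. f a) * l"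
      for f k :: "nat \<Rightarrow> real" and l
      by (simp add: right_diff_distrib sum_subtractf sum_distrib_right)
    have X: "X s = (\<Sum>a\<in>?A. (?q i s a - ?\<pi> i s a) * Q_avg G i ?p s a)"
    proof -
      have "X s = X s - (\<Sum>a\<in>?A. ?\<pi> i s a * A_avg G i ?p s a)"
        using A_avg_mean_zero[OF softmax_dec s i, of h] by (simp add: pi)
      also have "\<dots> = (\<Sum>a\<in>?A. (?q i s a - ?\<pi> i s a) * A_avg G i ?p s a)"
        by (simp add: X_def left_diff_distrib sum_subtractf)
      also have "\<dots> = (\<Sum>a\<in>?A. (?q i s a - ?\<pi> i s a) * Q_avg G i ?p s a)
          - (\<Sum>a\<in>?A. ?q i s a - ?\<pi> i s a) * V_fun G (reward G i) ?p s"
        unfolding A_avg_Q_avg[OF softmax_dec s] by (rule split)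
      also have "(\<Sum>a\<in>?A. ?q i s a - ?\<pi> i s a) = 0"
        by (simp add: sum_subtractf dec_policy_sum[OF softmax_dec i s])
      finally show ?thesis by simp
    qed
    have wsum: "(\<Sum>a\<in>?A. w s a) = 0"
      by (simp add: w_def right_diff_distrib sum_subtractf sum_distrib_right[symmetric] sum1 m_def)
    have Y: "Y s = (\<Sum>a\<in>?A. w s a * Q_avg G i ?\<pi> s a)"
    proof -
      have "(\<Sum>a\<in>?A. w s a * Q_avg G i ?\<pi> s a) =
          (\<Sum>a\<in>?A. w s a * A_avg G i ?\<pi> s a) + (\<Sum>a\<in>?A. w s a) * V_fun G (reward G i) ?\<pi> s"
        unfolding A_avg_Q_avg[OF softmax_dec s] right_diff_distrib sum_subtractf sum_distrib_right by simp
      also have "\<dots> = Y s - m s * (\<Sum>a\<in>?A. ?\<pi> i s a * A_avg G i ?\<pi> s a)"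
        unfolding wsum by (simp add: w_def Y_def sum_distrib_left sum_subtractf[symmetric] algebra_simps)
      finally show ?thesis using A_avg_mean_zero[OF softmax_dec s i, of \<theta>] by simp
    qed
    have l1: "(\<Sum>a\<in>?A. \<bar>?q i s a - ?\<pi> i s a\<bar>) \<le> N i"
      using tilt_l1_le[OF A pos sum1, of "?v s" "N i"] N(1)[OF i s] by (simp add: tilt[OF s])
    have sq: "(\<Sum>a\<in>?A. ?\<pi> i s a * (?v s a)\<^sup>2) \<le> (N i)\<^sup>2"
    proof -
      have "(\<Sum>a\<in>?A. ?\<pi> i s a * (?v s a)\<^sup>2) \<le> (\<Sum>a\<in>?A. ?\<pi> i s a * (N i)\<^sup>2)"
        using N(1)[OF i s] N(2)[OF i] pos
        by (intro sum_mono mult_left_mono) (auto simp: abs_le_square_iff[symmetric] less_imp_le)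
      then show ?thesis by (simp add: sum_distrib_right[symmetric] sum1)
    qed
    have l2: "(\<Sum>a\<in>?A. \<bar>?q i s a - ?\<pi> i s a - w s a\<bar>) \<le> 2 * (N i)\<^sup>2"
      using tilt_first_order[OF A pos sum1, of "?v s"] small[OF s] sq
      by (simp add: tilt[OF s] w_def m_def)
    have l3: "(\<Sum>a\<in>?A. \<bar>w s a\<bar>) \<le> 2 * N i"
    proof -
      have "\<bar>m s\<bar> \<le> (\<Sum>b\<in>?A. ?\<pi> i s b * N i)"
        unfolding m_def using N(1)[OF i s] pos
        by (intro order_trans[OF sum_abs] sum_mono) (auto simp: abs_mult less_imp_le intro!: mult_mono)
      then have "\<bar>m s\<bar> \<le> N i" by (simp add: sum_distrib_right[symmetric] sum1)
      then have "\<bar>w s a\<bar> \<le> ?\<pi> i s a * (2 * N i)" if "a \<in> ?A" for a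
        using N(1)[OF i s that] pos[OF that] by (auto simp: w_def abs_mult intro!: mult_left_mono)
      then have "(\<Sum>a\<in>?A. \<bar>w s a\<bar>) \<le> (\<Sum>a\<in>?A. ?\<pi> i s a * (2 * N i))" by (rule sum_mono)
      then show ?thesis by (simp add: sum_distrib_right[symmetric] sum1)
    qed
    have weighted: "\<bar>\<Sum>a\<in>?A. f a * k a\<bar> \<le> L * K"
      if "(\<Sum>a\<in>?A. \<bar>f a\<bar>) \<le> L" "\<And>a. a \<in> ?A \<Longrightarrow> \<bar>k a\<bar> \<le> K" "0 \<le> K" for f k :: "nat \<Rightarrow> real" and L K
    proof -
      have "\<bar>\<Sum>a\<in>?A. f a * k a\<bar> \<le> (\<Sum>a\<in>?A. \<bar>f a\<bar> * K)"
        using that by (intro order_trans[OF sum_abs] sum_mono) (auto simp: abs_mult intro!: mult_left_mono)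
      also have "\<dots> \<le> L * K" unfolding sum_distrib_right[symmetric] using that by (intro mult_right_mono) auto
      finally show ?thesis .
    qed
    have b1: "\<bar>X s\<bar> \<le> N i * (1 / (1 - \<gamma>))"
      unfolding X using g by (intro weighted l1 Q_avg_abs_le softmax_dec i s) auto
    have "X s - Y s = (\<Sum>a\<in>?A. (?q i s a - ?\<pi> i s a - w s a) * Q_avg G i ?p s a)
        + (\<Sum>a\<in>?A. w s a * (Q_avg G i ?p s a - Q_avg G i ?\<pi> s a))"
      unfolding X Y sum_subtractf[symmetric] sum.distrib[symmetric]
      by (intro sum.cong refl) (simp add: algebra_simps)
    moreover have "\<bar>\<Sum>a\<in>?A. (?q i s a - ?\<pi> i s a - w s a) * Q_avg G i ?p s a\<bar> \<le> 2 * (N i)\<^sup>2 * (1 / (1 - \<gamma>))"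
      using g by (intro weighted l2 Q_avg_abs_le softmax_dec i s) auto
    moreover have "\<bar>\<Sum>a\<in>?A. w s a * (Q_avg G i ?p s a - Q_avg G i ?\<pi> s a)\<bar> \<le> 2 * N i * (D / (1 - \<gamma>)\<^sup>2)"
      using D0 by (intro weighted l3 Q_avg_lipschitz softmax_dec i s dist_p) auto
    moreover have "2 * (N i)\<^sup>2 * (1 / (1 - \<gamma>)) \<le> 2 * (N i)\<^sup>2 / (1 - \<gamma>)\<^sup>2"
      unfolding times_divide_eq_right mult_1_right using g
      by (intro divide_left_mono) (auto simp: power2_eq_square mult_left_le)
    ultimately have "\<bar>X s - Y s\<bar> \<le> 2 * (N i)\<^sup>2 / (1 - \<gamma>)\<^sup>2 + 2 * N i * (D / (1 - \<gamma>)\<^sup>2)"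
      by linarith
    with b1 show ?thesis by (simp add: add_divide_distrib)
  qed
  let ?S1 = "(\<Sum>s\<in>S. visit_prob G ?q s * X s) - (\<Sum>s\<in>S. visit_prob G ?\<pi> s * X s)"
  let ?S2 = "\<Sum>s\<in>S. visit_prob G ?\<pi> s * (X s - Y s)"
  let ?E = "(2 * (N i)\<^sup>2 + 2 * N i * D) / (1 - \<gamma>)\<^sup>2"
  have "\<bar>?S1\<bar> \<le> D * (N i / (1 - \<gamma>)) / (1 - \<gamma>)"
    using state N(2)[OF i] g order_trans[OF policy_dist_le[OF softmax_dec softmax_dec] dist_q]
    by (intro visit_prob_lipschitz softmax_dec) auto
  then have s1: "\<bar>?S1\<bar> \<le> N i * D / (1 - \<gamma>)\<^sup>2"
    by (simp add: power2_eq_square mult.commute)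
  have s2: "\<bar>?S2\<bar> \<le> ?E"
  proof -
    have "\<bar>?S2\<bar> \<le> (\<Sum>s\<in>S. visit_prob G ?\<pi> s * ?E)"
      by (intro order_trans[OF sum_abs] sum_mono)
         (simp only: abs_mult abs_of_nonneg[OF visit_prob_nonneg[OF softmax_dec]],
          intro mult_left_mono visit_prob_nonneg softmax_dec, use state in blast)
    then show ?thesis by (simp only: sum_distrib_right[symmetric] visit_prob_sum[OF softmax_dec] mult_1)
  qed
  have "J_fun G i h' - J_fun G i h - first_order i \<theta> (\<lambda>j s a. \<theta>' j s a - \<theta> j s a) = 1 / (1 - \<gamma>) * (?S1 + ?S2)"
    unfolding Jdiff first by (simp add: right_diff_distrib sum_subtractf)
  then have "\<bar>J_fun G i h' - J_fun G i h - first_order i \<theta> (\<lambda>j s a. \<theta>' j s a - \<theta> j s a)\<bar> = 1 / (1 - \<gamma>) * \<bar>?S1 + ?S2\<bar>"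
    using g by (simp add: abs_mult)
  also have "\<dots> \<le> 1 / (1 - \<gamma>) * (N i * D / (1 - \<gamma>)\<^sup>2 + ?E)"
    using s1 s2 g by (intro mult_left_mono) auto
  also have "\<dots> = (3 * N i * D + 2 * (N i)\<^sup>2) / (1 - \<gamma>) ^ 3"
    by (simp add: add_divide_distrib[symmetric] power2_eq_square power3_eq_cube algebra_simps)
  finally show ?thesis .
qed

lemma grad_J_abs_le:
  assumes "i \<in> Ag" "s \<in> S" "a \<in> acts G i"
  shows "\<bar>grad_J G i \<theta> s a\<bar> \<le> 1 / (1 - \<gamma>)\<^sup>2"
proof -
  let ?p = "softmax G \<theta>"
  have p1: "?p i s a \<le> 1"
    using member_le_sum[of a "acts G i" "?p i s"] assms dec_policy_sum[OF softmax_dec assms(1,2), of \<theta>]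
    by (simp add: dec_policy_nonneg softmax_dec)
  have "\<bar>grad_J G i \<theta> s a\<bar> = 1 / (1 - \<gamma>) * visit_prob G ?p s * (?p i s a * \<bar>A_avg G i ?p s a\<bar>)"
    unfolding grad_J_eq[OF assms] using \<gamma>1 softmax_pos[OF assms, of \<theta>] visit_prob_nonneg[OF softmax_dec, of \<theta> s]
    by (simp add: abs_mult)
  also have "\<dots> \<le> 1 / (1 - \<gamma>) * 1 * (1 * (1 / (1 - \<gamma>)))"
    using \<gamma>1 p1 softmax_pos[OF assms, of \<theta>] visit_prob_nonneg[OF softmax_dec, of \<theta> s]
      visit_prob_le_1[OF softmax_dec assms(2), of \<theta>] A_avg_abs_le[OF softmax_dec assms, of \<theta>]
    by (intro mult_mono) auto
  finally show ?thesis by (simp add: power2_eq_square)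
qed

text \<open>
  Moving the agents one after the other gains \<open>\<eta> \<bar>\<nabla>\<^sub>i J\<^sub>i\<bar>\<^sup>2\<close> for each agent to first
  order.  The errors sum up to at most \<open>5 n \<eta>\<^sup>2 \<bar>\<nabla>\<bar>\<^sup>2 / (1 - \<gamma>)\<^sup>3\<close>, which is \<open>5 / 6\<close> of the
  first-order gain for this \<open>\<eta>\<close>; a sixth of it remains.
\<close>

lemma gradient_step_ascent:
  assumes pot: "potential G \<phi>"
    and step: "\<And>i s a. i \<in> Ag \<Longrightarrow> s \<in> S \<Longrightarrow> a \<in> acts G i \<Longrightarrow>
      \<theta>' i s a = \<theta> i s a + (1 - \<gamma>) ^ 3 / (6 * real (num_agents G)) * grad_J G i \<theta> s a"
  shows "(1 - \<gamma>) ^ 3 / (36 * real (num_agents G)) * grad_sq G \<theta> \<le>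
    start_value G \<phi> (softmax G \<theta>') - start_value G \<phi> (softmax G \<theta>)"
proof -
  let ?n = "real (num_agents G)"
  define \<eta> where "\<eta> = (1 - \<gamma>) ^ 3 / (6 * ?n)"
  have n: "1 \<le> ?n" using num_agents_pos by simp
  have g: "0 < 1 - \<gamma>" "1 - \<gamma> \<le> 1" using \<gamma>0 \<gamma>1 by auto
  have \<eta>: "0 < \<eta>" using n g by (simp add: \<eta>_def)
  define g2 where "g2 i = (\<Sum>s\<in>S. \<Sum>a\<in>acts G i. (grad_J G i \<theta> s a)\<^sup>2)" for i
  define N where "N i = \<eta> * sqrt (g2 i)" for i
  have v: "\<theta>' i s a - \<theta> i s a = \<eta> * grad_J G i \<theta> s a" if "i \<in> Ag" "s \<in> S" "a \<in> acts G i" for i s a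
    using step[OF that] by (simp add: \<eta>_def)
  have g2_nonneg: "0 \<le> g2 i" for i unfolding g2_def by (intro sum_nonneg) auto
  have N_nonneg: "0 \<le> N i" for i using \<eta> g2_nonneg by (simp add: N_def)
  have N_sq: "(N i)\<^sup>2 = \<eta>\<^sup>2 * g2 i" for i using g2_nonneg by (simp add: N_def power_mult_distrib)
  have N: "\<bar>\<theta>' i s a - \<theta> i s a\<bar> \<le> N i" if "i \<in> Ag" "s \<in> S" "a \<in> acts G i" for i s a
  proof -
    have "(grad_J G i \<theta> s a)\<^sup>2 \<le> (\<Sum>a\<in>acts G i. (grad_J G i \<theta> s a)\<^sup>2)"
      using that by (intro member_le_sum) auto
    also have "\<dots> \<le> g2 i"
      unfolding g2_def using that by (intro member_le_sum[of s S "\<lambda>s. \<Sum>a\<in>acts G i. (grad_J G i \<theta> s a)\<^sup>2"]) (auto intro!: sum_nonneg)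
    finally have "\<bar>grad_J G i \<theta> s a\<bar> \<le> sqrt (g2 i)" by (rule real_le_rsqrt[of "\<bar>grad_J G i \<theta> s a\<bar>", unfolded power2_abs])
    then show ?thesis using \<eta> by (simp add: v[OF that] abs_mult N_def)
  qed
  have small: "\<bar>\<theta>' i s a - \<theta> i s a\<bar> \<le> 1 / 2" if "i \<in> Ag" "s \<in> S" "a \<in> acts G i" for i s a
  proof -
    have "\<bar>\<theta>' i s a - \<theta> i s a\<bar> \<le> \<eta> * (1 / (1 - \<gamma>)\<^sup>2)"
      unfolding v[OF that] using mult_left_mono[OF grad_J_abs_le[OF that, of \<theta>], of \<eta>] \<eta> by (simp add: abs_mult)
    also have "\<dots> = (1 - \<gamma>) / (6 * ?n)"
      using g by (simp add: \<eta>_def power2_eq_square power3_eq_cube)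
    also have "\<dots> \<le> 1 / 2" using g n by (simp add: field_simps)
    finally show ?thesis .
  qed
  \<comment> \<open>\<open>N j\<close> is the Euclidean norm of the move of agent \<open>j\<close>, and \<open>D\<close> their sum.\<close>
  define D where "D = (\<Sum>j\<in>Ag. N j)"
  have agent: "start_value G \<phi> (softmax G (hybrid \<theta>' \<theta> i)) - start_value G \<phi> (softmax G (hybrid \<theta>' \<theta> (i - 1)))
      \<ge> \<eta> * g2 i - (3 * N i * D + 2 * (N i)\<^sup>2) / (1 - \<gamma>) ^ 3" if i: "i \<in> Ag" for i
  proof -
    let ?h = "hybrid \<theta>' \<theta> (i - 1)" and ?h' = "hybrid \<theta>' \<theta> i"
    have "start_value G \<phi> (softmax G ?h') - start_value G \<phi> (softmax G ?h) = J_fun G i ?h' - J_fun G i ?h"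
      by (rule potential_start_value[OF pot i]) (rule hybrid_step)
    moreover have "\<bar>J_fun G i ?h' - J_fun G i ?h - first_order i \<theta> (\<lambda>j s a. \<theta>' j s a - \<theta> j s a)\<bar> \<le>
        (3 * N i * D + 2 * (N i)\<^sup>2) / (1 - \<gamma>) ^ 3"
      unfolding D_def
    proof (rule J_fun_first_order[where h = ?h and h' = ?h' and \<theta>' = \<theta>' and N = N, OF i])
      show "?h j = \<theta>' j \<or> ?h j = \<theta> j" for j by (rule hybrid_cases)
      show "?h i = \<theta> i" by (rule hybrid_prev[OF i])
      show "?h' i = \<theta>' i" by (rule hybrid_self)
      show "?h' j = ?h j" if "j \<noteq> i" for j using that by (rule hybrid_step)
      show "\<bar>\<theta>' i s a - \<theta> i s a\<bar> \<le> 1 / 2" if "s \<in> S" "a \<in> acts G i" for s a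
        by (rule small[OF i that])
      show "\<bar>\<theta>' j s a - \<theta> j s a\<bar> \<le> N j" if "j \<in> Ag" "s \<in> S" "a \<in> acts G j" for j s a
        by (rule N[OF that])
      show "0 \<le> N j" for j by (rule N_nonneg)
    qed
    moreover have "first_order i \<theta> (\<lambda>j s a. \<theta>' j s a - \<theta> j s a) = \<eta> * g2 i"
      unfolding first_order_def g2_def sum_distrib_left
      by (intro sum.cong refl) (simp add: v[OF i] power2_eq_square)
    ultimately show ?thesis by linarith
  qed
  have G: "grad_sq G \<theta> = (\<Sum>i\<in>Ag. g2 i)" by (simp add: grad_sq_def g2_def)
  \<comment> \<open>\<open>D\<^sup>2 \<le> n \<Sum>N\<^sub>i\<^sup>2\<close> turns the total error into \<open>(3 n + 2) \<Sum>N\<^sub>i\<^sup>2\<close>.\<close>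
  have D2: "D\<^sup>2 \<le> ?n * (\<Sum>i\<in>Ag. (N i)\<^sup>2)"
    using sum_squared_le_sum_of_squares[of N Ag] finite_Ag by (simp add: D_def card_Ag mult.commute)
  have N2: "(\<Sum>i\<in>Ag. (N i)\<^sup>2) = \<eta>\<^sup>2 * grad_sq G \<theta>"
    by (simp add: N_sq G sum_distrib_left)
  have "(\<Sum>i\<in>Ag. 3 * N i * D + 2 * (N i)\<^sup>2) = 3 * D\<^sup>2 + 2 * (\<Sum>i\<in>Ag. (N i)\<^sup>2)"
    by (simp add: sum.distrib sum_distrib_left[symmetric] sum_distrib_right[symmetric] mult.assoc
        D_def[symmetric] power2_eq_square)
  also have "\<dots> \<le> 5 * ?n * (\<Sum>i\<in>Ag. (N i)\<^sup>2)"
    using D2 mult_right_mono[OF n, of "\<Sum>i\<in>Ag. (N i)\<^sup>2"] by (simp add: sum_nonneg)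
  finally have err: "(\<Sum>i\<in>Ag. 3 * N i * D + 2 * (N i)\<^sup>2) \<le> 5 * ?n * (\<eta>\<^sup>2 * grad_sq G \<theta>)"
    unfolding N2 .
  have "\<eta> * grad_sq G \<theta> - 5 * ?n * (\<eta>\<^sup>2 * grad_sq G \<theta>) / (1 - \<gamma>) ^ 3 \<le>
      \<eta> * grad_sq G \<theta> - (\<Sum>i\<in>Ag. 3 * N i * D + 2 * (N i)\<^sup>2) / (1 - \<gamma>) ^ 3"
    using divide_right_mono[OF err, of "(1 - \<gamma>) ^ 3"] g by simp
  also have "\<dots> = (\<Sum>i\<in>Ag. \<eta> * g2 i - (3 * N i * D + 2 * (N i)\<^sup>2) / (1 - \<gamma>) ^ 3)"
    by (simp only: sum_subtractf G sum_distrib_left sum_divide_distrib)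
  also have "\<dots> \<le> start_value G \<phi> (softmax G \<theta>') - start_value G \<phi> (softmax G \<theta>)"
    by (subst hybrid_telescope[of "start_value G \<phi>"], rule sum_mono, rule agent)
  finally have "\<eta> * grad_sq G \<theta> - 5 * ?n * (\<eta>\<^sup>2 * grad_sq G \<theta>) / (1 - \<gamma>) ^ 3 \<le>
      start_value G \<phi> (softmax G \<theta>') - start_value G \<phi> (softmax G \<theta>)" .
  moreover have "\<eta> * grad_sq G \<theta> - 5 * ?n * (\<eta>\<^sup>2 * grad_sq G \<theta>) / (1 - \<gamma>) ^ 3 =
      (1 - \<gamma>) ^ 3 / (36 * ?n) * grad_sq G \<theta>"
  proof -
    have "5 * ?n * \<eta>\<^sup>2 / (1 - \<gamma>) ^ 3 = 5 / 6 * \<eta>"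
    proof -
      have "5 * m * (k / (6 * m))\<^sup>2 / k = 5 / 6 * (k / (6 * m))" if "0 < k" "0 < m" for k m :: real
        using that by (simp add: power2_eq_square)
      from this[of "(1 - \<gamma>) ^ 3" ?n] show ?thesis using n g by (simp add: \<eta>_def)
    qed
    then have "5 * ?n * (\<eta>\<^sup>2 * grad_sq G \<theta>) / (1 - \<gamma>) ^ 3 = 5 / 6 * \<eta> * grad_sq G \<theta>"
      by (metis (no_types, opaque_lifting) mult.assoc mult.commute times_divide_eq_right)
    then show ?thesis by (simp add: \<eta>_def)
  qed
  ultimately show ?thesis by simp
qed

text \<open>
  For a maximizing set \<open>B\<close> of actions, \<open>c d(s) / (1 - \<gamma>)\<close> times the largest advantage is at most the
  sum of the partial derivatives over \<open>B\<close>, and the square of a sum of at most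
  \<open>card (acts G i)\<close> terms is at most that number times the sum of squares.
\<close>

lemma NEgap_sq_le_grad_sq:
  assumes "0 < c" "c \<le> c_fun G \<theta>" and M: "\<And>s. s \<in> S \<Longrightarrow> 0 < visit G \<theta> s \<and> 1 / visit G \<theta> s \<le> M"
  shows "(NEgap G \<theta>)\<^sup>2 \<le> M\<^sup>2 / c\<^sup>2 * (real (MAX i\<in>Ag. card (acts G i)) * grad_sq G \<theta>)"
proof (rule NEgap_sq_le)
  let ?K = "real (MAX i\<in>Ag. card (acts G i))" and ?p = "softmax G \<theta>"
  have g: "0 < 1 - \<gamma>" using \<gamma>1 by simp
  have E0: "0 \<le> grad_sq G \<theta>" unfolding grad_sq_def by (intro sum_nonneg) auto
  show "0 \<le> M\<^sup>2 / c\<^sup>2 * (?K * grad_sq G \<theta>)" using E0 by simp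
  fix i s x assume i: "i \<in> Ag" and s: "s \<in> S" and x: "x \<in> acts G i"
  let ?d = "visit G \<theta> s" and ?A = "A_avg G i ?p s"
  have d: "0 < ?d" "1 / ?d \<le> M" using M[OF s] by auto
  have M0: "0 < M" using d by (metis divide_pos_pos less_le_trans zero_less_one)
  have root: "sqrt (M\<^sup>2 / c\<^sup>2 * (?K * grad_sq G \<theta>)) = M / c * sqrt (?K * grad_sq G \<theta>)"
    using M0 assms(1) by (simp add: real_sqrt_mult real_sqrt_divide)
  obtain B where B: "B \<subseteq> acts G i" "B \<noteq> {}" "c_fun G \<theta> \<le> (\<Sum>a\<in>B. ?p i s a)"
    "\<And>a x. a \<in> B \<Longrightarrow> x \<in> acts G i \<Longrightarrow> ?A x \<le> ?A a"
    by (rule c_fun_le[OF i s, of \<theta>]) blast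
  have finB: "finite B" using B(1) finite_acts[OF i] by (rule finite_subset)
  show "?A x / (1 - \<gamma>) \<le> sqrt (M\<^sup>2 / c\<^sup>2 * (?K * grad_sq G \<theta>))"
  proof (cases "0 \<le> ?A x")
    case False
    then have "?A x / (1 - \<gamma>) \<le> 0" using g by (simp add: divide_nonpos_pos)
    also have "0 \<le> sqrt (M\<^sup>2 / c\<^sup>2 * (?K * grad_sq G \<theta>))" using E0 by simp
    finally show ?thesis .
  next
    case True
    have "c * ?A x \<le> (\<Sum>a\<in>B. ?p i s a) * ?A x"
      using assms(2) B(3) True by (intro mult_right_mono) auto
    also have "\<dots> \<le> (\<Sum>a\<in>B. ?p i s a * ?A a)"
      unfolding sum_distrib_right using B(4) x
      by (intro sum_mono mult_left_mono dec_policy_nonneg softmax_dec) auto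
    finally have "?d / (1 - \<gamma>) * (c * ?A x) \<le> ?d / (1 - \<gamma>) * (\<Sum>a\<in>B. ?p i s a * ?A a)"
      using d g by (intro mult_left_mono) auto
    also have "\<dots> = (\<Sum>a\<in>B. grad_J G i \<theta> s a)"
      unfolding sum_distrib_left using B(1)
      by (intro sum.cong refl) (auto simp: grad_J_eq[OF i s] visit_visit_prob subset_eq)
    also have "\<dots> \<le> sqrt (?K * grad_sq G \<theta>)"
    proof (rule real_le_rsqrt)
      have "(\<Sum>a\<in>B. grad_J G i \<theta> s a)\<^sup>2 \<le> (\<Sum>a\<in>B. (grad_J G i \<theta> s a)\<^sup>2) * card B"
        using finB by (intro sum_squared_le_sum_of_squares)
      also have "\<dots> \<le> grad_sq G \<theta> * ?K"
      proof (rule mult_mono)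
        have "(\<Sum>a\<in>B. (grad_J G i \<theta> s a)\<^sup>2) \<le> (\<Sum>a\<in>acts G i. (grad_J G i \<theta> s a)\<^sup>2)"
          using B(1) i by (intro sum_mono2) auto
        also have "\<dots> \<le> (\<Sum>s\<in>S. \<Sum>a\<in>acts G i. (grad_J G i \<theta> s a)\<^sup>2)"
          using s by (intro member_le_sum[of s S "\<lambda>s. \<Sum>a\<in>acts G i. (grad_J G i \<theta> s a)\<^sup>2"]) (auto intro!: sum_nonneg)
        also have "\<dots> \<le> grad_sq G \<theta>"
          unfolding grad_sq_def using i
          by (intro member_le_sum[of i Ag "\<lambda>i. \<Sum>s\<in>S. \<Sum>a\<in>acts G i. (grad_J G i \<theta> s a)\<^sup>2"]) (auto intro!: sum_nonneg)
        finally show "(\<Sum>a\<in>B. (grad_J G i \<theta> s a)\<^sup>2) \<le> grad_sq G \<theta>" .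
        have "card B \<le> card (acts G i)" using B(1) i by (intro card_mono) auto
        also have "\<dots> \<le> (MAX i\<in>Ag. card (acts G i))" using i by (intro Max_ge) auto
        finally show "real (card B) \<le> ?K" by simp
      qed (use E0 in auto)
      finally show "(\<Sum>a\<in>B. grad_J G i \<theta> s a)\<^sup>2 \<le> ?K * grad_sq G \<theta>" by (simp add: mult.commute)
    qed
    finally have "?d * c * (?A x / (1 - \<gamma>)) \<le> sqrt (?K * grad_sq G \<theta>)"
      by (simp add: mult_ac)
    then have "?A x / (1 - \<gamma>) \<le> 1 / ?d * (sqrt (?K * grad_sq G \<theta>) / c)"
      using d assms(1) by (simp add: field_simps)
    also have "\<dots> \<le> M * (sqrt (?K * grad_sq G \<theta>) / c)"
      using d assms(1) E0 by (intro mult_right_mono) auto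
    finally show ?thesis unfolding root by simp
  qed
qed

section \<open>Ascent along natural gradient play\<close>

text \<open>
  The mean advantage is multilinear in the distributions of the agents and vanishes at \<open>\<theta>\<close>.  Moving
  the agents one after the other, the \<open>i\<close>-th move is tested against the advantage averaged over
  partly moved opponents; replacing these by the unmoved ones costs \<open>\<delta>\<^sub>i\<close> times the total
  distance, times \<open>K\<close>.
\<close>

lemma multilinear_advantage_ge:
  fixes \<theta> \<theta>' :: param and \<phi> :: "nat \<Rightarrow> (nat \<Rightarrow> nat) \<Rightarrow> real"
  assumes pot: "potential G \<phi>" and s: "s \<in> S"
    and K: "\<And>a. a \<in> JA \<Longrightarrow> \<bar>A_fun G \<phi> (softmax G \<theta>) s a\<bar> \<le> K" "0 \<le> K"
  defines "\<delta> \<equiv> \<lambda>i. agent_dist G (softmax G \<theta>') (softmax G \<theta>) i s"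
  shows "(\<Sum>i\<in>Ag. \<Sum>x\<in>acts G i. (softmax G \<theta>' i s x - softmax G \<theta> i s x) * A_avg G i (softmax G \<theta>) s x)
      - (\<Sum>i\<in>Ag. \<delta> i)\<^sup>2 * K \<le>
    (\<Sum>a\<in>JA. joint_prob G (softmax G \<theta>') s a * A_fun G \<phi> (softmax G \<theta>) s a)"
proof -
  let ?\<pi> = "softmax G \<theta>" and ?q = "softmax G \<theta>'"
  let ?A = "A_fun G \<phi> ?\<pi>"
  define F where "F p = (\<Sum>a\<in>JA. joint_prob G p s a * ?A s a)" for p
  define D where "D = (\<Sum>i\<in>Ag. \<delta> i)"
  have F0: "F ?\<pi> = 0" unfolding F_def by (simp add: expected_A_fun softmax_dec s)
  have agent: "(\<Sum>x\<in>acts G i. (?q i s x - ?\<pi> i s x) * A_avg G i ?\<pi> s x) - \<delta> i * (D * K) \<le>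
      F (softmax G (hybrid \<theta>' \<theta> i)) - F (softmax G (hybrid \<theta>' \<theta> (i - 1)))" if i: "i \<in> Ag" for i
  proof -
    let ?h = "softmax G (hybrid \<theta>' \<theta> (i - 1))" and ?h' = "softmax G (hybrid \<theta>' \<theta> i)"
    let ?a = "\<lambda>p x. avg_others G i p ?A s x"
    have h'i: "?h' i s = ?q i s" by (rule softmax_cong) (simp add: hybrid_self)
    have hi: "?h i s = ?\<pi> i s" by (rule softmax_cong) (simp only: hybrid_prev[OF i])
    have Fh': "F ?h' = (\<Sum>x\<in>acts G i. ?q i s x * ?a ?h x)"
      unfolding F_def h'i[symmetric]
      by (rule joint_expectation_unilateral[OF i]) (rule softmax_cong, use hybrid_step in auto)
    have Fh: "F ?h = (\<Sum>x\<in>acts G i. ?\<pi> i s x * ?a ?h x)"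
      unfolding F_def hi[symmetric] by (rule joint_expectation_split[OF i])
    have dist: "(\<Sum>j\<in>Ag. agent_dist G ?h ?\<pi> j s) \<le> D"
      unfolding D_def
    proof (rule sum_mono)
      fix j assume "j \<in> Ag"
      have "?h j s = ?q j s \<or> ?h j s = ?\<pi> j s"
        using hybrid_cases[of \<theta>' \<theta> "i - 1" j] softmax_cong[of _ j s] by metis
      then show "agent_dist G ?h ?\<pi> j s \<le> \<delta> j"
        using agent_dist_nonneg[of ?q ?\<pi> j s] by (auto simp: \<delta>_def agent_dist_def)
    qed
    have near: "\<bar>?a ?h x - ?a ?\<pi> x\<bar> \<le> D * K" if "x \<in> acts G i" for x
      using avg_others_lipschitz[where F = ?A and B = K and \<pi>' = ?h and \<pi> = ?\<pi>,
          OF softmax_dec softmax_dec s i that K]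
        mult_right_mono[OF dist K(2)] by linarith
    have "(\<Sum>x\<in>acts G i. (?q i s x - ?\<pi> i s x) * A_avg G i ?\<pi> s x) - (F ?h' - F ?h) =
        (\<Sum>x\<in>acts G i. (?q i s x - ?\<pi> i s x) * (?a ?\<pi> x - ?a ?h x))"
      unfolding Fh Fh' sum_subtractf[symmetric]
      by (intro sum.cong refl) (simp add: potential_A_avg[OF pot i s] algebra_simps)
    also have "\<dots> \<le> (\<Sum>x\<in>acts G i. \<bar>?q i s x - ?\<pi> i s x\<bar> * (D * K))"
    proof (rule sum_mono)
      fix x assume x: "x \<in> acts G i"
      have "(?q i s x - ?\<pi> i s x) * (?a ?\<pi> x - ?a ?h x) \<le> \<bar>?q i s x - ?\<pi> i s x\<bar> * \<bar>?a ?\<pi> x - ?a ?h x\<bar>"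
        by (metis abs_ge_self abs_mult)
      also have "\<dots> \<le> \<bar>?q i s x - ?\<pi> i s x\<bar> * (D * K)"
        using near[OF x] by (intro mult_left_mono) auto
      finally show "(?q i s x - ?\<pi> i s x) * (?a ?\<pi> x - ?a ?h x) \<le> \<bar>?q i s x - ?\<pi> i s x\<bar> * (D * K)" .
    qed
    also have "\<dots> = \<delta> i * (D * K)" by (simp only: \<delta>_def agent_dist_def sum_distrib_right)
    finally show ?thesis by simp
  qed
  have "(\<Sum>i\<in>Ag. \<Sum>x\<in>acts G i. (?q i s x - ?\<pi> i s x) * A_avg G i ?\<pi> s x) - D\<^sup>2 * K =
      (\<Sum>i\<in>Ag. (\<Sum>x\<in>acts G i. (?q i s x - ?\<pi> i s x) * A_avg G i ?\<pi> s x) - \<delta> i * (D * K))"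
    by (simp add: sum_subtractf sum_distrib_right[symmetric] D_def[symmetric] power2_eq_square)
  also have "\<dots> \<le> (\<Sum>i\<in>Ag. F (softmax G (hybrid \<theta>' \<theta> i)) - F (softmax G (hybrid \<theta>' \<theta> (i - 1))))"
    by (rule sum_mono) (rule agent)
  also have "\<dots> = F ?q" unfolding hybrid_telescope[of F, symmetric] F0 by simp
  finally show ?thesis unfolding D_def F_def .
qed

text \<open>
  With \<open>gain i s\<close> the mean advantage of agent \<open>i\<close> after its own step, \<open>\<delta>\<^sub>i\<^sup>2\<close> is at most
  \<open>\<eta> gain i s / (1 - \<gamma>)\<close>.  The quadratic error in \<open>multilinear_advantage_ge\<close> is thus at most
  \<open>n \<eta> (\<phi>max - \<phi>min) / (1 - \<gamma>)\<^sup>2\<close> times the sum of the gains, which is one half of that sum by the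
  choice of \<open>\<eta>\<close>.  All gains are nonnegative, so a single agent and a single state can be singled
  out.
\<close>

lemma natural_gradient_step_ascent:
  assumes pot: "potential G \<phi>"
    and \<phi>: "\<And>s a. s \<in> S \<Longrightarrow> a \<in> JA \<Longrightarrow> \<phi>min \<le> \<phi> s a \<and> \<phi> s a \<le> \<phi>max" and less: "\<phi>min < \<phi>max"
  defines "\<eta> \<equiv> (1 - \<gamma>)\<^sup>2 / (2 * real (num_agents G) * (\<phi>max - \<phi>min))"
  assumes step: "\<And>i s a. i \<in> Ag \<Longrightarrow> s \<in> S \<Longrightarrow> a \<in> acts G i \<Longrightarrow>
      softmax G \<theta>' i s a = npg_weight G \<eta> i (softmax G \<theta>) s a /
        (\<Sum>b\<in>acts G i. npg_weight G \<eta> i (softmax G \<theta>) s b)"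
    and i: "i \<in> Ag" and s: "s \<in> S"
  shows "visit G \<theta>' s * \<eta> / (8 * (1 - \<gamma>)\<^sup>2) *
      (\<Sum>x\<in>acts G i. softmax G \<theta> i s x * (A_avg G i (softmax G \<theta>) s x)\<^sup>2) \<le>
    start_value G \<phi> (softmax G \<theta>') - start_value G \<phi> (softmax G \<theta>)"
proof -
  let ?\<pi> = "softmax G \<theta>" and ?q = "softmax G \<theta>'" and ?\<Delta> = "\<phi>max - \<phi>min" and ?n = "real (num_agents G)"
  have g: "0 < 1 - \<gamma>" using \<gamma>1 by simp
  have n: "1 \<le> ?n" using num_agents_pos by simp
  have \<Delta>: "0 < ?\<Delta>" using less by simp
  have \<eta>: "0 < \<eta>" using g n \<Delta> by (simp add: \<eta>_def)
  define x where "x i s a = \<eta> * A_avg G i ?\<pi> s a / (1 - \<gamma>)" for i s a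
  define gain where "gain i s = (\<Sum>a\<in>acts G i. ?q i s a * A_avg G i ?\<pi> s a)" for i s
  have A_fun: "\<bar>A_fun G \<phi> ?\<pi> s a\<bar> \<le> ?\<Delta> / (1 - \<gamma>)" if "s \<in> S" "a \<in> JA" for s a
    by (rule A_fun_abs_le[OF softmax_dec \<phi> that])
  have A_avg: "\<bar>A_avg G i ?\<pi> s a\<bar> \<le> ?\<Delta> / (1 - \<gamma>)" if "i \<in> Ag" "s \<in> S" "a \<in> acts G i" for i s a
    unfolding potential_A_avg[OF pot that, symmetric]
    by (rule abs_avg_others_le[OF softmax_dec that(2,1,3)]) (rule A_fun[OF that(2)])
  have x_small: "\<bar>x i s a\<bar> \<le> 1 / 2" if "i \<in> Ag" "s \<in> S" "a \<in> acts G i" for i s a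
  proof -
    have "\<bar>x i s a\<bar> = \<eta> / (1 - \<gamma>) * \<bar>A_avg G i ?\<pi> s a\<bar>"
      using \<eta> g by (simp add: x_def abs_mult)
    also have "\<dots> \<le> \<eta> / (1 - \<gamma>) * (?\<Delta> / (1 - \<gamma>))"
      using \<eta> g A_avg[OF that] by (intro mult_left_mono) auto
    also have "\<dots> = 1 / (2 * ?n)"
      using g \<Delta> n by (simp add: \<eta>_def power2_eq_square)
    also have "\<dots> \<le> 1 / 2" using n by (simp add: field_simps)
    finally show ?thesis .
  qed
  have tilt: "?q i s a = tilt (acts G i) (?\<pi> i s) (x i s) a" if "i \<in> Ag" "s \<in> S" "a \<in> acts G i" for i s a
    by (simp only: step[OF that] npg_weight_def tilt_def x_def)
  note tilt_prems = finite_acts acts_ne softmax_pos dec_policy_sum[OF softmax_dec]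
  have gain_eq: "gain i s = (\<Sum>a\<in>acts G i. (?q i s a - ?\<pi> i s a) * A_avg G i ?\<pi> s a)"
    if "i \<in> Ag" "s \<in> S" for i s
    using A_avg_mean_zero[OF softmax_dec that(2,1), of \<theta>] by (simp add: gain_def left_diff_distrib sum_subtractf)
  have x_gain: "(\<Sum>a\<in>acts G i. ?q i s a * x i s a) = \<eta> / (1 - \<gamma>) * gain i s" for i s
    by (simp add: gain_def x_def sum_distrib_left mult_ac)
  have x_zero: "(\<Sum>a\<in>acts G i. ?\<pi> i s a * x i s a) = 0" if "i \<in> Ag" "s \<in> S" for i s
  proof -
    have "(\<Sum>a\<in>acts G i. ?\<pi> i s a * x i s a) = \<eta> / (1 - \<gamma>) * (\<Sum>a\<in>acts G i. ?\<pi> i s a * A_avg G i ?\<pi> s a)"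
      by (simp add: x_def sum_distrib_left mult_ac)
    then show ?thesis using A_avg_mean_zero[OF softmax_dec that(2,1), of \<theta>] by simp
  qed
  have lower: "\<eta> / (4 * (1 - \<gamma>)) * (\<Sum>a\<in>acts G i. ?\<pi> i s a * (A_avg G i ?\<pi> s a)\<^sup>2) \<le> gain i s"
    if "i \<in> Ag" "s \<in> S" for i s
  proof -
    have "(\<Sum>a\<in>acts G i. ?\<pi> i s a * (x i s a)\<^sup>2) / 4 \<le> (\<Sum>a\<in>acts G i. tilt (acts G i) (?\<pi> i s) (x i s) a * x i s a)"
      using that by (intro tilt_gain_ge x_small x_zero tilt_prems)
    also have "\<dots> = \<eta> / (1 - \<gamma>) * gain i s"
      unfolding x_gain[symmetric] using that by (simp add: tilt)
    also have "(\<Sum>a\<in>acts G i. ?\<pi> i s a * (x i s a)\<^sup>2) / 4 =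
        \<eta> / (1 - \<gamma>) * (\<eta> / (4 * (1 - \<gamma>)) * (\<Sum>a\<in>acts G i. ?\<pi> i s a * (A_avg G i ?\<pi> s a)\<^sup>2))"
      by (simp add: x_def sum_distrib_left sum_divide_distrib power2_eq_square mult_ac)
    finally show ?thesis using \<eta> g by (subst (asm) mult_le_cancel_left_pos) auto
  qed
  have gain_nonneg: "0 \<le> gain i s" if "i \<in> Ag" "s \<in> S" for i s
  proof -
    have "0 \<le> \<eta> / (4 * (1 - \<gamma>)) * (\<Sum>a\<in>acts G i. ?\<pi> i s a * (A_avg G i ?\<pi> s a)\<^sup>2)"
      using \<eta> g by (intro mult_nonneg_nonneg sum_nonneg) (auto simp: dec_policy_nonneg softmax_dec)
    then show ?thesis using lower[OF that] by linarith
  qed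
  have dist_sq: "(agent_dist G ?q ?\<pi> i s)\<^sup>2 \<le> \<eta> / (1 - \<gamma>) * gain i s" if "i \<in> Ag" "s \<in> S" for i s
  proof -
    have "(\<Sum>a\<in>acts G i. \<bar>tilt (acts G i) (?\<pi> i s) (x i s) a - ?\<pi> i s a\<bar>)\<^sup>2 \<le>
        (\<Sum>a\<in>acts G i. (tilt (acts G i) (?\<pi> i s) (x i s) a - ?\<pi> i s a) * x i s a)"
      using that by (intro tilt_l1_sq_le tilt_prems)
    also have "\<dots> = (\<Sum>a\<in>acts G i. ?q i s a * x i s a) - (\<Sum>a\<in>acts G i. ?\<pi> i s a * x i s a)"
      using that by (simp add: tilt left_diff_distrib sum_subtractf)
    also have "\<dots> = \<eta> / (1 - \<gamma>) * gain i s" unfolding x_zero[OF that] x_gain by simp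
    also have "(\<Sum>a\<in>acts G i. \<bar>tilt (acts G i) (?\<pi> i s) (x i s) a - ?\<pi> i s a\<bar>) = agent_dist G ?q ?\<pi> i s"
      unfolding agent_dist_def by (intro sum.cong refl) (simp only: tilt[OF that])
    finally show ?thesis .
  qed
  have state: "(\<Sum>i\<in>Ag. gain i s) / 2 \<le> (\<Sum>a\<in>JA. joint_prob G ?q s a * A_fun G \<phi> ?\<pi> s a)"
    if s: "s \<in> S" for s
  proof -
    let ?\<delta> = "\<lambda>i. agent_dist G ?q ?\<pi> i s"
    have "(\<Sum>i\<in>Ag. ?\<delta> i)\<^sup>2 \<le> (\<Sum>i\<in>Ag. (?\<delta> i)\<^sup>2) * ?n"
      using sum_squared_le_sum_of_squares[of ?\<delta> Ag] by (simp add: card_Ag)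
    also have "\<dots> \<le> (\<Sum>i\<in>Ag. \<eta> / (1 - \<gamma>) * gain i s) * ?n"
      using dist_sq[OF _ s] by (intro mult_right_mono sum_mono) auto
    finally have "(\<Sum>i\<in>Ag. ?\<delta> i)\<^sup>2 * (?\<Delta> / (1 - \<gamma>)) \<le> (\<Sum>i\<in>Ag. \<eta> / (1 - \<gamma>) * gain i s) * ?n * (?\<Delta> / (1 - \<gamma>))"
      using \<Delta> g by (intro mult_right_mono) auto
    also have "\<dots> = \<eta> / (1 - \<gamma>) * ?n * (?\<Delta> / (1 - \<gamma>)) * (\<Sum>i\<in>Ag. gain i s)"
      unfolding sum_distrib_left[symmetric] by (simp only: mult_ac)
    also have "\<eta> / (1 - \<gamma>) * ?n * (?\<Delta> / (1 - \<gamma>)) = 1 / 2"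
      using g \<Delta> n by (simp add: \<eta>_def power2_eq_square)
    finally have "(\<Sum>i\<in>Ag. ?\<delta> i)\<^sup>2 * (?\<Delta> / (1 - \<gamma>)) \<le> 1 / 2 * (\<Sum>i\<in>Ag. gain i s)" .
    moreover have "(\<Sum>i\<in>Ag. gain i s) - (\<Sum>i\<in>Ag. ?\<delta> i)\<^sup>2 * (?\<Delta> / (1 - \<gamma>)) \<le>
        (\<Sum>a\<in>JA. joint_prob G ?q s a * A_fun G \<phi> ?\<pi> s a)"
      using multilinear_advantage_ge[OF pot s A_fun[OF s], of \<theta>'] \<Delta> g by (simp add: gain_eq s)
    ultimately show ?thesis by linarith
  qed
  let ?W = "\<Sum>a\<in>acts G i. ?\<pi> i s a * (A_avg G i ?\<pi> s a)\<^sup>2"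
  have "visit G \<theta>' s * \<eta> / (8 * (1 - \<gamma>)\<^sup>2) * ?W = 1 / (1 - \<gamma>) * (visit G \<theta>' s * (\<eta> / (4 * (1 - \<gamma>)) * ?W / 2))"
  proof -
    have "d * \<eta> / (8 * k\<^sup>2) * w = 1 / k * (d * (\<eta> / (4 * k) * w / 2))" for d k w :: real
      by (simp add: power2_eq_square)
    then show ?thesis .
  qed
  also have "\<dots> \<le> 1 / (1 - \<gamma>) * (visit_prob G ?q s * ((\<Sum>i\<in>Ag. gain i s) / 2))"
  proof -
    have "gain i s \<le> (\<Sum>i\<in>Ag. gain i s)"
      using i s gain_nonneg by (intro member_le_sum) auto
    then have "\<eta> / (4 * (1 - \<gamma>)) * ?W / 2 \<le> (\<Sum>i\<in>Ag. gain i s) / 2"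
      by (rule divide_right_mono[OF order_trans[OF lower[OF i s]]]) simp
    then show ?thesis unfolding visit_visit_prob
      using g by (intro mult_left_mono visit_prob_nonneg softmax_dec) auto
  qed
  also have "\<dots> \<le> 1 / (1 - \<gamma>) * (\<Sum>s\<in>S. visit_prob G ?q s * ((\<Sum>i\<in>Ag. gain i s) / 2))"
    using g s gain_nonneg
    by (intro mult_left_mono member_le_sum[of s S "\<lambda>s. visit_prob G ?q s * ((\<Sum>i\<in>Ag. gain i s) / 2)"])
       (auto intro!: mult_nonneg_nonneg sum_nonneg visit_prob_nonneg softmax_dec)
  also have "\<dots> \<le> 1 / (1 - \<gamma>) * (\<Sum>s\<in>S. visit_prob G ?q s * (\<Sum>a\<in>JA. joint_prob G ?q s a * A_fun G \<phi> ?\<pi> s a))"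
    using g state by (intro mult_left_mono sum_mono visit_prob_nonneg softmax_dec) auto
  also have "\<dots> = start_value G \<phi> ?q - start_value G \<phi> ?\<pi>"
    by (rule performance_difference[OF softmax_dec softmax_dec, symmetric])
  finally show ?thesis .
qed

text \<open>
  The maximizing actions have probability at least \<open>c\<close>, so the second moment of the averaged
  advantage is at least \<open>c\<close> times the square of its largest value.
\<close>

lemma NEgap_sq_le_natural_gradient_ascent:
  assumes "0 < c" "c \<le> c_fun G \<theta>" "0 < M" "0 < L"
    and ascent: "\<And>i s. i \<in> Ag \<Longrightarrow> s \<in> S \<Longrightarrow>
      L / M * (\<Sum>x\<in>acts G i. softmax G \<theta> i s x * (A_avg G i (softmax G \<theta>) s x)\<^sup>2) \<le> gain"
  shows "(NEgap G \<theta>)\<^sup>2 \<le> M / (L * c * (1 - \<gamma>)\<^sup>2) * gain"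
proof (rule NEgap_sq_le)
  let ?p = "softmax G \<theta>"
  have g: "0 < 1 - \<gamma>" using \<gamma>1 by simp
  have bound: "L / M * (c * (A_avg G i ?p s x)\<^sup>2) \<le> gain"
    if i: "i \<in> Ag" and s: "s \<in> S" and x: "x \<in> acts G i" and pos: "0 \<le> A_avg G i ?p s x" for i s x
  proof -
    let ?A = "A_avg G i ?p s"
    obtain B where B: "B \<subseteq> acts G i" "B \<noteq> {}" "c_fun G \<theta> \<le> (\<Sum>a\<in>B. ?p i s a)"
      "\<And>a x. a \<in> B \<Longrightarrow> x \<in> acts G i \<Longrightarrow> ?A x \<le> ?A a"
      by (rule c_fun_le[OF i s, of \<theta>]) blast
    have "c * (?A x)\<^sup>2 \<le> (\<Sum>a\<in>B. ?p i s a) * (?A x)\<^sup>2"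
      using assms(2) B(3) by (intro mult_right_mono) auto
    also have "\<dots> \<le> (\<Sum>a\<in>B. ?p i s a * (?A a)\<^sup>2)"
      unfolding sum_distrib_right
    proof (rule sum_mono)
      fix a assume "a \<in> B"
      then have "(?A x)\<^sup>2 \<le> (?A a)\<^sup>2" using B(4) x pos by (intro power_mono) auto
      then show "?p i s a * (?A x)\<^sup>2 \<le> ?p i s a * (?A a)\<^sup>2"
        by (rule mult_left_mono) (rule dec_policy_nonneg[OF softmax_dec])
    qed
    also have "\<dots> \<le> (\<Sum>a\<in>acts G i. ?p i s a * (?A a)\<^sup>2)"
      using B(1) i by (intro sum_mono2) (auto simp: dec_policy_nonneg softmax_dec)
    finally have "L / M * (c * (?A x)\<^sup>2) \<le> L / M * (\<Sum>a\<in>acts G i. ?p i s a * (?A a)\<^sup>2)"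
      using assms(3,4) by (intro mult_left_mono) auto
    also have "\<dots> \<le> gain" by (rule ascent[OF i s])
    finally show ?thesis .
  qed
  have gain: "0 \<le> gain"
  proof -
    obtain i s where i: "i \<in> Ag" and s: "s \<in> S" using Ag_ne S_ne by blast
    have "0 \<le> L / M * (\<Sum>x\<in>acts G i. ?p i s x * (A_avg G i ?p s x)\<^sup>2)"
      using assms(3,4) by (intro mult_nonneg_nonneg sum_nonneg) (auto simp: dec_policy_nonneg softmax_dec)
    then show ?thesis using ascent[OF i s] by linarith
  qed
  show R: "0 \<le> M / (L * c * (1 - \<gamma>)\<^sup>2) * gain" using gain assms(1,3,4) by simp
  fix i s x assume asm: "i \<in> Ag" "s \<in> S" "x \<in> acts G i"
  let ?a = "A_avg G i ?p s x"
  show "?a / (1 - \<gamma>) \<le> sqrt (M / (L * c * (1 - \<gamma>)\<^sup>2) * gain)"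
  proof (cases "0 \<le> ?a")
    case False
    then have "?a / (1 - \<gamma>) \<le> 0" using g by (simp add: divide_nonpos_pos)
    also have "0 \<le> sqrt (M / (L * c * (1 - \<gamma>)\<^sup>2) * gain)" using R by simp
    finally show ?thesis .
  next
    case True
    have "(?a / (1 - \<gamma>))\<^sup>2 \<le> M / (L * c * (1 - \<gamma>)\<^sup>2) * gain"
    proof -
      have "(?a / (1 - \<gamma>))\<^sup>2 = M / (L * c * (1 - \<gamma>)\<^sup>2) * (L / M * (c * ?a\<^sup>2))"
        using assms(1,3,4) by (simp add: power_divide)
      also have "\<dots> \<le> M / (L * c * (1 - \<gamma>)\<^sup>2) * gain"
        using assms(1,3,4) by (intro mult_left_mono bound[OF asm True]) auto
      finally show ?thesis .
    qed
    then show ?thesis by (rule real_le_rsqrt)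
  qed
qed

section \<open>Convergence rates\<close>

lemma start_value_range:
  assumes \<phi>: "\<And>s a. s \<in> S \<Longrightarrow> a \<in> JA \<Longrightarrow> \<phi>min \<le> \<phi> s a \<and> \<phi> s a \<le> \<phi>max"
    and "\<pi> \<in> dec_policies G" "\<pi>' \<in> dec_policies G"
  shows "start_value G \<phi> \<pi>' - start_value G \<phi> \<pi> \<le> (\<phi>max - \<phi>min) / (1 - \<gamma>)"
proof -
  have "start_value G \<phi> \<pi>' - start_value G \<phi> \<pi> =
      (\<Sum>s\<in>S. pmf (init_dist G) s * (V_fun G \<phi> \<pi>' s - V_fun G \<phi> \<pi> s))"
    by (simp add: start_value_def right_diff_distrib sum_subtractf)
  also have "\<dots> \<le> (\<Sum>s\<in>S. pmf (init_dist G) s * ((\<phi>max - \<phi>min) / (1 - \<gamma>)))"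
  proof (intro sum_mono mult_left_mono pmf_nonneg)
    fix s assume s: "s \<in> S"
    have "V_fun G \<phi> \<pi>' s \<le> \<phi>max / (1 - \<gamma>)" using \<phi> by (intro V_fun_le assms s) auto
    moreover have "\<phi>min / (1 - \<gamma>) \<le> V_fun G \<phi> \<pi> s" using \<phi> by (intro V_fun_ge assms s) auto
    ultimately show "V_fun G \<phi> \<pi>' s - V_fun G \<phi> \<pi> s \<le> (\<phi>max - \<phi>min) / (1 - \<gamma>)"
      by (simp add: diff_divide_distrib)
  qed
  also have "\<dots> = (\<phi>max - \<phi>min) / (1 - \<gamma>)"
    by (simp only: sum_distrib_right[symmetric] init_sum mult_1)
  finally show ?thesis .
qed

lemma average_NEgap_sq_le:
  assumes \<phi>: "\<And>s a. s \<in> S \<Longrightarrow> a \<in> JA \<Longrightarrow> \<phi>min \<le> \<phi> s a \<and> \<phi> s a \<le> \<phi>max"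
    and "0 \<le> K" and step: "\<And>t. (NEgap G (\<theta> t))\<^sup>2 \<le>
      K * (start_value G \<phi> (softmax G (\<theta> (Suc t))) - start_value G \<phi> (softmax G (\<theta> t)))"
  shows "1 / real T * (\<Sum>t<T. (NEgap G (\<theta> t))\<^sup>2) \<le> K * (\<phi>max - \<phi>min) / ((1 - \<gamma>) * real T)"
proof -
  let ?\<Phi> = "\<lambda>t. start_value G \<phi> (softmax G (\<theta> t))"
  have "(\<Sum>t<T. (NEgap G (\<theta> t))\<^sup>2) \<le> (\<Sum>t<T. K * (?\<Phi> (Suc t) - ?\<Phi> t))"
    by (rule sum_mono) (rule step)
  also have "\<dots> = K * (?\<Phi> T - ?\<Phi> 0)"
    unfolding sum_distrib_left[symmetric] sum_lessThan_telescope[of ?\<Phi>] ..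
  also have "\<dots> \<le> K * ((\<phi>max - \<phi>min) / (1 - \<gamma>))"
    using \<open>0 \<le> K\<close> by (intro mult_left_mono start_value_range \<phi> softmax_dec)
  finally have "1 / real T * (\<Sum>t<T. (NEgap G (\<theta> t))\<^sup>2) \<le> 1 / real T * (K * ((\<phi>max - \<phi>min) / (1 - \<gamma>)))"
    by (intro mult_left_mono) auto
  then show ?thesis by (simp add: mult_ac)
qed

lemma visit_lower_bound:
  assumes "(INF \<theta>'::param. MIN s\<in>S. visit G \<theta>' s) > 0" "s \<in> S"
  defines "M \<equiv> (SUP \<theta>'::param. MAX s\<in>S. 1 / visit G \<theta>' s)"
  shows "0 < visit G \<theta> s" "1 / visit G \<theta> s \<le> M"
proof -
  let ?m = "INF \<theta>'::param. MIN s\<in>S. visit G \<theta>' s"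
  have nonneg: "0 \<le> (MIN s\<in>S. visit G \<theta>' s)" for \<theta>'
    using S_ne by (auto simp: visit_visit_prob visit_prob_nonneg softmax_dec)
  have lower: "?m \<le> visit G \<theta>' s" if "s \<in> S" for \<theta>' s
  proof -
    have "?m \<le> (MIN s\<in>S. visit G \<theta>' s)"
      by (rule cINF_lower) (auto intro!: bdd_belowI[where m=0] nonneg)
    also have "\<dots> \<le> visit G \<theta>' s" using that by (intro Min_le) auto
    finally show ?thesis .
  qed
  show "0 < visit G \<theta> s" using lower[OF assms(2)] assms(1) by (rule less_le_trans[rotated])
  have "1 / visit G \<theta> s \<le> (MAX s\<in>S. 1 / visit G \<theta> s)" using assms(2) by (intro Max_ge) auto
  also have "\<dots> \<le> M"
    unfolding M_def
  proof (rule cSUP_upper)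
    have "(MAX s\<in>S. 1 / visit G \<theta>' s) \<le> 1 / ?m" for \<theta>'
    proof (intro Max.boundedI)
      fix y assume "y \<in> (\<lambda>s. 1 / visit G \<theta>' s) ` S"
      then obtain s where "s \<in> S" "y = 1 / visit G \<theta>' s" by auto
      then show "y \<le> 1 / ?m"
        using lower[of s \<theta>'] assms(1) less_le_trans[OF assms(1) lower[of s \<theta>']] by (simp add: frac_le)
    qed (use S_ne in auto)
    then show "bdd_above (range (\<lambda>\<theta>'::param. MAX s\<in>S. 1 / visit G \<theta>' s))"
      by (auto intro!: bdd_aboveI[where M="1 / ?m"])
  qed simp
  finally show "1 / visit G \<theta> s \<le> M" .
qed

lemma gradient_play_rate:
  assumes pot: "potential G \<phi>"
    and \<phi>: "\<And>s a. s \<in> S \<Longrightarrow> a \<in> JA \<Longrightarrow> \<phi>min \<le> \<phi> s a \<and> \<phi> s a \<le> \<phi>max"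
    and visit: "\<And>t s. s \<in> S \<Longrightarrow> 0 < visit G (\<theta> t) s \<and> 1 / visit G (\<theta> t) s \<le> M"
    and c: "0 < c" "\<And>t. c \<le> c_fun G (\<theta> t)"
    and play: "gradient_play G ((1 - \<gamma>) ^ 3 / (6 * real (num_agents G))) \<theta>"
  shows "1 / real T * (\<Sum>t<T. (NEgap G (\<theta> t))\<^sup>2) \<le>
    36 * (real (num_agents G) * real (MAX i\<in>Ag. card (acts G i)) * (\<phi>max - \<phi>min) * M\<^sup>2
      / ((1 - \<gamma>) ^ 4 * c\<^sup>2 * real T))"
proof -
  let ?n = "real (num_agents G)" and ?A = "real (MAX i\<in>Ag. card (acts G i))"
  let ?\<Phi> = "\<lambda>t. start_value G \<phi> (softmax G (\<theta> t))"
  have g: "0 < 1 - \<gamma>" using \<gamma>1 by simp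
  have n: "0 < ?n" using num_agents_pos by simp
  define K where "K = M\<^sup>2 / c\<^sup>2 * (?A * (36 * ?n / (1 - \<gamma>) ^ 3))"
  have step: "(NEgap G (\<theta> t))\<^sup>2 \<le> K * (?\<Phi> (Suc t) - ?\<Phi> t)" for t
  proof -
    have "(1 - \<gamma>) ^ 3 / (36 * ?n) * grad_sq G (\<theta> t) \<le> ?\<Phi> (Suc t) - ?\<Phi> t"
      by (rule gradient_step_ascent[OF pot]) (use play in \<open>auto simp: gradient_play_def\<close>)
    then have "grad_sq G (\<theta> t) \<le> 36 * ?n / (1 - \<gamma>) ^ 3 * (?\<Phi> (Suc t) - ?\<Phi> t)"
      using g n by (simp add: field_simps)
    then have "M\<^sup>2 / c\<^sup>2 * (?A * grad_sq G (\<theta> t)) \<le> M\<^sup>2 / c\<^sup>2 * (?A * (36 * ?n / (1 - \<gamma>) ^ 3 * (?\<Phi> (Suc t) - ?\<Phi> t)))"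
      by (intro mult_left_mono) auto
    with NEgap_sq_le_grad_sq[OF c(1) c(2) visit, of t]
    show ?thesis by (simp add: K_def mult.assoc)
  qed
  have K0: "0 \<le> K" using g n by (simp add: K_def)
  have "1 / real T * (\<Sum>t<T. (NEgap G (\<theta> t))\<^sup>2) \<le> K * (\<phi>max - \<phi>min) / ((1 - \<gamma>) * real T)"
    by (rule average_NEgap_sq_le[where \<phi> = \<phi> and \<theta> = \<theta>, OF \<phi> K0 step])
  also have "\<dots> = 36 * (?n * ?A * (\<phi>max - \<phi>min) * M\<^sup>2 / ((1 - \<gamma>) ^ 4 * c\<^sup>2 * real T))"
    by (simp add: K_def power4_eq_xxxx power3_eq_cube mult_ac)
  finally show ?thesis .
qed

lemma natural_gradient_play_rate:
  assumes pot: "potential G \<phi>"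
    and \<phi>: "\<And>s a. s \<in> S \<Longrightarrow> a \<in> JA \<Longrightarrow> \<phi>min \<le> \<phi> s a \<and> \<phi> s a \<le> \<phi>max" and less: "\<phi>min < \<phi>max"
    and visit: "\<And>t s. s \<in> S \<Longrightarrow> 0 < visit G (\<theta> t) s \<and> 1 / visit G (\<theta> t) s \<le> M"
    and c: "0 < c" "\<And>t. c \<le> c_fun G (\<theta> t)"
    and play: "natural_gradient_play G ((1 - \<gamma>)\<^sup>2 / (2 * real (num_agents G) * (\<phi>max - \<phi>min))) \<theta>"
  shows "1 / real T * (\<Sum>t<T. (NEgap G (\<theta> t))\<^sup>2) \<le>
    16 * (real (num_agents G) * (\<phi>max - \<phi>min)\<^sup>2 * M / ((1 - \<gamma>) ^ 3 * c * real T))"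
proof -
  let ?n = "real (num_agents G)" and ?\<Delta> = "\<phi>max - \<phi>min"
  let ?\<Phi> = "\<lambda>t. start_value G \<phi> (softmax G (\<theta> t))"
  define \<eta> where "\<eta> = (1 - \<gamma>)\<^sup>2 / (2 * ?n * ?\<Delta>)"
  have g: "0 < 1 - \<gamma>" using \<gamma>1 by simp
  have n: "0 < ?n" using num_agents_pos by simp
  have \<Delta>: "0 < ?\<Delta>" using less by simp
  have \<eta>: "0 < \<eta>" using g n \<Delta> by (simp add: \<eta>_def)
  have M: "0 < M"
  proof -
    obtain s where "s \<in> S" using S_ne by blast
    from visit[OF this, of 0] show ?thesis by (metis divide_pos_pos less_le_trans zero_less_one)
  qed
  define L where "L = \<eta> / (8 * (1 - \<gamma>)\<^sup>2)"
  have L: "0 < L" using \<eta> g by (simp add: L_def)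
  have step: "(NEgap G (\<theta> t))\<^sup>2 \<le> M / (L * c * (1 - \<gamma>)\<^sup>2) * (?\<Phi> (Suc t) - ?\<Phi> t)" for t
  proof (rule NEgap_sq_le_natural_gradient_ascent[OF c(1) c(2) M L])
    fix i s assume i: "i \<in> Ag" and s: "s \<in> S"
    let ?W = "\<Sum>x\<in>acts G i. softmax G (\<theta> t) i s x * (A_avg G i (softmax G (\<theta> t)) s x)\<^sup>2"
    have "1 / M \<le> visit G (\<theta> (Suc t)) s"
      using visit[OF s, of "Suc t"] M by (auto simp: pos_divide_le_eq mult.commute)
    then have "1 / M * (L * ?W) \<le> visit G (\<theta> (Suc t)) s * (L * ?W)"
      using L by (intro mult_right_mono mult_nonneg_nonneg sum_nonneg) (auto simp: dec_policy_nonneg softmax_dec)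
    also have "\<dots> = visit G (\<theta> (Suc t)) s * \<eta> / (8 * (1 - \<gamma>)\<^sup>2) * ?W" by (simp add: L_def)
    also have "\<dots> \<le> ?\<Phi> (Suc t) - ?\<Phi> t"
      unfolding \<eta>_def
      by (rule natural_gradient_step_ascent[OF pot \<phi> less _ i s])
         (use play in \<open>auto simp: natural_gradient_play_def\<close>)
    finally show "L / M * ?W \<le> ?\<Phi> (Suc t) - ?\<Phi> t" by simp
  qed
  have K0: "0 \<le> M / (L * c * (1 - \<gamma>)\<^sup>2)" using M L c(1) by simp
  have "1 / real T * (\<Sum>t<T. (NEgap G (\<theta> t))\<^sup>2) \<le>
      M / (L * c * (1 - \<gamma>)\<^sup>2) * ?\<Delta> / ((1 - \<gamma>) * real T)"
    by (rule average_NEgap_sq_le[where \<phi> = \<phi> and \<theta> = \<theta>, OF \<phi> K0 step])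
  also have "M / (L * c * (1 - \<gamma>)\<^sup>2) = 16 * ?n * ?\<Delta> * M / ((1 - \<gamma>)\<^sup>2 * c)"
    using g n \<Delta> by (simp add: L_def \<eta>_def mult_ac)
  also have "16 * ?n * ?\<Delta> * M / ((1 - \<gamma>)\<^sup>2 * c) * ?\<Delta> / ((1 - \<gamma>) * real T) =
      16 * (?n * ?\<Delta>\<^sup>2 * M / ((1 - \<gamma>) ^ 3 * c * real T))"
    by (simp add: power2_eq_square power3_eq_cube mult_ac)
  finally show ?thesis .
qed

end

theorem theorem5:
  shows "\<exists>C::real. C > 0 \<and>
    (\<forall>(G::stochastic_game) (\<phi>::nat \<Rightarrow> (nat \<Rightarrow> nat) \<Rightarrow> real) (\<phi>min::real) (\<phi>max::real)
        (M::real) (\<theta>::nat \<Rightarrow> param) (c::real).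
      is_game G \<longrightarrow>
      potential G \<phi> \<longrightarrow>
      (\<forall>s\<in>states G. \<forall>a\<in>joint_acts G. \<phi>min \<le> \<phi> s a \<and> \<phi> s a \<le> \<phi>max) \<longrightarrow>
      \<phi>min < \<phi>max \<longrightarrow>
      (INF \<theta>'::param. MIN s\<in>states G. visit G \<theta>' s) > 0 \<longrightarrow>
      (\<forall>\<pi>\<in>stationary_policies G. \<pi> isolated_in stationary_policies G) \<longrightarrow>
      M = (SUP \<theta>'::param. MAX s\<in>states G. 1 / visit G \<theta>' s) \<longrightarrow>
      c = (INF t. c_fun G (\<theta> t)) \<longrightarrow>
      \<comment> \<open>for \<open>c = 0\<close> the right-hand sides below are read as \<open>\<infinity>\<close>\<close>
      c \<noteq> 0 \<longrightarrow>
      (gradient_play G ((1 - discount G) ^ 3 / (6 * real (num_agents G))) \<theta> \<longrightarrow>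
        (\<forall>T\<ge>1. (1 / real T) * (\<Sum>t<T. (NEgap G (\<theta> t))\<^sup>2) \<le>
          C * (real (num_agents G) * real (MAX i\<in>agents G. card (acts G i)) * (\<phi>max - \<phi>min) * M\<^sup>2
               / ((1 - discount G) ^ 4 * c\<^sup>2 * real T)))) \<and>
      (natural_gradient_play G
          ((1 - discount G)\<^sup>2 / (2 * real (num_agents G) * (\<phi>max - \<phi>min))) \<theta> \<longrightarrow>
        (\<forall>T\<ge>1. (1 / real T) * (\<Sum>t<T. (NEgap G (\<theta> t))\<^sup>2) \<le>
          C * (real (num_agents G) * (\<phi>max - \<phi>min)\<^sup>2 * M
               / ((1 - discount G) ^ 3 * c * real T)))))"
proof (intro exI[of _ 36] conjI allI impI)
  fix G :: stochastic_game and \<phi> :: "nat \<Rightarrow> (nat \<Rightarrow> nat) \<Rightarrow> real" and \<phi>min \<phi>max M c :: real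
    and \<theta> :: "nat \<Rightarrow> param" and T :: nat
  assume "is_game G" and pot: "potential G \<phi>"
    and \<phi>: "\<forall>s\<in>states G. \<forall>a\<in>joint_acts G. \<phi>min \<le> \<phi> s a \<and> \<phi> s a \<le> \<phi>max" and less: "\<phi>min < \<phi>max"
    and inf: "(INF \<theta>'::param. MIN s\<in>states G. visit G \<theta>' s) > 0"
    and M: "M = (SUP \<theta>'::param. MAX s\<in>states G. 1 / visit G \<theta>' s)"
    and c: "c = (INF t. c_fun G (\<theta> t))" "c \<noteq> 0"
  interpret game G by standard fact
  have range: "\<And>s a. s \<in> S \<Longrightarrow> a \<in> JA \<Longrightarrow> \<phi>min \<le> \<phi> s a \<and> \<phi> s a \<le> \<phi>max" using \<phi> by blast
  have visit: "0 < visit G (\<theta> t) s \<and> 1 / visit G (\<theta> t) s \<le> M" if "s \<in> S" for t s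
    unfolding M using visit_lower_bound[OF inf that] by blast
  have c_le: "c \<le> c_fun G (\<theta> t)" for t
    unfolding c by (rule cINF_lower) (auto intro!: bdd_belowI[where m=0] c_fun_nonneg)
  have "0 \<le> c" unfolding c by (rule cINF_greatest) (auto simp: c_fun_nonneg)
  then have c_pos: "0 < c" using c(2) by simp
  {
    assume play: "gradient_play G ((1 - discount G) ^ 3 / (6 * real (num_agents G))) \<theta>"
    show "1 / real T * (\<Sum>t<T. (NEgap G (\<theta> t))\<^sup>2) \<le>
        36 * (real (num_agents G) * real (MAX i\<in>agents G. card (acts G i)) * (\<phi>max - \<phi>min) * M\<^sup>2
          / ((1 - discount G) ^ 4 * c\<^sup>2 * real T))"
      by (rule gradient_play_rate[where \<theta> = \<theta> and \<phi> = \<phi>, OF pot range visit c_pos c_le play])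
  next
    assume play: "natural_gradient_play G
        ((1 - discount G)\<^sup>2 / (2 * real (num_agents G) * (\<phi>max - \<phi>min))) \<theta>"
    have "1 / real T * (\<Sum>t<T. (NEgap G (\<theta> t))\<^sup>2) \<le>
        16 * (real (num_agents G) * (\<phi>max - \<phi>min)\<^sup>2 * M / ((1 - discount G) ^ 3 * c * real T))"
      by (rule natural_gradient_play_rate[where \<theta> = \<theta> and \<phi> = \<phi>, OF pot range less visit c_pos c_le play])
    also have "\<dots> \<le>
        36 * (real (num_agents G) * (\<phi>max - \<phi>min)\<^sup>2 * M / ((1 - discount G) ^ 3 * c * real T))"
    proof (rule mult_right_mono)
      obtain s where "s \<in> S" using S_ne by blast
      then have "0 < M" using visit[of s 0] by (metis divide_pos_pos less_le_trans zero_less_one)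
      then show "0 \<le> real (num_agents G) * (\<phi>max - \<phi>min)\<^sup>2 * M / ((1 - discount G) ^ 3 * c * real T)"
        using c_pos \<gamma>1 by simp
    qed simp
    finally show "1 / real T * (\<Sum>t<T. (NEgap G (\<theta> t))\<^sup>2) \<le>
        36 * (real (num_agents G) * (\<phi>max - \<phi>min)\<^sup>2 * M / ((1 - discount G) ^ 3 * c * real T))" .
  }
qed simp

end
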